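(* Let $f$ be a smooth strictly convex function on a domain $\Omega\subset\mathbb{R}^3$, and let $M=\{(x,f(x)) : x\in\Omega\}$ be its graph. Suppose that the cubic form (Fubini-Pick form) $A$ of $M$ is parallel, i.e. $\nabla A=0$, where $\nabla$ is the Levi-Civita connection of the Calabi metric $G$ of $M$. Then $M$ is Calabi affine equivalent to an open part of one of the following three types of hypersurfaces: (i) the elliptic paraboloid; or (ii) one of the hypersurfaces $Q(c_1,\dots,c_r;3)$, with $1\le r\le 3$ and $c_1,\dots,c_r>0$; or (iii) the hypersurface $$x_4=-\frac{1}{2c^2}\ln\bigl(x_1^2-(x_2^2+x_3^2)\bigr),$$ where the constant $-2c^2$ ($c>0$) is the scalar curvature of $M$ with respect to $G$.
   Context: A domain is a nonempty connected open set; strictly convex means that the Hessian matrix $(f_{ij})=(\partial^2 f/\partial x_i\partial x_j)$ is positive definite everywhere. For $n=3$: the Calabi metric of the graph $M=\{(x,f(x)):x\in\Omega\}$ is the Riemannian metric $G=\sum_{i,j} f_{ij}\,dx_i\,dx_j$ (on $\Omega$, equivalently on $M$, using $(x_1,\dots,x_n)$ as global coordinates). The cubic form (Fubini-Pick form) is the totally symmetric $(0,3)$-tensor $A$ with components $A_{ijk}=-\tfrac12\,\partial^3 f/\partial x_i\partial x_j\partial x_k$ in the coordinates $(x_1,\dots,x_n)$. Scalar curvature is the full trace of the Ricci tensor, with the sign convention that hyperbolic space has negative scalar curvature. Two graph hypersurfaces in $\mathbb{R}^{n+1}$ are Calabi affine equivalent if one is the image of the other under an affine transformation of $\mathbb{R}^{n+1}$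 of the form $X\mapsto \begin{pmatrix} P & 0\\ q & 1\end{pmatrix}X+b$ with $P\in GL(n,\mathbb{R})$, $q$ a constant row vector of length $n$, and $b\in\mathbb{R}^{n+1}$ (that is, an affine transformation whose linear part fixes $Y=(0,\dots,0,1)^t$). The elliptic paraboloid is the graph of $x_{n+1}=\tfrac12\sum_{i=1}^n x_i^2$ over $\mathbb{R}^n$. For $1\le r\le n$ and positive numbers $c_1,\dots,c_r$, the hypersurface $Q(c_1,\dots,c_r;n)$ is the graph of $$x_{n+1}=-\sum_{i=1}^r c_i\ln x_i+\sum_{j=r+1}^n\tfrac12x_j^2$$ over $\{(x_1,\dots,x_n): x_1>0,\dots,x_r>0\}$. The hypersurface in (iii) is the graph over the cone $\{x_1>\sqrt{x_2^2+x_3^2}\}$. *)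

theory Defs
  imports "HOL-Analysis.Analysis"
begin

section \<open>Partial derivatives and smooth functions on open sets\<close>

definition partial :: "'n::finite \<Rightarrow> (real^'n \<Rightarrow> real) \<Rightarrow> real^'n \<Rightarrow> real" where
  "partial i f x = frechet_derivative f (at x) (axis i 1)"

primrec Ck_on :: "nat \<Rightarrow> (real^'n::finite) set \<Rightarrow> (real^'n \<Rightarrow> real) \<Rightarrow> bool" where
  "Ck_on 0 S f \<longleftrightarrow> continuous_on S f"
| "Ck_on (Suc k) S f \<longleftrightarrow> (\<forall>x\<in>S. f differentiable (at x)) \<and> (\<forall>i. Ck_on k S (partial i f))"

definition smooth_on :: "(real^'n::finite) set \<Rightarrow> (real^'n \<Rightarrow> real) \<Rightarrow> bool" where
  "smooth_on S f \<longleftrightarrow> (\<forall>k. Ck_on k S f)"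

definition is_domain :: "'a::topological_space set \<Rightarrow> bool" where
  "is_domain S \<longleftrightarrow> S \<noteq> {} \<and> connected S \<and> open S"

definition hessian :: "(real^'n::finite \<Rightarrow> real) \<Rightarrow> real^'n \<Rightarrow> real^'n^'n" where
  "hessian f x = (\<chi> i j. partial i (partial j f) x)"

definition positive_definite :: "real^'n::finite^'n \<Rightarrow> bool" where
  "positive_definite B \<longleftrightarrow> transpose B = B \<and> (\<forall>v. v \<noteq> 0 \<longrightarrow> v \<bullet> (B *v v) > 0)"

definition strictly_convex_on :: "(real^'n::finite) set \<Rightarrow> (real^'n \<Rightarrow> real) \<Rightarrow> bool" where
  "strictly_convex_on S f \<longleftrightarrow> (\<forall>x\<in>S. positive_definite (hessian f x))"


section \<open>Levi-Civita connection and curvature of a metric in global coordinates\<close>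

text \<open>
  A Riemannian metric on an open subset of \<open>\<real>\<^sup>n\<close> is given by the matrix field of its
  components; \<open>christoffel g k i j\<close> is \<open>\<Gamma>\<^sup>k\<^sub>i\<^sub>j\<close>,
  i.e. \<open>\<nabla>\<^sub>i \<partial>\<^sub>j = \<Sum>k. \<Gamma>\<^sup>k\<^sub>i\<^sub>j \<partial>\<^sub>k\<close>.
\<close>

definition christoffel ::
    "(real^'n::finite \<Rightarrow> real^'n^'n) \<Rightarrow> 'n \<Rightarrow> 'n \<Rightarrow> 'n \<Rightarrow> real^'n \<Rightarrow> real" where
  "christoffel g k i j x =
     (1/2) * (\<Sum>l\<in>UNIV. matrix_inv (g x) $ k $ l *
        (partial i (\<lambda>y. g y $ j $ l) x + partial j (\<lambda>y. g y $ i $ l) x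
          - partial l (\<lambda>y. g y $ i $ j) x))"

text \<open>
  The coefficients above are those of the unique torsion-free metric connection.
\<close>

lemma christoffel_levi_civita:
  fixes g :: "real^'n::finite \<Rightarrow> real^'n^'n"
  assumes sym: "\<And>y. transpose (g y) = g y" and inv: "invertible (g x)"
  shows "(\<forall>i j k. \<Gamma> k i j = \<Gamma> k j i) \<and>
         (\<forall>l i j. partial l (\<lambda>y. g y $ i $ j) x =
            (\<Sum>m\<in>UNIV. \<Gamma> m l i * g x $ m $ j) + (\<Sum>m\<in>UNIV. \<Gamma> m l j * g x $ i $ m))
     \<longleftrightarrow> (\<forall>k i j. \<Gamma> k i j = christoffel g k i j x)"
proof -
  define A where "A = g x"
  define B where "B = matrix_inv A"
  define D where "D = (\<lambda>i j l. partial i (\<lambda>y. g y $ j $ l) x)"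
  define L where "L = (\<lambda>a i j. \<Sum>m\<in>UNIV. \<Gamma> m i j * A $ m $ a)"
  have g_sym: "g y $ i $ j = g y $ j $ i" for y i j
    using arg_cong[OF sym[of y], of "\<lambda>M. M $ j $ i"] by (simp add: transpose_def)
  have A_sym: "A $ i $ j = A $ j $ i" for i j
    unfolding A_def by (rule g_sym)
  have D_sym: "D l i j = D l j i" for l i j
    unfolding D_def by (subst g_sym) simp
  have "invertible A" using inv by (simp add: A_def)
  then have AB: "A ** B = mat 1" and BA: "B ** A = mat 1"
    unfolding B_def matrix_inv_def invertible_def
    by (metis (mono_tags, lifting) someI_ex)+
  have ch: "christoffel g k i j x = (\<Sum>l\<in>UNIV. B $ k $ l * ((D i j l + D j i l - D l i j) / 2))"
    for k i j
    by (simp add: christoffel_def A_def B_def D_def sum_distrib_left)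
  have lower: "(\<forall>k. \<Gamma> k i j = christoffel g k i j x)
      \<longleftrightarrow> (\<forall>a. L a i j = (D i j a + D j i a - D a i j) / 2)" for i j
  proof -
    define v where "v = (\<chi> k. \<Gamma> k i j)"
    define w where "w = (\<chi> a. (D i j a + D j i a - D a i j) / 2)"
    have 1: "(\<forall>k. \<Gamma> k i j = christoffel g k i j x) \<longleftrightarrow> v = B *v w"
      by (simp add: v_def w_def ch vec_eq_iff matrix_vector_mult_def)
    have 2: "(\<forall>a. L a i j = (D i j a + D j i a - D a i j) / 2) \<longleftrightarrow> A *v v = w"
    proof -
      have "(A *v v) $ a = L a i j" for a
        by (simp add: v_def L_def matrix_vector_mult_def A_sym[of a] mult.commute)
      then show ?thesis by (simp add: w_def vec_eq_iff)
    qed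
    have "v = B *v w \<longleftrightarrow> A *v v = w"
      using AB BA by (metis matrix_vector_mul_assoc matrix_vector_mul_lid)
    with 1 2 show ?thesis by simp
  qed
  have met: "(\<Sum>m\<in>UNIV. \<Gamma> m l i * g x $ m $ j) + (\<Sum>m\<in>UNIV. \<Gamma> m l j * g x $ i $ m)
      = L j l i + L i l j" for l i j
    using A_sym[of i] by (simp add: L_def A_def)
  show ?thesis (is "?T \<and> ?M \<longleftrightarrow> ?C")
  proof
    assume tm: "?T \<and> ?M"
    then have Ls: "L a i j = L a j i" for a i j by (simp add: L_def)
    have M: "D l i j = L j l i + L i l j" for l i j
      using tm met by (simp add: D_def)
    have "L a i j = (D i j a + D j i a - D a i j) / 2" for a i j
      using Ls[of a i j] Ls[of j i a] Ls[of i j a] by (simp add: M)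
    then show ?C using lower by blast
  next
    assume C: ?C
    then have L: "L a i j = (D i j a + D j i a - D a i j) / 2" for a i j
      using lower by blast
    have ?T using C D_sym by (simp add: ch add.commute)
    moreover have "D l i j = L j l i + L i l j" for l i j
      using D_sym[of l i j] by (simp add: L field_simps)
    then have ?M unfolding met by (simp add: D_def)
    ultimately show "?T \<and> ?M" by blast
  qed
qed

definition ricci :: "(real^'n::finite \<Rightarrow> real^'n^'n) \<Rightarrow> 'n \<Rightarrow> 'n \<Rightarrow> real^'n \<Rightarrow> real" where
  "ricci g j k x =
     (\<Sum>i\<in>UNIV. partial i (christoffel g i j k) x - partial j (christoffel g i i k) x
        + (\<Sum>m\<in>UNIV. christoffel g i i m x * christoffel g m j k x
                    - christoffel g i j m x * christoffel g m i k x))"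

definition scalar_curvature :: "(real^'n::finite \<Rightarrow> real^'n^'n) \<Rightarrow> real^'n \<Rightarrow> real" where
  "scalar_curvature g x = (\<Sum>j\<in>UNIV. \<Sum>k\<in>UNIV. matrix_inv (g x) $ j $ k * ricci g j k x)"

text \<open>Components \<open>(\<nabla>\<^sub>l T)\<^sub>i\<^sub>j\<^sub>k\<close> of the covariant derivative of a \<open>(0,3)\<close>-tensor field.\<close>

definition covariant_derivative3 ::
    "(real^'n::finite \<Rightarrow> real^'n^'n) \<Rightarrow> ('n \<Rightarrow> 'n \<Rightarrow> 'n \<Rightarrow> real^'n \<Rightarrow> real) \<Rightarrow>
       'n \<Rightarrow> 'n \<Rightarrow> 'n \<Rightarrow> 'n \<Rightarrow> real^'n \<Rightarrow> real" where
  "covariant_derivative3 g T l i j k x =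
     partial l (T i j k) x
     - (\<Sum>m\<in>UNIV. christoffel g m l i x * T m j k x)
     - (\<Sum>m\<in>UNIV. christoffel g m l j x * T i m k x)
     - (\<Sum>m\<in>UNIV. christoffel g m l k x * T i j m x)"

definition parallel3_on ::
    "(real^'n::finite) set \<Rightarrow> (real^'n \<Rightarrow> real^'n^'n) \<Rightarrow>
       ('n \<Rightarrow> 'n \<Rightarrow> 'n \<Rightarrow> real^'n \<Rightarrow> real) \<Rightarrow> bool" where
  "parallel3_on S g T \<longleftrightarrow> (\<forall>x\<in>S. \<forall>l i j k. covariant_derivative3 g T l i j k x = 0)"


section \<open>Calabi geometry of graphs\<close>

definition calabi_metric :: "(real^'n::finite \<Rightarrow> real) \<Rightarrow> real^'n \<Rightarrow> real^'n^'n" where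
  "calabi_metric f = hessian f"

definition cubic_form ::
    "(real^'n::finite \<Rightarrow> real) \<Rightarrow> 'n \<Rightarrow> 'n \<Rightarrow> 'n \<Rightarrow> real^'n \<Rightarrow> real" where
  "cubic_form f i j k x = - (1/2) * partial i (partial j (partial k f)) x"

text \<open>
  \<open>\<real>\<^sup>n\<^sup>+\<^sup>1\<close> is represented as \<open>\<real>\<^sup>n \<times> \<real>\<close>, the last coordinate being the second component;
  in particular \<open>Y = (0, 1)\<close>.
\<close>

definition graph_over :: "(real^'n::finite) set \<Rightarrow> (real^'n \<Rightarrow> real) \<Rightarrow> ((real^'n) \<times> real) set" where
  "graph_over S f = (\<lambda>x. (x, f x)) ` S"

definition calabi_affine :: "((real^'n::finite) \<times> real \<Rightarrow> (real^'n) \<times> real) \<Rightarrow> bool" where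
  "calabi_affine \<phi> \<longleftrightarrow>
     (\<exists>(P::real^'n^'n) (q::real^'n) b.
        invertible P \<and> \<phi> = (\<lambda>(x, t). (P *v x, q \<bullet> x + t) + b))"

definition calabi_equivalent :: "((real^'n::finite) \<times> real) set \<Rightarrow> ((real^'n) \<times> real) set \<Rightarrow> bool" where
  "calabi_equivalent M N \<longleftrightarrow> (\<exists>\<phi>. calabi_affine \<phi> \<and> (N = \<phi> ` M \<or> M = \<phi> ` N))"

definition equivalent_to_open_part ::
    "((real^'n::finite) \<times> real) set \<Rightarrow> ((real^'n) \<times> real) set \<Rightarrow> bool" where
  "equivalent_to_open_part M H \<longleftrightarrow>
     (\<exists>N. openin (top_of_set H) N \<and> calabi_equivalent M N)"


section \<open>The model hypersurfaces\<close>

definition elliptic_paraboloid :: "((real^'n::finite) \<times> real) set" where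
  "elliptic_paraboloid = graph_over UNIV (\<lambda>x. (1/2) * (\<Sum>i\<in>UNIV. (x $ i)\<^sup>2))"

text \<open>
  \<open>Q(c\<^sub>1, \<dots>, c\<^sub>r; 3)\<close>. The indices \<open>1, 2, 3\<close> are natural numbers, cast to the index type
  by \<^const>\<open>of_nat\<close>: in the order of the numeral type \<open>3\<close> the element \<open>3 = 0\<close> is the least
  one, so intervals of that type would not enumerate the coordinates as intended.
\<close>

definition Q_hypersurface :: "nat \<Rightarrow> (nat \<Rightarrow> real) \<Rightarrow> ((real^3) \<times> real) set" where
  "Q_hypersurface r c =
     graph_over {x. \<forall>i\<in>{1..r}. x $ of_nat i > 0}
       (\<lambda>x. - (\<Sum>i = 1..r. c i * ln (x $ of_nat i)) + (\<Sum>j = r+1..3. (1/2) * (x $ of_nat j)\<^sup>2))"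

definition cone_hypersurface :: "real \<Rightarrow> ((real^3) \<times> real) set" where
  "cone_hypersurface c =
     graph_over {x. x $ 1 > sqrt ((x $ 2)\<^sup>2 + (x $ 3)\<^sup>2)}
       (\<lambda>x. - (1 / (2 * c\<^sup>2)) * ln ((x $ 1)\<^sup>2 - ((x $ 2)\<^sup>2 + (x $ 3)\<^sup>2)))"

end

theory Submission
  imports Defs
begin

text \<open>
  Let \<open>G = D\<^sup>2f\<close> and define a commutative product on the tangent space at \<open>x\<close> by
  \<open>G(u \<circ> v, w) = D\<^sup>3f(u, v, w)\<close>. In affine coordinates \<open>\<nabla>A = 0\<close> becomes the autonomous equation
  \<open>D\<^sub>w(u \<circ> v) = (u \<circ> (v \<circ> w) + v \<circ> (u \<circ> w) - w \<circ> (u \<circ> v)) / 2\<close>.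
  Symmetry of second derivatives turns into the statement that every commutator \<open>[L\<^sub>z, L\<^sub>w]\<close> of
  multiplications is a derivation, so the product at a point is of Jordan type with a positive
  definite associative form. In dimension three, minimising \<open>D\<^sup>3f(v, v, v)\<close> over the unit sphere
  leaves only orthogonal sums of lines (possibly with zero product) and the spin factor. Each of
  these is realised by an explicit model, and unique continuation for the equation above, followed
  by the one for \<open>G\<close>, identifies \<open>f\<close> with the model up to an affine function. The domain
  cannot leave that of the model, where the product would blow up.
\<close>

section \<open>Symmetry of second derivatives\<close>

text \<open>For a Hessian metric the Christoffel symbols are half the structure constants of the
  product, so vanishing of the covariant derivative makes fourth derivatives of f quadratic in the
  third ones. Passing to an equation for the product alone costs the derivative of G, which reverses
  the sign of the term with w on the outside. The equation no longer mentions G, so the product is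
  continued on its own and everything is decided by algebra at one point. There a minimiser e
  satisfies e e = l e with l \<le> 0. Eigenvalues k of multiplication by e on the complement of e
  satisfy k (l - k) (l - 2 k) = 0, and minimality excludes k = l < 0. Eigenvalue 0 throughout splits
  e off, one 0 and one l/2 give the spin factor, l/2 throughout is impossible. On a line the
  equation is \<lambda>' = \<lambda>^2 / 2, solved by \<lambda> = -2/y; this is the origin of -2/l.
  No completeness is assumed, so \<Omega> might a priori cross the boundary of the model domain.
  Identities with cleared denominators extend to such a boundary point and would make a basis vector
  vanish there.\<close>

lemma second_difference_quotient_tendsto:
  fixes f :: "'a::real_normed_vector \<Rightarrow> real"
  assumes S: "open S" "x \<in> S"
    and f: "\<And>y. y \<in> S \<Longrightarrow> (f has_derivative F y) (at y)"
    and Fu: "((\<lambda>y. F y u) has_derivative Fu) (at x)"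
  shows "((\<lambda>t. (f (x + t *\<^sub>R u + t *\<^sub>R v) - f (x + t *\<^sub>R u) - f (x + t *\<^sub>R v) + f x) / t\<^sup>2)
    \<longlongrightarrow> Fu v) (at_right 0)"
proof (rule tendstoI)
  fix e :: real assume e: "e > 0"
  \<comment> \<open>Each of the two linearisation errors below is at most
    \<open>e' * (t * (norm u + norm v))\<close>. The summand 1 makes their sum strictly smaller than
    \<open>e' * (t * c)\<close>, and \<open>t0\<close> keeps the points used within \<open>d\<close>
    of \<open>x\<close> and inside \<open>S\<close>.\<close>
  define c where "c = 2 * (norm u + norm v) + 1"
  have c: "c > 0" unfolding c_def by (intro add_nonneg_pos) auto
  define e' where "e' = e / (2 * c)"
  have e': "e' > 0" using e c by (simp add: e'_def)
  have lin: "bounded_linear Fu" using Fu by (rule has_derivative_bounded_linear)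
  obtain d where d: "d > 0"
    and dF: "\<And>y. norm (y - x) < d \<Longrightarrow> norm (F y u - F x u - Fu (y - x)) \<le> e' * norm (y - x)"
    using Fu e' unfolding has_derivative_at_alt by blast
  obtain r where r: "r > 0" "ball x r \<subseteq> S"
    using S by (meson openE)
  define t0 where "t0 = min d r / c"
  have t0: "t0 > 0" using d r c by (simp add: t0_def)
  have main: "dist ((f (x + t *\<^sub>R u + t *\<^sub>R v) - f (x + t *\<^sub>R u) - f (x + t *\<^sub>R v) + f x) / t\<^sup>2) (Fu v) < e"
    if t: "0 < t" "t < t0" for t
  proof -
    have tc: "t * c < min d r"
      using t c by (simp add: t0_def pos_less_divide_eq)
    have near: "norm ((s * t) *\<^sub>R u + a *\<^sub>R v) \<le> t * (norm u + norm v)"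
      if "0 \<le> s" "s \<le> 1" "0 \<le> a" "a \<le> t" for s a
    proof -
      have "norm ((s * t) *\<^sub>R u + a *\<^sub>R v) \<le> (s * t) * norm u + a * norm v"
        using norm_triangle_ineq[of "(s * t) *\<^sub>R u" "a *\<^sub>R v"] that t by simp
      also have "\<dots> \<le> t * norm u + t * norm v"
        using that t by (intro add_mono mult_right_mono) (auto simp: mult_left_le_one_le)
      finally show ?thesis by (simp add: algebra_simps)
    qed
    have lt: "t * (norm u + norm v) < min d r"
    proof -
      have "t * (norm u + norm v) \<le> t * c"
        using t by (intro mult_left_mono) (auto simp: c_def)
      with tc show ?thesis by simp
    qed
    define g where "g s = f (x + ((s * t) *\<^sub>R u + t *\<^sub>R v)) - f (x + ((s * t) *\<^sub>R u + 0 *\<^sub>R v))" for s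
    have inS: "x + ((s * t) *\<^sub>R u + a *\<^sub>R v) \<in> S" if "0 \<le> s" "s \<le> 1" "0 \<le> a" "a \<le> t" for s a
      
    proof -
      have "dist (x + ((s * t) *\<^sub>R u + a *\<^sub>R v)) x < r"
        using near[OF that] lt by (simp only: dist_norm add_diff_cancel_left')
      then show ?thesis using r(2) by (auto simp: dist_commute)
    qed
    have dg: "(g has_real_derivative
        t * (F (x + ((s * t) *\<^sub>R u + t *\<^sub>R v)) u - F (x + ((s * t) *\<^sub>R u + 0 *\<^sub>R v)) u)) (at s)"
      if s: "0 \<le> s" "s \<le> 1" for s
    proof -
      have *: "((\<lambda>s. f (x + ((s * t) *\<^sub>R u + a *\<^sub>R v))) has_real_derivative
          t * F (x + ((s * t) *\<^sub>R u + a *\<^sub>R v)) u) (at s)" if a: "0 \<le> a" "a \<le> t" for a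
      proof -
        have bl: "bounded_linear (F (x + ((s * t) *\<^sub>R u + a *\<^sub>R v)))"
          using f[OF inS[OF s a]] by (rule has_derivative_bounded_linear)
        have "((\<lambda>s. f (x + ((s * t) *\<^sub>R u + a *\<^sub>R v))) has_derivative
            (\<lambda>h. F (x + ((s * t) *\<^sub>R u + a *\<^sub>R v)) ((h * t) *\<^sub>R u))) (at s)"
          by (rule has_derivative_compose[where g = f and f = "\<lambda>s. x + ((s * t) *\<^sub>R u + a *\<^sub>R v)"])
            (auto intro!: derivative_eq_intros f[OF inS[OF s a]])
        then show ?thesis
          by (simp add: has_field_derivative_def linear_cmul[OF bounded_linear.linear[OF bl]] mult_ac
            mult_commute_abs)
      qed
      show ?thesis
        unfolding g_def using DERIV_diff[OF *[of t] *[of 0]] t by (simp add: algebra_simps)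
    qed
    obtain s where s: "0 < s" "s < 1"
      and gs: "g 1 - g 0 = t * (F (x + ((s * t) *\<^sub>R u + t *\<^sub>R v)) u - F (x + ((s * t) *\<^sub>R u + 0 *\<^sub>R v)) u)"
      using MVT2[of 0 1 g, OF _ dg] by auto
    define p q where "p = (s * t) *\<^sub>R u + t *\<^sub>R v" and "q = (s * t) *\<^sub>R u + 0 *\<^sub>R v"
    have np: "norm p \<le> t * (norm u + norm v)" and nq: "norm q \<le> t * (norm u + norm v)"
      using near[of s t] near[of s 0] s t by (auto simp: p_def q_def)
    have P: "\<bar>F (x + p) u - F x u - Fu p\<bar> \<le> e' * (t * (norm u + norm v))"
    proof -
      have "\<bar>F (x + p) u - F x u - Fu p\<bar> \<le> e' * norm p"
        using dF[of "x + p"] np lt by auto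
      also have "\<dots> \<le> e' * (t * (norm u + norm v))" using np e' by (intro mult_left_mono) auto
      finally show ?thesis .
    qed
    have Q: "\<bar>F (x + q) u - F x u - Fu q\<bar> \<le> e' * (t * (norm u + norm v))"
    proof -
      have "\<bar>F (x + q) u - F x u - Fu q\<bar> \<le> e' * norm q"
        using dF[of "x + q"] nq lt by auto
      also have "\<dots> \<le> e' * (t * (norm u + norm v))" using nq e' by (intro mult_left_mono) auto
      finally show ?thesis .
    qed
    have pq: "Fu p - Fu q = t * Fu v"
    proof -
      have "Fu p - Fu q = Fu (p - q)" using lin by (simp add: bounded_linear.linear linear_diff)
      also have "p - q = t *\<^sub>R v" by (simp add: p_def q_def)
      finally show ?thesis using lin by (simp add: bounded_linear.linear linear_cmul)
    qed
    have "\<bar>(F (x + p) u - F (x + q) u) - t * Fu v\<bar> \<le> 2 * (e' * (t * (norm u + norm v)))"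
      using P Q pq by linarith
    also have "\<dots> < e' * (t * c)"
      using e' t by (simp add: c_def algebra_simps)
    finally have main: "\<bar>(F (x + p) u - F (x + q) u) - t * Fu v\<bar> < e' * (t * c)" .
    have num: "f (x + t *\<^sub>R u + t *\<^sub>R v) - f (x + t *\<^sub>R u) - f (x + t *\<^sub>R v) + f x = t * (F (x + p) u - F (x + q) u)"
      using gs unfolding p_def q_def g_def by (simp add: add.assoc algebra_simps)
    have "t * (F (x + p) u - F (x + q) u) / t\<^sup>2 - Fu v = ((F (x + p) u - F (x + q) u) - t * Fu v) / t"
      using t by (simp add: field_simps power2_eq_square)
    then have "\<bar>t * (F (x + p) u - F (x + q) u) / t\<^sup>2 - Fu v\<bar> = \<bar>(F (x + p) u - F (x + q) u) - t * Fu v\<bar> / t"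
      using t by simp
    also have "\<dots> < e' * c"
      using main t by (simp add: pos_divide_less_eq mult_ac)
    also have "\<dots> < e" using e c by (simp add: e'_def)
    finally show ?thesis unfolding num dist_real_def .
  qed
  show "\<forall>\<^sub>F t in at_right 0. dist ((f (x + t *\<^sub>R u + t *\<^sub>R v) - f (x + t *\<^sub>R u) - f (x + t *\<^sub>R v) + f x) / t\<^sup>2) (Fu v) < e"
    unfolding eventually_at_right_field using t0 main by auto
qed

text \<open>The second difference quotient is symmetric in \<open>u\<close> and \<open>v\<close>, so
  \<open>Fu v\<close> and \<open>Fv u\<close> are limits of the same function.\<close>

lemma second_derivative_symmetric:
  fixes f :: "'a::real_normed_vector \<Rightarrow> real"
  assumes "open S" "x \<in> S"
    and "\<And>y. y \<in> S \<Longrightarrow> (f has_derivative F y) (at y)"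
    and "((\<lambda>y. F y u) has_derivative Fu) (at x)"
    and "((\<lambda>y. F y v) has_derivative Fv) (at x)"
  shows "Fu v = Fv u"
proof (rule tendsto_unique)
  show "((\<lambda>t. (f (x + t *\<^sub>R u + t *\<^sub>R v) - f (x + t *\<^sub>R u) - f (x + t *\<^sub>R v) + f x) / t\<^sup>2)
    \<longlongrightarrow> Fu v) (at_right 0)"
    by (rule second_difference_quotient_tendsto[OF assms(1-4)])
  show "((\<lambda>t. (f (x + t *\<^sub>R u + t *\<^sub>R v) - f (x + t *\<^sub>R u) - f (x + t *\<^sub>R v) + f x) / t\<^sup>2)
    \<longlongrightarrow> Fv u) (at_right 0)"
    using second_difference_quotient_tendsto[OF assms(1-3,5), of u]
    by (simp add: algebra_simps)
qed simp

section \<open>Unique continuation\<close>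

text \<open>A Gronwall estimate without integration: on a small closed ball the sum \<open>N\<close>
  of the norms has a maximum, and the mean value inequality between \<open>x\<close> and a maximiser
  \<open>z\<close> gives \<open>N z \<le> k * n * r * N z\<close>. As \<open>k * n * r < 1\<close>,
  the maximum is zero.\<close>

lemma local_vanishing:
  fixes d :: "'i \<Rightarrow> 'a::euclidean_space \<Rightarrow> 'b::real_normed_vector"
  assumes I: "finite I" and r0: "r0 > 0"
    and d: "\<And>i y. i \<in> I \<Longrightarrow> y \<in> ball x r0 \<Longrightarrow> (d i has_derivative d' i y) (at y)"
    and K: "\<And>i y w. i \<in> I \<Longrightarrow> y \<in> ball x r0 \<Longrightarrow> norm (d' i y w) \<le> K * (\<Sum>j\<in>I. norm (d j y)) * norm w"
    and zero: "\<And>i. i \<in> I \<Longrightarrow> d i x = 0"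
  shows "\<exists>r>0. \<forall>y\<in>ball x r. \<forall>i\<in>I. d i y = 0"
proof -
  define k where "k = max K 0"
  define n where "n = real (card I)"
  have kn: "k \<ge> 0" "n \<ge> 0" by (auto simp: k_def n_def)
  \<comment> \<open>The second bound yields \<open>k * n * r < 1\<close>; the summand 1 covers
    \<open>k * n = 0\<close>.\<close>
  define r where "r = min (r0 / 2) (1 / (2 * (k * n + 1)))"
  have r: "r > 0" "r < r0"
    using r0 kn by (auto simp: r_def min_def add_nonneg_pos)
  have knr: "k * n * r < 1"
  proof -
    have "k * n * r \<le> k * n * (1 / (2 * (k * n + 1)))"
      using kn by (intro mult_left_mono) (auto simp: r_def)
    also have "\<dots> < 1" using kn by (simp add: divide_simps add_nonneg_pos)
    finally show ?thesis .
  qed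
  define N where "N y = (\<Sum>j\<in>I. norm (d j y))" for y
  have sub: "cball x r \<subseteq> ball x r0" using r by (simp add: cball_subset_ball_iff)
  have cont: "continuous_on (cball x r) N"
    unfolding N_def
    by (intro continuous_intros continuous_at_imp_continuous_on ballI has_derivative_continuous[OF d])
      (use sub in auto)
  obtain z where z: "z \<in> cball x r" "\<And>y. y \<in> cball x r \<Longrightarrow> N y \<le> N z"
    using continuous_attains_sup[OF compact_cball _ cont] r by (metis cball_eq_empty less_imp_le not_less)
  have N0: "N y \<ge> 0" for y by (simp add: N_def sum_nonneg)
  have each: "norm (d i z) \<le> k * N z * r" if i: "i \<in> I" for i
  proof -
    have "norm (d i z - d i x) \<le> (k * N z) * norm (z - x)"
    proof (rule differentiable_bound[OF convex_cball])
      fix y assume y: "y \<in> cball x r"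
      then have yb: "y \<in> ball x r0" using sub by auto
      show "(d i has_derivative d' i y) (at y within cball x r)"
        using d[OF i yb] has_derivative_at_withinI by blast
      show "onorm (d' i y) \<le> k * N z"
      proof (rule onorm_le)
        fix w
        have "norm (d' i y w) \<le> K * N y * norm w" using K[OF i yb] by (simp add: N_def)
        also have "\<dots> \<le> k * N y * norm w" by (intro mult_right_mono) (auto simp: k_def N0)
        also have "\<dots> \<le> k * N z * norm w"
          using z(2)[OF y] kn by (intro mult_right_mono mult_left_mono) auto
        finally show "norm (d' i y w) \<le> k * N z * norm w" .
      qed
    qed (use z r in auto)
    also have "\<dots> \<le> (k * N z) * r"
      using z(1) kn N0 by (intro mult_left_mono) (auto simp: dist_norm norm_minus_commute)
    finally show ?thesis using zero[OF i] by simp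
  qed
  have "N z \<le> (\<Sum>i\<in>I. k * N z * r)" unfolding N_def[of z] by (rule sum_mono) (use each N_def in auto)
  also have "\<dots> = (k * n * r) * N z" by (simp add: n_def mult_ac)
  finally have "(1 - k * n * r) * N z \<le> 0" by (simp add: algebra_simps)
  with knr N0[of z] have "N z = 0" by (simp add: mult_le_0_iff)
  then have "N y = 0" if "y \<in> cball x r" for y using z(2)[OF that] N0[of y] by simp
  then have "\<forall>y\<in>ball x r. \<forall>i\<in>I. d i y = 0"
    using I by (auto simp: N_def sum_nonneg_eq_0_iff)
  then show ?thesis using r by blast
qed

text \<open>\<open>Q\<close> will contain membership in the open domain of a model. Such a condition
  is not closed, so limit points in \<open>S\<close> get a hypothesis of their own; the blow-up
  arguments discharge it.\<close>

lemma connected_clopen_induct: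
  assumes "connected S" "x0 \<in> S" "Q x0"
    and open_step: "\<And>x. x \<in> S \<Longrightarrow> Q x \<Longrightarrow> \<exists>r>0. \<forall>y\<in>ball x r. y \<in> S \<longrightarrow> Q y"
    and closed_step: "\<And>x. x \<in> S \<Longrightarrow> x \<in> closure {y\<in>S. Q y} \<Longrightarrow> Q x"
    and "x \<in> S"
  shows "Q (x::'a::metric_space)"
proof -
  define Z where "Z = {y\<in>S. Q y}"
  have "openin (top_of_set S) Z"
    unfolding openin_contains_ball
  proof (intro conjI ballI)
    fix y assume "y \<in> Z"
    then obtain r where "r > 0" "\<forall>z\<in>ball y r. z \<in> S \<longrightarrow> Q z" using open_step by (auto simp: Z_def)
    then show "\<exists>e>0. ball y e \<inter> S \<subseteq> Z" by (auto simp: Z_def)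
  qed (auto simp: Z_def)
  moreover have "closedin (top_of_set S) Z"
  proof -
    have "Z = S \<inter> closure Z" using closed_step closure_subset[of Z] unfolding Z_def by blast
    then show ?thesis using closed_closure by (metis closedin_closed_Int)
  qed
  moreover have "Z \<noteq> {}" using assms by (auto simp: Z_def)
  ultimately have "Z = S" using \<open>connected S\<close> connected_clopen by blast
  with \<open>x \<in> S\<close> show ?thesis by (auto simp: Z_def)
qed

lemma zero_on_closure:
  fixes g :: "'a::metric_space \<Rightarrow> 'b::real_normed_vector"
  assumes "continuous (at x) g" "x \<in> closure Z" "\<And>z. z \<in> Z \<Longrightarrow> g z = 0"
  shows "g x = 0"
proof -
  obtain s where s: "\<And>n. s n \<in> Z" "s \<longlonglongrightarrow> x"
    using assms(2) by (auto simp: closure_sequential)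
  then have "(g \<circ> s) \<longlonglongrightarrow> g x"
    using assms(1) unfolding continuous_at_sequentially by blast
  moreover have "g \<circ> s = (\<lambda>n. 0)" using s assms(3) by auto
  ultimately show ?thesis by (simp add: LIMSEQ_const_iff)
qed

section \<open>The differential equation of the product\<close>

text \<open>A bilinear map is tracked by its finitely many values on pairs of basis vectors; this
  turns families of bilinear maps into instances of \<open>local_vanishing\<close> with index set
  \<open>Basis \<times> Basis\<close>.\<close>

definition bilinear_norm :: "('a::euclidean_space \<Rightarrow> 'a \<Rightarrow> 'b::real_normed_vector) \<Rightarrow> real" where
  "bilinear_norm p = (\<Sum>(b, c)\<in>Basis \<times> Basis. norm (p b c))"

lemma bilinear_norm_nonneg: "bilinear_norm p \<ge> 0"
  unfolding bilinear_norm_def by (auto intro: sum_nonneg)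

lemma bilinear_expand:
  fixes p :: "'a::euclidean_space \<Rightarrow> 'a \<Rightarrow> 'b::real_normed_vector"
  assumes "bilinear p"
  shows "p u v = (\<Sum>(b, c)\<in>Basis \<times> Basis. ((u \<bullet> b) * (v \<bullet> c)) *\<^sub>R p b c)"
proof -
  have "p u v = p (\<Sum>b\<in>Basis. (u \<bullet> b) *\<^sub>R b) (\<Sum>c\<in>Basis. (v \<bullet> c) *\<^sub>R c)"
    by (simp add: euclidean_representation)
  also have "\<dots> = (\<Sum>(b, c)\<in>Basis \<times> Basis. p ((u \<bullet> b) *\<^sub>R b) ((v \<bullet> c) *\<^sub>R c))"
    by (rule bilinear_sum[OF assms])
  finally show ?thesis
    by (simp add: bilinear_lmul[OF assms] bilinear_rmul[OF assms] split_def mult.commute)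
qed

lemma norm_bilinear_le:
  assumes "bilinear p"
  shows "norm (p u v) \<le> bilinear_norm p * norm u * norm v"
proof -
  have "norm (p u v) \<le> (\<Sum>(b, c)\<in>Basis \<times> Basis. norm (((u \<bullet> b) * (v \<bullet> c)) *\<^sub>R p b c))"
    by (subst bilinear_expand[OF assms]) (simp only: split_def norm_sum)
  also have "\<dots> \<le> (\<Sum>(b, c)\<in>Basis \<times> Basis. norm (p b c) * (norm u * norm v))"
  proof (rule sum_mono, clarify)
    fix b c :: 'a assume "b \<in> Basis" "c \<in> Basis"
    then have "\<bar>u \<bullet> b\<bar> * \<bar>v \<bullet> c\<bar> \<le> norm u * norm v" by (intro mult_mono Basis_le_norm) auto
    then have "(\<bar>u \<bullet> b\<bar> * \<bar>v \<bullet> c\<bar>) * norm (p b c) \<le> (norm u * norm v) * norm (p b c)"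
      by (rule mult_right_mono) simp
    then show "norm (((u \<bullet> b) * (v \<bullet> c)) *\<^sub>R p b c) \<le> norm (p b c) * (norm u * norm v)"
      by (simp add: abs_mult mult_ac)
  qed
  finally show ?thesis
    by (simp add: bilinear_norm_def sum_distrib_right split_def mult.assoc)
qed

definition product_ode :: "'a::euclidean_space set \<Rightarrow> ('a \<Rightarrow> 'a \<Rightarrow> 'a \<Rightarrow> 'a) \<Rightarrow> bool" where
  "product_ode S P \<longleftrightarrow> (\<forall>x\<in>S. bilinear (P x) \<and> (\<forall>u v. P x u v = P x v u) \<and>
     (\<forall>u v. ((\<lambda>y. P y u v) has_derivative
        (\<lambda>w. (1/2) *\<^sub>R (P x u (P x v w) + P x v (P x u w) - P x w (P x u v)))) (at x)))"

text \<open>A product rule when \<open>P\<close> is differentiable only for each fixed pair of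
  arguments: expand the moving argument in a basis. Linearity of \<open>P' u\<close> in its second
  argument is not assumed; it follows from uniqueness of derivatives.\<close>

lemma has_derivative_bilinear_family:
  fixes P :: "'a::euclidean_space \<Rightarrow> 'a \<Rightarrow> 'a \<Rightarrow> 'b::real_normed_vector"
  assumes S: "open S" "x \<in> S"
    and bil: "\<And>y. y \<in> S \<Longrightarrow> bilinear (P y)"
    and P: "\<And>u v. ((\<lambda>y. P y u v) has_derivative P' u v) (at x)"
    and g: "(g has_derivative g') (at x)"
  shows "((\<lambda>y. P y u (g y)) has_derivative (\<lambda>w. P' u (g x) w + P x u (g' w))) (at x)"
proof -
  have ex: "p u a = (\<Sum>b\<in>Basis. (a \<bullet> b) *\<^sub>R p u b)"
    if "bilinear p" for p :: "'a \<Rightarrow> 'a \<Rightarrow> 'b" and a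
  proof -
    have "linear (p u)" using that by (simp add: bilinear_def)
    then have "p u (\<Sum>b\<in>Basis. (a \<bullet> b) *\<^sub>R b) = (\<Sum>b\<in>Basis. (a \<bullet> b) *\<^sub>R p u b)"
      by (simp add: linear_sum linear_cmul)
    then show ?thesis by (simp add: euclidean_representation)
  qed
  have "((\<lambda>y. \<Sum>b\<in>Basis. (g x \<bullet> b) *\<^sub>R P y u b) has_derivative
      (\<lambda>w. \<Sum>b\<in>Basis. (g x \<bullet> b) *\<^sub>R P' u b w)) (at x)"
    by (intro has_derivative_sum has_derivative_scaleR_right P)
  moreover have "((\<lambda>y. \<Sum>b\<in>Basis. (g x \<bullet> b) *\<^sub>R P y u b) has_derivative P' u (g x)) (at x)"
    using S by (intro has_derivative_transform_within_open[OF P[of u "g x"] S]) (simp add: ex[OF bil, symmetric])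
  ultimately have P'_ex: "P' u (g x) = (\<lambda>w. \<Sum>b\<in>Basis. (g x \<bullet> b) *\<^sub>R P' u b w)"
    using has_derivative_unique by blast
  have "((\<lambda>y. \<Sum>b\<in>Basis. (g y \<bullet> b) *\<^sub>R P y u b) has_derivative
      (\<lambda>w. \<Sum>b\<in>Basis. (g x \<bullet> b) *\<^sub>R P' u b w + (g' w \<bullet> b) *\<^sub>R P x u b)) (at x)"
    by (intro has_derivative_sum has_derivative_scaleR P has_derivative_inner_left g)
  then have "((\<lambda>y. \<Sum>b\<in>Basis. (g y \<bullet> b) *\<^sub>R P y u b) has_derivative
      (\<lambda>w. P' u (g x) w + P x u (g' w))) (at x)"
    by (subst ex[OF bil[OF S(2)], where a = "g' _"]) (simp only: sum.distrib P'_ex)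
  then show ?thesis
    by (rule has_derivative_transform_within_open[OF _ S]) (simp add: ex[OF bil, symmetric])
qed

text \<open>This is the integrability condition of the differential equation.\<close>

lemma product_ode_derivation:
  fixes P :: "'a::euclidean_space \<Rightarrow> 'a \<Rightarrow> 'a \<Rightarrow> 'a"
  assumes ode: "product_ode S P" and S: "open S" "x \<in> S"
  defines "m \<equiv> P x"
  shows "m z (m w (m u v)) - m w (m z (m u v)) =
    m u (m z (m w v) - m w (m z v)) + m v (m z (m w u) - m w (m z u))"
proof -
  have bil: "\<And>y. y \<in> S \<Longrightarrow> bilinear (P y)" and com: "\<And>y u v. y \<in> S \<Longrightarrow> P y u v = P y v u"
    and der: "\<And>y u v. y \<in> S \<Longrightarrow> ((\<lambda>y. P y u v) has_derivative
        (\<lambda>w. (1/2) *\<^sub>R (P y u (P y v w) + P y v (P y u w) - P y w (P y u v)))) (at y)"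
    using ode by (auto simp: product_ode_def)
  define J where "J u v w = (1/2) *\<^sub>R (m u (m v w) + m v (m u w) - m w (m u v))" for u v w
  have bm: "bilinear m" using bil[OF S(2)] by (simp add: m_def)
  note lin = bilinear_ladd[OF bm] bilinear_radd[OF bm] bilinear_lsub[OF bm] bilinear_rsub[OF bm]
    bilinear_lmul[OF bm] bilinear_rmul[OF bm]
  have cm: "m a b = m b a" for a b using com[OF S(2)] by (simp add: m_def)
  have d1: "((\<lambda>y. P y u v) has_derivative J u v) (at x)" for u v
    using der[OF S(2)] by (simp add: J_def[abs_def] m_def)
  define G where "G y w = (1/2) *\<^sub>R (P y u (P y v w) + P y v (P y u w) - P y w (P y u v))" for y w
  have dG: "((\<lambda>y. G y w) has_derivative (\<lambda>z. (1/2) *\<^sub>R ((J u (m v w) z + m u (J v w z))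
      + (J v (m u w) z + m v (J u w z)) - (J w (m u v) z + m w (J u v z))))) (at x)" for w
    unfolding G_def m_def
    by (intro has_derivative_scaleR_right has_derivative_add has_derivative_diff
        has_derivative_bilinear_family[OF S bil d1 d1])
  \<comment> \<open>\<open>E w z\<close> is the second derivative of \<open>P y u v\<close> at
    \<open>x\<close> in the directions \<open>w\<close> and \<open>z\<close>, with the equation
    inserted twice.\<close>
  define E where "E w z = (1/2) *\<^sub>R ((J u (m v w) z + m u (J v w z))
      + (J v (m u w) z + m v (J u w z)) - (J w (m u v) z + m w (J u v z)))" for w z
  have sym: "E w z = E z w"
  proof (rule euclidean_eqI)
    fix k :: 'a
    show "E w z \<bullet> k = E z w \<bullet> k"
    proof (rule second_derivative_symmetric[OF S, where Fu = "\<lambda>z. E w z \<bullet> k" and Fv = "\<lambda>w. E z w \<bullet> k"])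
      show "((\<lambda>y. P y u v \<bullet> k) has_derivative (\<lambda>w. G y w \<bullet> k)) (at y)" if "y \<in> S" for y
        unfolding G_def by (intro has_derivative_inner_left der that)
      show "((\<lambda>y. G y w \<bullet> k) has_derivative (\<lambda>z. E w z \<bullet> k)) (at x)" for w
        unfolding E_def by (intro has_derivative_inner_left dG)
      then show "((\<lambda>y. G y z \<bullet> k) has_derivative (\<lambda>w. E z w \<bullet> k)) (at x)" .
    qed
  qed
  \<comment> \<open>The factor 4 clears both halves. All terms symmetric in \<open>w\<close> and
    \<open>z\<close> cancel, and what remains is the Leibniz rule of the commutator of
    \<open>m z\<close> and \<open>m w\<close> on \<open>m u v\<close>.\<close>
  then have "4 *\<^sub>R E w z = 4 *\<^sub>R E z w" by simp
  then show ?thesis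
    unfolding J_def E_def
    by (simp add: lin cm algebra_simps)
qed


lemma locally_bounded_bilinear_norm:
  fixes P :: "'a::euclidean_space \<Rightarrow> 'a \<Rightarrow> 'a \<Rightarrow> 'b::real_normed_vector"
  assumes "\<And>y u v. y \<in> S \<Longrightarrow> continuous (at y) (\<lambda>y. P y u v)" and "cball x r \<subseteq> S"
  shows "\<exists>B>0. \<forall>y\<in>cball x r. bilinear_norm (P y) \<le> B"
proof -
  have "continuous_on (cball x r) (\<lambda>y. bilinear_norm (P y))"
    unfolding bilinear_norm_def split_def
    using assms by (intro continuous_intros continuous_at_imp_continuous_on) auto
  then have "bounded ((\<lambda>y. bilinear_norm (P y)) ` cball x r)"
    by (intro compact_imp_bounded compact_continuous_image compact_cball)
  then obtain B where "B > 0" "\<forall>y\<in>cball x r. norm (bilinear_norm (P y)) \<le> B"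
    by (auto simp: bounded_pos)
  then show ?thesis by (intro exI[of _ B]) (auto simp: abs_le_iff)
qed

lemma bilinear_eqI:
  fixes p q :: "'a::euclidean_space \<Rightarrow> 'a \<Rightarrow> 'b::real_normed_vector"
  assumes "bilinear p" "bilinear q" "\<And>b c. b \<in> Basis \<Longrightarrow> c \<in> Basis \<Longrightarrow> p b c = q b c"
  shows "p = q"
proof (intro ext)
  fix u v show "p u v = q u v"
    unfolding bilinear_expand[OF assms(1), of u v] bilinear_expand[OF assms(2), of u v]
    by (rule sum.cong) (auto simp: assms(3))
qed

text \<open>The right side of the equation is quadratic in the product, hence Lipschitz on a closed
  ball where both solutions are bounded.\<close>

lemma product_ode_local_uniqueness:
  fixes P M :: "'a::euclidean_space \<Rightarrow> 'a \<Rightarrow> 'a \<Rightarrow> 'a"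
  assumes P: "product_ode S P" and M: "product_ode S M"
    and S: "open S" "x \<in> S" and eq: "P x = M x"
  shows "\<exists>r>0. \<forall>y\<in>ball x r. y \<in> S \<and> P y = M y"
proof -
  have bP: "\<And>y. y \<in> S \<Longrightarrow> bilinear (P y)" and bM: "\<And>y. y \<in> S \<Longrightarrow> bilinear (M y)"
    using P M by (auto simp: product_ode_def)
  have dP: "\<And>y u v. y \<in> S \<Longrightarrow> ((\<lambda>y. P y u v) has_derivative
        (\<lambda>w. (1/2) *\<^sub>R (P y u (P y v w) + P y v (P y u w) - P y w (P y u v)))) (at y)"
    and dM: "\<And>y u v. y \<in> S \<Longrightarrow> ((\<lambda>y. M y u v) has_derivative
        (\<lambda>w. (1/2) *\<^sub>R (M y u (M y v w) + M y v (M y u w) - M y w (M y u v)))) (at y)"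
    using P M by (auto simp: product_ode_def)
  obtain r where r: "r > 0" "cball x r \<subseteq> S" using S open_contains_cball by blast
  obtain B where B: "B > 0" "\<And>y. y \<in> cball x r \<Longrightarrow> bilinear_norm (P y) \<le> B"
    using locally_bounded_bilinear_norm[of S P, OF has_derivative_continuous[OF dP] r(2)] by blast
  obtain C where C: "C > 0" "\<And>y. y \<in> cball x r \<Longrightarrow> bilinear_norm (M y) \<le> C"
    using locally_bounded_bilinear_norm[of S M, OF has_derivative_continuous[OF dM] r(2)] by blast
  define d where "d = (\<lambda>(u, v) y. P y u v - M y u v)"
  define d' where "d' = (\<lambda>(u, v) y w. (1/2) *\<^sub>R (P y u (P y v w) + P y v (P y u w) - P y w (P y u v))
      - (1/2) *\<^sub>R (M y u (M y v w) + M y v (M y u w) - M y w (M y u v)))"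
  define N where "N y = (\<Sum>i\<in>Basis \<times> Basis. norm (d i y))" for y
  have N: "N y = bilinear_norm (\<lambda>u v. P y u v - M y u v)" for y
    by (simp add: N_def bilinear_norm_def d_def split_def)
  have N0: "N y \<ge> 0" for y by (simp add: N bilinear_norm_nonneg)
  have "\<exists>r'>0. \<forall>y\<in>ball x r'. \<forall>i\<in>Basis \<times> Basis. d i y = 0"
  proof (rule local_vanishing[where d' = d' and K = "2 * (B + C)"])
    show "(d i has_derivative d' i y) (at y)" if "y \<in> ball x r" for i y
      using r that unfolding d_def d'_def
      by (cases i) (auto intro!: has_derivative_diff dP dM)
    fix i :: "'a \<times> 'a" and y w assume i: "i \<in> Basis \<times> Basis" and "y \<in> ball x r"
    then have y: "y \<in> cball x r" "y \<in> S" using r by auto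
    obtain u v where uv: "i = (u, v)" "norm u = 1" "norm v = 1" using i by auto
    have bd: "bilinear (\<lambda>u v. P y u v - M y u v)"
      using bP[OF y(2)] bM[OF y(2)] by (auto simp: bilinear_def intro: linear_compose_sub)
    have diff: "norm (P y a b - M y a b) \<le> N y * norm a * norm b" for a b
      using norm_bilinear_le[OF bd] by (simp add: N)
    have nP: "norm (P y a b) \<le> B * norm a * norm b" for a b
      by (rule order_trans[OF norm_bilinear_le[OF bP[OF y(2)]]])
        (intro mult_right_mono B y norm_ge_zero)
    have nM: "norm (M y a b) \<le> C * norm a * norm b" for a b
      by (rule order_trans[OF norm_bilinear_le[OF bM[OF y(2)]]])
        (intro mult_right_mono C y norm_ge_zero)
    have two: "norm (P y a (P y b c) - M y a (M y b c)) \<le> (B + C) * N y * (norm a * norm b * norm c)" for a b c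
    proof -
      \<comment> \<open>Change one factor at a time, so that each term contains the difference of
        the products once.\<close>
      have "P y a (P y b c) - M y a (M y b c) = (P y a (P y b c) - M y a (P y b c)) + M y a (P y b c - M y b c)"
        by (simp add: bilinear_rsub[OF bM[OF y(2)]])
      then have "norm (P y a (P y b c) - M y a (M y b c))
          \<le> norm (P y a (P y b c) - M y a (P y b c)) + norm (M y a (P y b c - M y b c))"
        by (simp only: norm_triangle_ineq)
      also have "\<dots> \<le> N y * norm a * norm (P y b c) + C * norm a * norm (P y b c - M y b c)"
        by (intro add_mono diff nM)
      also have "\<dots> \<le> N y * norm a * (B * norm b * norm c) + C * norm a * (N y * norm b * norm c)"
        using N0 C by (intro add_mono mult_left_mono diff nP) auto
      finally show ?thesis by (simp add: algebra_simps)
    qed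
    have half: "norm ((1/2) *\<^sub>R (a + b - c)) \<le> (1/2) * (norm a + norm b + norm c)" for a b c :: 'a
      using norm_triangle_ineq4[of "a + b" c] norm_triangle_ineq[of a b] by simp
    have "d' i y w = (1/2) *\<^sub>R ((P y u (P y v w) - M y u (M y v w)) + (P y v (P y u w) - M y v (M y u w))
        - (P y w (P y u v) - M y w (M y u v)))"
      by (simp add: d'_def uv(1) algebra_simps)
    then have "norm (d' i y w) \<le> (1/2) * (norm (P y u (P y v w) - M y u (M y v w))
        + norm (P y v (P y u w) - M y v (M y u w)) + norm (P y w (P y u v) - M y w (M y u v)))"
      by (simp only: half)
    also have "\<dots> \<le> (1/2) * ((B + C) * N y * norm w + (B + C) * N y * norm w + (B + C) * N y * norm w)"
      using two[of u v w] two[of v u w] two[of w u v] uv(2,3) by (intro mult_left_mono add_mono) simp_all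
    also have "\<dots> = (3/2) * ((B + C) * N y * norm w)" by simp
    \<comment> \<open>Three terms and the factor 1/2 give 3/2, rounded up to the 2 announced in
      \<open>K\<close>.\<close>
    also have "\<dots> \<le> 2 * ((B + C) * N y * norm w)"
      using B C N0[of y] by (intro mult_right_mono mult_nonneg_nonneg) simp_all
    finally show "norm (d' i y w) \<le> 2 * (B + C) * (\<Sum>j\<in>Basis \<times> Basis. norm (d j y)) * norm w"
      by (simp only: N_def mult.assoc)
  qed (use r eq in \<open>auto simp: d_def\<close>)
  then obtain r' where r': "r' > 0" "\<And>y i. y \<in> ball x r' \<Longrightarrow> i \<in> Basis \<times> Basis \<Longrightarrow> d i y = 0"
    by blast
  have "y \<in> S \<and> P y = M y" if "y \<in> ball x (min r r')" for y
  proof -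
    have y: "y \<in> S" using that r by (auto simp: subset_iff)
    moreover have "P y = M y"
      using r'(2)[of y "(_, _)"] that by (intro bilinear_eqI bP bM y) (auto simp: d_def)
    ultimately show ?thesis by simp
  qed
  then show ?thesis using r r' by (intro exI[of _ "min r r'"]) auto
qed

text \<open>That \<open>S\<close> lies in the domain \<open>D\<close> of the model is a conclusion
  here. Agreement is open by local uniqueness; \<open>bdry\<close> keeps limit points of the
  agreement set inside \<open>D\<close>, where continuity of both products closes it.\<close>

lemma product_ode_unique_continuation:
  fixes P M :: "'a::euclidean_space \<Rightarrow> 'a \<Rightarrow> 'a \<Rightarrow> 'a"
  assumes P: "product_ode S P" "open S" "connected S" and M: "product_ode D M" "open D"
    and x0: "x0 \<in> S" "x0 \<in> D" "P x0 = M x0"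
    and bdry: "\<And>x. x \<in> S \<Longrightarrow> x \<in> closure {y\<in>S. y \<in> D \<and> P y = M y} \<Longrightarrow> x \<in> D"
    and x: "x \<in> S"
  shows "x \<in> D \<and> P x = M x"
proof (rule connected_clopen_induct[where Q = "\<lambda>x. x \<in> D \<and> P x = M x", OF P(3) x0(1) _ _ _ x])
  fix x assume x: "x \<in> S" "x \<in> D \<and> P x = M x"
  have "product_ode (S \<inter> D) P" "product_ode (S \<inter> D) M"
    using P M by (auto simp: product_ode_def)
  from product_ode_local_uniqueness[OF this, of x] x P M
  show "\<exists>r>0. \<forall>y\<in>ball x r. y \<in> S \<longrightarrow> y \<in> D \<and> P y = M y" by auto
next
  fix x assume x: "x \<in> S" and cl: "x \<in> closure {y\<in>S. y \<in> D \<and> P y = M y}"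
  have xD: "x \<in> D" using bdry[OF x cl] .
  have "P x u v - M x u v = 0" for u v
  proof (rule zero_on_closure[OF _ cl, where g = "\<lambda>x. P x u v - M x u v"])
    show "continuous (at x) (\<lambda>x. P x u v - M x u v)"
      using P(1) M(1) x xD unfolding product_ode_def
      by (intro continuous_diff has_derivative_continuous) blast+
  qed auto
  then have "P x = M x" by (intro ext) simp
  then show "x \<in> D \<and> P x = M x" using xD by blast
qed (use x0 in auto)

section \<open>Three-dimensional products with derivations\<close>

definition orthonormal3 :: "('a \<Rightarrow> 'a \<Rightarrow> real) \<Rightarrow> 'a \<Rightarrow> 'a \<Rightarrow> 'a \<Rightarrow> bool" where
  "orthonormal3 h a b c \<longleftrightarrow>
     h a a = 1 \<and> h b b = 1 \<and> h c c = 1 \<and> h a b = 0 \<and> h a c = 0 \<and> h b c = 0"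

text \<open>
  In a \<open>split_basis\<close> the nonzero eigenvalues come first; their negative sign makes the affine
  coordinates \<open>-2/l\<close> of the models positive.
\<close>

definition split_basis ::
    "('a::real_vector \<Rightarrow> 'a \<Rightarrow> real) \<Rightarrow> ('a \<Rightarrow> 'a \<Rightarrow> 'a) \<Rightarrow> 'a \<Rightarrow> 'a \<Rightarrow> 'a \<Rightarrow> real \<Rightarrow> real \<Rightarrow> real \<Rightarrow> bool"
  where "split_basis h m a b c l1 l2 l3 \<longleftrightarrow> orthonormal3 h a b c \<and>
     m a a = l1 *\<^sub>R a \<and> m b b = l2 *\<^sub>R b \<and> m c c = l3 *\<^sub>R c \<and> m a b = 0 \<and> m a c = 0 \<and> m b c = 0 \<and>
     l1 \<le> 0 \<and> l2 \<le> 0 \<and> l3 \<le> 0 \<and> (l1 = 0 \<longrightarrow> l2 = 0) \<and> (l2 = 0 \<longrightarrow> l3 = 0)"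

text \<open>The spin factor, a unit plus a Euclidean plane: \<open>a\<close> divided by
  \<open>n\<close> is the unit, and \<open>b\<close> and \<open>c\<close> both square to
  \<open>n\<close> squared times the unit.\<close>

definition spin_basis ::
    "('a::real_vector \<Rightarrow> 'a \<Rightarrow> real) \<Rightarrow> ('a \<Rightarrow> 'a \<Rightarrow> 'a) \<Rightarrow> 'a \<Rightarrow> 'a \<Rightarrow> 'a \<Rightarrow> real \<Rightarrow> bool"
  where "spin_basis h m a b c n \<longleftrightarrow> orthonormal3 h a b c \<and> n < 0 \<and>
     m a a = n *\<^sub>R a \<and> m a b = n *\<^sub>R b \<and> m a c = n *\<^sub>R c \<and> m b b = n *\<^sub>R a \<and> m c c = n *\<^sub>R a \<and> m b c = 0"

lemma orthonormal3_expand: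
  fixes v :: "real^3"
  assumes "orthonormal3 (\<bullet>) a b c"
  shows "v = (v \<bullet> a) *\<^sub>R a + (v \<bullet> b) *\<^sub>R b + (v \<bullet> c) *\<^sub>R c"
proof -
  define w where "w = v - ((v \<bullet> a) *\<^sub>R a + (v \<bullet> b) *\<^sub>R b + (v \<bullet> c) *\<^sub>R c)"
  note o = assms[unfolded orthonormal3_def]
  have w: "w \<bullet> a = 0" "w \<bullet> b = 0" "w \<bullet> c = 0"
    using o by (auto simp: w_def inner_simps inner_commute)
  have "w = 0"
  proof (rule ccontr)
    assume w0: "w \<noteq> 0"
    have ne: "a \<noteq> 0" "b \<noteq> 0" "c \<noteq> 0" "a \<noteq> b" "a \<noteq> c" "b \<noteq> c" using o by auto
    have wne: "w \<noteq> a" "w \<noteq> b" "w \<noteq> c" using w ne by auto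
    have "pairwise orthogonal {w, a, b, c}"
      using o w by (auto simp: pairwise_def orthogonal_def inner_commute)
    then have "independent {w, a, b, c}"
      by (rule pairwise_orthogonal_independent) (use w0 ne in auto)
    then have "card {w, a, b, c} \<le> DIM(real^3)" using independent_bound by blast
    then show False using ne wne by simp
  qed
  then show ?thesis by (simp add: w_def)
qed

text \<open>\<open>real^'n\<close> has a componentwise product, so \<open>v + v\<close> may be
  collected as \<open>2 * v\<close>; these rules turn such terms back into scalar multiples.\<close>

lemma numeral_mult_vec: "numeral n * v = numeral n *\<^sub>R v" "v * numeral n = numeral n *\<^sub>R v"
  for v :: "real^'n"
  by (simp_all add: vec_eq_iff numeral_index)

lemma unit_orthogonal_exists:
  fixes a b :: "real^3"
  shows "\<exists>v. v \<bullet> v = 1 \<and> a \<bullet> v = 0 \<and> b \<bullet> v = 0"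
proof -
  have "dim {a, b} \<le> card {a, b}" by (rule dim_le_card) (auto intro: span_base)
  also have "\<dots> \<le> 2" by (simp add: card_insert_if)
  finally have "dim {a, b} < DIM(real^3)" by simp
  then obtain v where v: "v \<noteq> 0" "\<And>y. y \<in> span {a, b} \<Longrightarrow> orthogonal v y"
    using orthogonal_to_subspace_exists by blast
  then have "a \<bullet> v = 0" "b \<bullet> v = 0"
    by (auto simp: orthogonal_def span_base inner_commute)
  with v(1) show ?thesis
    by (intro exI[of _ "v /\<^sub>R norm v"]) (simp add: dot_square_norm power2_eq_square field_simps)
qed

section \<open>Extremal values of forms on the unit sphere\<close>

lemma quadratic_first_variation:
  fixes A B C :: real
  assumes "\<And>t. A \<le> A * (cos t)\<^sup>2 + 2 * B * cos t * sin t + C * (sin t)\<^sup>2"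
  shows "B = 0"
proof -
  let ?g = "\<lambda>t. A * (cos t)\<^sup>2 + 2 * B * cos t * sin t + C * (sin t)\<^sup>2"
  have "DERIV ?g 0 :> 2 * B" by (auto intro!: derivative_eq_intros)
  then have "2 * B = 0"
    by (rule DERIV_local_min[where d = 1]) (use assms in auto)
  then show ?thesis by simp
qed

text \<open>The right side is a cubic form along the great circle through a minimiser at
  \<open>t = 0\<close>, and \<open>3 * B\<close> is its derivative there.\<close>

lemma cubic_first_variation:
  fixes A B C D :: real
  assumes "\<And>t. A \<le> A * (cos t)^3 + 3 * B * (cos t)\<^sup>2 * sin t + 3 * C * cos t * (sin t)\<^sup>2 + D * (sin t)^3"
  shows "B = 0"
proof -
  let ?g = "\<lambda>t. A * (cos t)^3 + 3 * B * (cos t)\<^sup>2 * sin t + 3 * C * cos t * (sin t)\<^sup>2 + D * (sin t)^3"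
  have "DERIV ?g 0 :> 3 * B" by (auto intro!: derivative_eq_intros)
  then have "3 * B = 0"
    by (rule DERIV_local_min[where d = 1]) (use assms in auto)
  then show ?thesis by simp
qed

lemma minimum_on_sphere:
  fixes W :: "(real^3) set" and g :: "real^3 \<Rightarrow> real"
  assumes W: "subspace W" and a: "a \<in> W" "a \<bullet> a = 1" and g: "continuous_on (sphere 0 1 \<inter> W) g"
  obtains e where "e \<in> W" "e \<bullet> e = 1" "\<forall>v\<in>W. v \<bullet> v = 1 \<longrightarrow> g e \<le> g v"
proof -
  have "compact (sphere 0 1 \<inter> W)"
    by (intro compact_Int_closed compact_sphere closed_subspace W)
  moreover have "sphere 0 1 \<inter> W \<noteq> {}" using a by (auto simp: norm_eq_1)
  ultimately obtain e where "e \<in> sphere 0 1 \<inter> W" "\<forall>v\<in>sphere 0 1 \<inter> W. g e \<le> g v"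
    using continuous_attains_inf[OF _ _ g] by blast
  then show ?thesis by (intro that[of e]) (auto simp: norm_eq_1)
qed

lemma circle_in_subspace:
  assumes "subspace W" "e \<in> W" "v \<in> W" "e \<bullet> e = 1" "v \<bullet> v = 1" "e \<bullet> v = 0" "c\<^sup>2 + s\<^sup>2 = 1"
  shows "c *\<^sub>R e + s *\<^sub>R v \<in> W" "(c *\<^sub>R e + s *\<^sub>R v) \<bullet> (c *\<^sub>R e + s *\<^sub>R v) = 1"
  using assms by (auto simp: subspace_add subspace_scale inner_simps inner_commute[of v e] power2_eq_square)

text \<open>The algebra is done for the dot product, where compact spheres and orthogonal
  complements are at hand; \<open>form_split_or_spin\<close> transports the result to an arbitrary
  positive definite form. With \<open>com\<close>, the axiom \<open>inv\<close> makes the trilinear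
  form \<open>m u v \<bullet> w\<close> totally symmetric.\<close>

locale derivation_product =
  fixes m :: "real^3 \<Rightarrow> real^3 \<Rightarrow> real^3"
  assumes bil: "bilinear m"
    and com: "m u v = m v u"
    and inv: "m u v \<bullet> w = m u w \<bullet> v"
    and der: "m z (m w (m u v)) - m w (m z (m u v)) =
      m u (m z (m w v) - m w (m z v)) + m v (m z (m w u) - m w (m z u))"
begin

lemmas lin = bilinear_ladd[OF bil] bilinear_radd[OF bil] bilinear_lsub[OF bil] bilinear_rsub[OF bil]
  bilinear_lmul[OF bil] bilinear_rmul[OF bil] bilinear_lneg[OF bil] bilinear_rneg[OF bil]
  bilinear_lzero[OF bil] bilinear_rzero[OF bil] numeral_mult_vec

lemma perm: "m u v \<bullet> w = m w v \<bullet> u"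
  by (metis com inv)

lemma product_continuous:
  assumes "continuous_on S f" "continuous_on S g" "continuous_on S h"
  shows "continuous_on S (\<lambda>v. m (f v) (g v) \<bullet> h v)"
  using assms bil unfolding bilinear_conv_bounded_bilinear
  by (intro continuous_on_inner bounded_bilinear.continuous_on[of m])

lemma cubic_expand:
  "m (c *\<^sub>R e + s *\<^sub>R v) (c *\<^sub>R e + s *\<^sub>R v) \<bullet> (c *\<^sub>R e + s *\<^sub>R v) =
   (m e e \<bullet> e) * c^3 + 3 * (m e e \<bullet> v) * c\<^sup>2 * s + 3 * (m e v \<bullet> v) * c * s\<^sup>2 + (m v v \<bullet> v) * s^3"
  using inv[of e v e] inv[of v e v]
  by (simp add: lin inner_simps com[of v e] power2_eq_square power3_eq_cube algebra_simps)

text \<open>The sign comes from comparing \<open>e\<close> with \<open>- e\<close>, the second claim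
  from the first variation. The third replaces a second variation: it is weaker than
  \<open>m e e \<bullet> e \<le> 2 * (m e v \<bullet> v)\<close>, but enough to exclude that
  \<open>m e v \<bullet> v\<close> equals a negative \<open>m e e \<bullet> e\<close>.\<close>

lemma cubic_minimum:
  assumes W: "subspace W" and e: "e \<in> W" "e \<bullet> e = 1"
    and min: "\<forall>v\<in>W. v \<bullet> v = 1 \<longrightarrow> m e e \<bullet> e \<le> m v v \<bullet> v"
  shows "m e e \<bullet> e \<le> 0"
    and "v \<in> W \<Longrightarrow> v \<bullet> v = 1 \<Longrightarrow> e \<bullet> v = 0 \<Longrightarrow> m e e \<bullet> v = 0"
    and "v \<in> W \<Longrightarrow> v \<bullet> v = 1 \<Longrightarrow> e \<bullet> v = 0 \<Longrightarrow> 61 * (m e e \<bullet> e) \<le> 108 * (m e v \<bullet> v)"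
proof -
  show "m e e \<bullet> e \<le> 0"
    using bspec[OF min, of "- e"] e W by (simp add: lin subspace_neg)
  assume v: "v \<in> W" "v \<bullet> v = 1" "e \<bullet> v = 0"
  have *: "m e e \<bullet> e \<le> (m e e \<bullet> e) * c^3 + 3 * (m e e \<bullet> v) * c\<^sup>2 * s + 3 * (m e v \<bullet> v) * c * s\<^sup>2 + (m v v \<bullet> v) * s^3"
    if "c\<^sup>2 + s\<^sup>2 = 1" for c s
    using bspec[OF min circle_in_subspace(1)[OF W e(1) v(1) e(2) v(2,3) that]]
      circle_in_subspace(2)[OF W e(1) v(1) e(2) v(2,3) that] by (simp add: cubic_expand)
  show "m e e \<bullet> v = 0"
    by (rule cubic_first_variation) (rule *, simp)
  \<comment> \<open>A Pythagorean triple gives rational points on the circle. Adding the comparisons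
    for \<open>s\<close> and \<open>- s\<close> removes the odd terms; with 64/125 = 1 - 61/125 and
    3 (4/5) (9/25) = 108/125 this is the claim.\<close>
  show "61 * (m e e \<bullet> e) \<le> 108 * (m e v \<bullet> v)"
    using *[of "4/5" "3/5"] *[of "4/5" "-3/5"] by (simp add: power2_eq_square power3_eq_cube)
qed

text \<open>The cubic form is odd, so a minimum zero makes it vanish on \<open>W\<close>;
  polarisation then removes the whole trilinear form.\<close>

lemma cubic_zero:
  assumes W: "subspace W" and e: "e \<in> W" "e \<bullet> e = 1"
    and min: "\<forall>v\<in>W. v \<bullet> v = 1 \<longrightarrow> m e e \<bullet> e \<le> m v v \<bullet> v"
    and zero: "m e e \<bullet> e = 0" and abc: "a \<in> W" "b \<in> W" "c \<in> W"
  shows "m a b \<bullet> c = 0"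
proof -
  have p0: "m v v \<bullet> v = 0" if v: "v \<in> W" for v
  proof (cases "v = 0")
    case False
    define u where "u = v /\<^sub>R norm v"
    have u: "u \<in> W" "u \<bullet> u = 1"
      using v False W by (auto simp: u_def subspace_scale dot_square_norm power2_eq_square)
    have "m u u \<bullet> u = 0"
      using bspec[OF min u(1)] bspec[OF min, of "- u"] u zero W by (simp add: lin subspace_neg)
    moreover have "v = norm v *\<^sub>R u" using False by (simp add: u_def)
    then have "m v v \<bullet> v = m (norm v *\<^sub>R u) (norm v *\<^sub>R u) \<bullet> (norm v *\<^sub>R u)" by simp
    ultimately show ?thesis by (simp add: lin)
  qed (simp add: lin)
  have in_W: "a + b + c \<in> W" "a + b - c \<in> W" "a - b + c \<in> W" "a - b - c \<in> W"
    using W abc by (auto intro: subspace_add subspace_diff)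
  \<comment> \<open>Polarisation of a cubic form: four sign patterns, each contributing 3! copies of
    the mixed term.\<close>
  have "24 * (m a b \<bullet> c) = m (a + b + c) (a + b + c) \<bullet> (a + b + c) - m (a + b - c) (a + b - c) \<bullet> (a + b - c)
    - m (a - b + c) (a - b + c) \<bullet> (a - b + c) + m (a - b - c) (a - b - c) \<bullet> (a - b - c)"
    using inv[of a c b] perm[of c b a]
    by (simp add: lin inner_simps com[of b a] com[of c a] com[of c b])
  then show ?thesis using p0[OF in_W(1)] p0[OF in_W(2)] p0[OF in_W(3)] p0[OF in_W(4)] by simp
qed

text \<open>Each relation between structure constants below is one choice of these five
  vectors.\<close>

lemma derivation_at:
  "(m z (m w (m u v)) - m w (m z (m u v))) \<bullet> k =
    (m u (m z (m w v) - m w (m z v)) + m v (m z (m w u) - m w (m z u))) \<bullet> k"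
  using der by simp

text \<open>Apply the derivation given by the commutator of \<open>m v\<close> and
  \<open>m e\<close> to \<open>m e e\<close>: both sides are multiples of \<open>v\<close>. For
  nonzero \<open>l\<close> the roots are the Peirce eigenvalues 1, 1/2, 0 of the idempotent
  \<open>e\<close> divided by \<open>l\<close>, scaled by \<open>l\<close>.\<close>

lemma peirce:
  assumes "m e e = l *\<^sub>R e" "m e v = k *\<^sub>R v" "v \<noteq> 0"
  shows "k * (l - k) * (l - 2 * k) = 0"
proof -
  have ve: "m v e = k *\<^sub>R v" using assms com by metis
  have "(l * l * k - l * k * k) *\<^sub>R v = (2 * (l * k * k - k * k * k)) *\<^sub>R v"
    using der[of v e e e] by (simp add: assms ve lin algebra_simps)
  then have "l * l * k - l * k * k = 2 * (l * k * k - k * k * k)" using assms(3) by simp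
  then show ?thesis by (simp add: algebra_simps)
qed

text \<open>The structure constants are forced one by one until
  \<open>m b b = (2 * z) *\<^sub>R b\<close> and \<open>m b c = z *\<^sub>R c\<close> with
  \<open>z\<close> equal to \<open>k\<close> up to sign. So \<open>b\<close> carries a second
  idempotent, of the same length as that of \<open>e\<close>, and \<open>c\<close> is a half
  eigenvector of both. The sum of the two idempotents is the unit, a multiple of
  \<open>e + s *\<^sub>R b\<close>.\<close>

lemma spin_case:
  assumes o: "orthonormal3 (\<bullet>) e b c" and l: "l < 0"
    and ee: "m e e = l *\<^sub>R e" and eb: "m e b = 0" and ec: "m e c = (l/2) *\<^sub>R c"
  shows "\<exists>a b c n. spin_basis (\<bullet>) m a b c n"
proof -
  define k where "k = l / 2"
  have k: "l = 2 * k" "k < 0" using l by (auto simp: k_def)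
  define x y z t where "x = m b b \<bullet> b" "y = m b b \<bullet> c" "z = m b c \<bullet> c" "t = m c c \<bullet> c"
  note o' = o[unfolded orthonormal3_def]
  have i: "e \<bullet> e = 1" "b \<bullet> b = 1" "c \<bullet> c = 1" "e \<bullet> b = 0" "b \<bullet> e = 0" "e \<bullet> c = 0" "c \<bullet> e = 0" "b \<bullet> c = 0" "c \<bullet> b = 0"
    using o' by (auto simp: inner_commute)
  have bb: "m b b = x *\<^sub>R b + y *\<^sub>R c"
    using orthonormal3_expand[OF o, of "m b b"] perm[of b b e] eb i by (simp add: x_y_z_t_def)
  have bc: "m b c = y *\<^sub>R b + z *\<^sub>R c"
    using orthonormal3_expand[OF o, of "m b c"] perm[of b c e] inv[of b c b] ec i by (simp add: x_y_z_t_def)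
  have cc: "m c c = k *\<^sub>R e + z *\<^sub>R b + t *\<^sub>R c"
    using orthonormal3_expand[OF o, of "m c c"] perm[of c c e] perm[of c c b] ec i k by (simp add: x_y_z_t_def)
  note prod = ee eb ec[folded k_def] bb bc cc com[of b e] com[of c e] com[of c b] k(1)
  note ev = prod lin inner_simps i
  have y0: "y = 0"
    using derivation_at[of e c e b b] k by (simp add: ev)
  have eq1: "z * (x - 2 * z) = 0"
    using derivation_at[of e c b b c] k y0 by (simp add: ev algebra_simps)
  have t0: "t = 0"
    using derivation_at[of e c c c e] k y0 by (simp add: ev algebra_simps)
  have eq2: "z * z = k * k"
    using derivation_at[of e c c c c] k y0 t0 by (simp add: ev algebra_simps)
  have z0: "z \<noteq> 0" using eq2 k by auto
  have x: "x = 2 * z" using eq1 z0 by simp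
  \<comment> \<open>\<open>s\<close> is 1 or -1 and orients \<open>b\<close> so that its eigenvalue
    gets the sign of \<open>k\<close>; then \<open>e\<close> and \<open>s *\<^sub>R b\<close> play
    equal roles.\<close>
  define s where "s = z / k"
  have s: "s * s = 1" "z = s * k" using eq2 k by (auto simp: s_def field_simps)
  have s1: "s = 1 \<or> s = -1" using s(1) by (simp add: square_eq_1_iff)
  define r where "r = (sqrt 2)"
  have r: "r * r = 2" "r > 0" by (auto simp: r_def)
  have "spin_basis (\<bullet>) m ((1/r) *\<^sub>R (e + s *\<^sub>R b)) ((1/r) *\<^sub>R (e - s *\<^sub>R b)) c (r * k)"
    using r k s1
    by (auto simp: spin_basis_def orthonormal3_def ev x y0 t0 s(2) field_simps mult_neg_pos vec_eq_iff forall_3)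
  then show ?thesis by blast
qed

text \<open>The square of a half eigenvector \<open>v\<close> must have a part in the 0-eigenspace
  of \<open>e\<close>; here it has none. In the derivation identity for \<open>e\<close>,
  \<open>v\<close> applied to \<open>m v v\<close> and paired with \<open>v\<close>, the
  contributions of \<open>s\<close> cancel and \<open>- k^3 = 2 * k^3\<close> is left.\<close>

lemma no_half_eigenvalue:
  assumes "m e e = (2 * k) *\<^sub>R e" "m e v = k *\<^sub>R v" "m v v = k *\<^sub>R e + s" "m e s = k *\<^sub>R s"
    "v \<bullet> v = 1" "e \<bullet> v = 0" "k \<noteq> 0"
  shows False
proof -
  have *: "m e (m v s) \<bullet> v = k * (m v s \<bullet> v)"
    using perm[of e "m v s" v] inv[of v "m v s" e] com[of v s] com[of v e] perm[of "m v s" v e] perm[of "m v s" e v] assms(2)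
    by (metis com inner_commute inner_scaleR_left)
  have "k * k * k = 0"
    using derivation_at[of e v v v v] assms(5,6)
    by (simp add: assms(1-4) com[of v e] lin inner_simps * algebra_simps)
  then show False using assms(7) by simp
qed

text \<open>Since \<open>e\<close> annihilates its complement, invariance of the form makes that
  plane closed under the product, and the minimisation can be repeated inside it.\<close>

lemma split_case:
  assumes e: "e \<bullet> e = 1" and l: "l < 0" and ee: "m e e = l *\<^sub>R e"
    and ann: "\<And>v. v \<bullet> e = 0 \<Longrightarrow> m e v = 0"
  shows "\<exists>a b c l1 l2 l3. split_basis (\<bullet>) m a b c l1 l2 l3"
proof -
  define W where "W = {v. v \<bullet> e = 0}"
  have W: "subspace W" by (auto simp: W_def subspace_def inner_simps)
  obtain w where "w \<bullet> w = 1" "e \<bullet> w = 0" using unit_orthogonal_exists by blast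
  then have "w \<in> W" "w \<bullet> w = 1" by (auto simp: W_def inner_commute)
  then obtain b where b: "b \<in> W" "b \<bullet> b = 1"
    and min: "\<forall>v\<in>W. v \<bullet> v = 1 \<longrightarrow> m b b \<bullet> b \<le> m v v \<bullet> v"
    using minimum_on_sphere[OF W _ _ product_continuous[OF continuous_on_id continuous_on_id continuous_on_id]]
    by (metis (no_types, lifting))
  obtain c where c: "c \<bullet> c = 1" "e \<bullet> c = 0" "b \<bullet> c = 0" using unit_orthogonal_exists by blast
  have cW: "c \<in> W" using c by (simp add: W_def inner_commute)
  note cm = cubic_minimum[OF W b min]
  have i: "e \<bullet> e = 1" "b \<bullet> b = 1" "c \<bullet> c = 1" "e \<bullet> b = 0" "b \<bullet> e = 0" "e \<bullet> c = 0" "c \<bullet> e = 0" "b \<bullet> c = 0" "c \<bullet> b = 0"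
    using e b c by (auto simp: W_def inner_commute)
  have o: "orthonormal3 (\<bullet>) e b c" using i by (simp add: orthonormal3_def)
  have eb: "m e b = 0" and ec: "m e c = 0" using ann i by auto
  define x z t where "x = m b b \<bullet> b" "z = m b c \<bullet> c" "t = m c c \<bullet> c"
  have y: "m b b \<bullet> c = 0" using cm(2)[OF cW c(1,3)] .
  have bb: "m b b = x *\<^sub>R b"
    using orthonormal3_expand[OF o, of "m b b"] perm[of b b e] eb y by (simp add: x_z_t_def)
  have bc: "m b c = z *\<^sub>R c"
    using orthonormal3_expand[OF o, of "m b c"] perm[of b c e] inv[of b c b] ec y by (simp add: x_z_t_def)
  have cc: "m c c = z *\<^sub>R b + t *\<^sub>R c"
    using orthonormal3_expand[OF o, of "m c c"] perm[of c c e] perm[of c c b] ec by (simp add: x_z_t_def)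
  have x0: "x \<le> 0" using cm(1) by (simp add: x_z_t_def)
  show ?thesis
  proof (cases "x = 0")
    case True
    then have "z = 0" "t = 0"
      using cubic_zero[OF W b min _ b(1) cW cW] cubic_zero[OF W b min _ cW cW cW] by (auto simp: x_z_t_def)
    then have "split_basis (\<bullet>) m e b c l 0 0"
      using True l o by (simp add: split_basis_def ee bb bc cc eb ec)
    then show ?thesis by blast
  next
    case False
    then have xn: "x < 0" using x0 by simp
    have "z * (x - z) * (x - 2 * z) = 0" using peirce[OF bb bc] i(3) by fastforce
    moreover have "z \<noteq> x" using cm(3)[OF cW c(1,3)] xn by (auto simp: x_z_t_def)
    \<comment> \<open>Inside the plane no room is left for a 0-eigenspace of \<open>b\<close>:
      \<open>m c c\<close> lies in the span of \<open>b\<close> and the half eigenvector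
      \<open>c\<close>.\<close>
    moreover have "x \<noteq> 2 * z"
    proof
      assume "x = 2 * z"
      then show False
        using no_half_eigenvalue[of b z c "t *\<^sub>R c"] bb bc cc i xn by (auto simp: lin)
    qed
    ultimately have z: "z = 0" by auto
    show ?thesis
    proof (cases "t \<le> 0")
      case True
      then have "split_basis (\<bullet>) m e b c l x t"
        using xn l o z by (simp add: split_basis_def ee bb bc cc eb ec)
      then show ?thesis by blast
    next
      case False
      \<comment> \<open>Replacing \<open>c\<close> by \<open>- c\<close> changes the sign of its
        eigenvalue.\<close>
      then have "split_basis (\<bullet>) m e b (- c) l x (- t)"
        using xn l o z by (simp add: split_basis_def orthonormal3_def ee bb bc cc eb ec lin)
      then show ?thesis by blast
    qed
  qed
qed

text \<open>The cubic minimum makes \<open>m e e\<close> a multiple of \<open>e\<close>, so the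
  symmetric operator \<open>m e\<close> preserves the complement of \<open>e\<close>. A second
  minimisation, of the quadratic form of \<open>m e\<close> on that plane, supplies its eigenvectors
  \<open>b\<close> and \<open>c\<close>.\<close>

lemma split_or_spin:
  "(\<exists>a b c l1 l2 l3. split_basis (\<bullet>) m a b c l1 l2 l3) \<or> (\<exists>a b c n. spin_basis (\<bullet>) m a b c n)"
proof -
  have U: "subspace (UNIV :: (real^3) set)" by simp
  obtain w :: "real^3" where "w \<bullet> w = 1" using unit_orthogonal_exists by blast
  then obtain e :: "real^3" where e: "e \<in> UNIV" "e \<bullet> e = 1"
    and min: "\<forall>v\<in>UNIV. v \<bullet> v = 1 \<longrightarrow> m e e \<bullet> e \<le> m v v \<bullet> v"
    using minimum_on_sphere[OF U _ _ product_continuous[OF continuous_on_id continuous_on_id continuous_on_id]]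
    by (metis (no_types, lifting) UNIV_I)
  note cm = cubic_minimum[OF U e min]
  define l where "l = m e e \<bullet> e"
  define W where "W = {v. v \<bullet> e = 0}"
  have W: "subspace W" by (auto simp: W_def subspace_def inner_simps)
  obtain w where "w \<bullet> w = 1" "e \<bullet> w = 0" using unit_orthogonal_exists by blast
  then have "w \<in> W" "w \<bullet> w = 1" by (auto simp: W_def inner_commute)
  then obtain b where b: "b \<in> W" "b \<bullet> b = 1"
    and minb: "\<forall>v\<in>W. v \<bullet> v = 1 \<longrightarrow> m e b \<bullet> b \<le> m e v \<bullet> v"
    using minimum_on_sphere[OF W _ _ product_continuous[OF continuous_on_const[of _ e] continuous_on_id continuous_on_id]]
    by (metis (no_types, lifting))
  obtain c where c: "c \<bullet> c = 1" "e \<bullet> c = 0" "b \<bullet> c = 0" using unit_orthogonal_exists by blast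
  have cW: "c \<in> W" using c by (simp add: W_def inner_commute)
  have i: "e \<bullet> e = 1" "b \<bullet> b = 1" "c \<bullet> c = 1" "e \<bullet> b = 0" "b \<bullet> e = 0" "e \<bullet> c = 0" "c \<bullet> e = 0" "b \<bullet> c = 0" "c \<bullet> b = 0"
    using e b c by (auto simp: W_def inner_commute)
  have o: "orthonormal3 (\<bullet>) e b c" using i by (simp add: orthonormal3_def)
  show ?thesis
  proof (cases "l = 0")
    case True
    then have "m e e \<bullet> e = 0" by (simp only: l_def)
    then have z: "m u v \<bullet> w = 0" for u v w
      by - (rule cubic_zero[OF U e min _ UNIV_I UNIV_I UNIV_I])
    have "m u v = 0" for u v using z[of u v "m u v"] by simp
    then have "split_basis (\<bullet>) m e b c 0 0 0" using o by (simp add: split_basis_def)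
    then show ?thesis by blast
  next
    case False
    then have l: "l < 0" using cm(1) by (simp add: l_def)
    have eeb: "m e e \<bullet> b = 0" "m e e \<bullet> c = 0"
      using cm(2)[OF UNIV_I i(2,4)] cm(2)[OF UNIV_I i(3,6)] by auto
    have ebc: "m e b \<bullet> c = 0"
    proof (rule quadratic_first_variation)
      fix t
      have "m e b \<bullet> b \<le> m e (cos t *\<^sub>R b + sin t *\<^sub>R c) \<bullet> (cos t *\<^sub>R b + sin t *\<^sub>R c)"
        using bspec[OF minb circle_in_subspace(1)[OF W b(1) cW i(2,3,8) sin_cos_squared_add2]]
          circle_in_subspace(2)[OF W b(1) cW i(2,3,8) sin_cos_squared_add2] by blast
      also have "\<dots> = (m e b \<bullet> b) * (cos t)\<^sup>2 + 2 * (m e b \<bullet> c) * cos t * sin t + (m e c \<bullet> c) * (sin t)\<^sup>2"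
        using inv[of e c b] by (simp add: lin inner_simps power2_eq_square algebra_simps)
      finally show "m e b \<bullet> b \<le> (m e b \<bullet> b) * (cos t)\<^sup>2 + 2 * (m e b \<bullet> c) * cos t * sin t + (m e c \<bullet> c) * (sin t)\<^sup>2" .
    qed
    have ee: "m e e = l *\<^sub>R e"
      using orthonormal3_expand[OF o, of "m e e"] eeb by (simp add: l_def)
    define p where "p = m e b \<bullet> b"
    define q where "q = m e c \<bullet> c"
    have eb: "m e b = p *\<^sub>R b"
      using orthonormal3_expand[OF o, of "m e b"] inv[of e b e] eeb ebc by (simp add: p_def)
    have ec: "m e c = q *\<^sub>R c"
      using orthonormal3_expand[OF o, of "m e c"] inv[of e c e] inv[of e c b] eeb ebc by (simp add: q_def)
    have ne: "b \<noteq> 0" "c \<noteq> 0" using i(2,3) by auto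
    \<comment> \<open>\<open>peirce\<close> allows 0, \<open>l\<close> and \<open>l / 2\<close>; the
      bound \<open>61 * l \<le> 108 * p\<close> excludes \<open>p = l\<close> because
      \<open>l < 0\<close>.\<close>
    have p: "p = 0 \<or> p = l / 2"
      using peirce[OF ee eb ne(1)] cm(3)[OF UNIV_I i(2,4)] i l by (auto simp: p_def l_def)
    have q: "q = 0 \<or> q = l / 2"
      using peirce[OF ee ec ne(2)] cm(3)[OF UNIV_I i(3,6)] i l by (auto simp: q_def l_def)
    consider "p = 0" "q = 0" | "p = 0" "q = l / 2" | "p = l / 2" "q = 0" | "p = l / 2" "q = l / 2"
      using p q by blast
    then show ?thesis
    proof cases
      case 1
      have "m e v = 0" if "v \<bullet> e = 0" for v
      proof -
        have "v = (v \<bullet> b) *\<^sub>R b + (v \<bullet> c) *\<^sub>R c" using orthonormal3_expand[OF o, of v] that by simp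
        then have "m e v = m e ((v \<bullet> b) *\<^sub>R b + (v \<bullet> c) *\<^sub>R c)" by simp
        then show ?thesis using 1 by (simp add: lin eb ec)
      qed
      then show ?thesis using split_case[OF i(1) l ee] by blast
    next
      case 2
      then show ?thesis using spin_case[OF o l ee] eb ec by simp
    next
      case 3
      have "orthonormal3 (\<bullet>) e c b" using i by (simp add: orthonormal3_def)
      then show ?thesis using spin_case[of e c b l] l ee eb ec 3 by simp
    next
      case 4
      \<comment> \<open>The whole complement of \<open>e\<close> consists of half eigenvectors, so
        the part \<open>s\<close> of \<open>m b b\<close> orthogonal to \<open>e\<close> is one as
        well.\<close>
      define s where "s = (m b b \<bullet> b) *\<^sub>R b + (m b b \<bullet> c) *\<^sub>R c"
      have "m b b = (l / 2) *\<^sub>R e + s"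
        using orthonormal3_expand[OF o, of "m b b"] perm[of b b e] eb 4 i by (simp add: s_def add.assoc)
      moreover have "m e s = (l / 2) *\<^sub>R s" by (simp add: s_def lin eb ec 4 algebra_simps)
      ultimately show ?thesis
        using no_half_eigenvalue[of e "l / 2" b s] ee eb 4 i l by simp
    qed
  qed
qed

end

section \<open>Calabi geometry in invariant notation\<close>

lemma linear_axis_expand:
  fixes g :: "real^'n::finite \<Rightarrow> 'b::real_vector"
  assumes "linear g"
  shows "g w = (\<Sum>l\<in>UNIV. w $ l *\<^sub>R g (axis l 1))"
proof -
  have "g w = g (\<Sum>l\<in>UNIV. w $ l *\<^sub>R axis l 1)"
    by (simp add: basis_expansion flip: scalar_mult_eq_scaleR)
  then show ?thesis using assms by (simp add: linear_sum linear_cmul)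
qed

lemma partial_eqI: "(f has_derivative D) (at x) \<Longrightarrow> partial i f x = D (axis i 1)"
  unfolding partial_def using frechet_derivative_at by metis

lemma partial_cong_open:
  assumes "open S" "x \<in> S" "\<And>y. y \<in> S \<Longrightarrow> f y = g y" "g differentiable (at x)"
  shows "partial i f x = partial i g x"
proof -
  obtain D where D: "(g has_derivative D) (at x)" using assms(4) by (auto simp: differentiable_def)
  then have "(f has_derivative D) (at x)"
    by (rule has_derivative_transform_within_open[OF _ assms(1,2)]) (simp add: assms(3))
  with D show ?thesis by (simp add: partial_eqI)
qed

lemma smooth_on_partial: "smooth_on S f \<Longrightarrow> smooth_on S (partial i f)"
  unfolding smooth_on_def by (metis Ck_on.simps(2))

lemma smooth_on_differentiable: "smooth_on S f \<Longrightarrow> x \<in> S \<Longrightarrow> f differentiable (at x)"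
  unfolding smooth_on_def by (metis Ck_on.simps(2))

lemma differentiable_has_partials:
  assumes "f differentiable (at x)"
  shows "(f has_derivative (\<lambda>w. \<Sum>l\<in>UNIV. w $ l * partial l f x)) (at x)"
proof -
  have D: "(f has_derivative frechet_derivative f (at x)) (at x)"
    using assms frechet_derivative_works by blast
  have "frechet_derivative f (at x) = (\<lambda>w. \<Sum>l\<in>UNIV. w $ l * partial l f x)"
  proof
    fix w show "frechet_derivative f (at x) w = (\<Sum>l\<in>UNIV. w $ l * partial l f x)"
      using linear_axis_expand[OF has_derivative_linear[OF D], of w] by (simp add: partial_def)
  qed
  from D[unfolded this] show ?thesis .
qed

lemma sum_axis_mult: "(\<Sum>l\<in>UNIV. axis i (1::real) $ l * g l) = g i"
  by (simp add: axis_def if_distrib if_distribR cong: if_cong)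

lemma smooth_partial_commute:
  assumes "smooth_on S f" "open S" "x \<in> S"
  shows "partial i (partial j f) x = partial j (partial i f) x"
proof -
  define F where "F y w = (\<Sum>l\<in>UNIV. w $ l * partial l f y)" for y w
  have F_axis: "F y (axis i 1) = partial i f y" for y i
    by (simp add: F_def sum_axis_mult)
  have d2: "((\<lambda>y. F y (axis i 1)) has_derivative (\<lambda>w. \<Sum>l\<in>UNIV. w $ l * partial l (partial i f) x)) (at x)" for i
    unfolding F_axis
    by (intro differentiable_has_partials smooth_on_differentiable[OF _ assms(3)] smooth_on_partial assms)
  have "(\<lambda>w. \<Sum>l\<in>UNIV. w $ l * partial l (partial j f) x) (axis i 1)
      = (\<lambda>w. \<Sum>l\<in>UNIV. w $ l * partial l (partial i f) x) (axis j 1)"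
  proof (rule second_derivative_symmetric[where f = f and F = F and u = "axis j 1" and v = "axis i 1"
        and Fu = "\<lambda>w. \<Sum>l\<in>UNIV. w $ l * partial l (partial j f) x"
        and Fv = "\<lambda>w. \<Sum>l\<in>UNIV. w $ l * partial l (partial i f) x", OF assms(2,3)])
    show "(f has_derivative F y) (at y)" if "y \<in> S" for y
      unfolding F_def by (intro differentiable_has_partials smooth_on_differentiable[OF assms(1) that])
  qed (rule d2)+
  then show ?thesis by (simp add: sum_axis_mult)
qed

definition third :: "(real^'n::finite \<Rightarrow> real) \<Rightarrow> real^'n \<Rightarrow> real^'n \<Rightarrow> real^'n \<Rightarrow> real^'n \<Rightarrow> real" where
  "third f x u v z = (\<Sum>i\<in>UNIV. \<Sum>j\<in>UNIV. \<Sum>k\<in>UNIV. u $ i * v $ j * z $ k * partial i (partial j (partial k f)) x)"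

definition hessian_form :: "(real^'n::finite \<Rightarrow> real) \<Rightarrow> real^'n \<Rightarrow> real^'n \<Rightarrow> real^'n \<Rightarrow> real" where
  "hessian_form f x u v = u \<bullet> (hessian f x *v v)"

text \<open>The product \<open>u \<circ> v\<close> with \<open>G(u \<circ> v, z) = D\<^sup>3f(u, v, z)\<close>; it is \<open>-2\<close> times the index-raised
  cubic form, and twice the Christoffel symbols.\<close>

definition calabi_product :: "(real^'n::finite \<Rightarrow> real) \<Rightarrow> real^'n \<Rightarrow> real^'n \<Rightarrow> real^'n \<Rightarrow> real^'n" where
  "calabi_product f x u v = matrix_inv (hessian f x) *v (\<chi> k. third f x u v (axis k 1))"

lemma third_axis: "third f x (axis i 1) (axis j 1) (axis k 1) = partial i (partial j (partial k f)) x"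
  by (simp add: third_def sum_axis_mult mult.assoc flip: sum_distrib_left)

lemma linear_third:
  "linear (\<lambda>u. third f x u v z)" "linear (\<lambda>v. third f x u v z)" "linear (\<lambda>z. third f x u v z)"
  unfolding third_def
  by (auto intro!: linearI simp: algebra_simps sum.distrib sum_distrib_left)

lemma differentiable_prod:
  fixes g :: "'i \<Rightarrow> 'a::real_normed_vector \<Rightarrow> real"
  assumes "finite I" "\<And>i. i \<in> I \<Longrightarrow> g i differentiable (at x)"
  shows "(\<lambda>y. \<Prod>i\<in>I. g i y) differentiable (at x)"
  using assms by (induction I) auto

lemma det_differentiable:
  fixes A :: "'a::real_normed_vector \<Rightarrow> real^'n::finite^'n"
  assumes "\<And>i j. (\<lambda>y. A y $ i $ j) differentiable (at x)"
  shows "(\<lambda>y. det (A y)) differentiable (at x)"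
  unfolding det_def
  by (intro differentiable_sum ballI differentiable_mult differentiable_const differentiable_prod assms)
    (auto simp: finite_permutations)

lemma positive_definite_invertible:
  fixes B :: "real^'n::finite^'n"
  assumes "positive_definite B"
  shows "invertible B" "det B \<noteq> 0"
proof -
  have "B *v v = 0 \<longrightarrow> v = 0" for v
    using assms unfolding positive_definite_def by (metis inner_zero_right less_irrefl)
  then show "invertible B"
    by (simp add: invertible_left_inverse matrix_left_invertible_ker)
  then show "det B \<noteq> 0" by (simp add: invertible_det_nz)
qed

section \<open>Graphs with parallel cubic form\<close>

locale parallel_calabi =
  fixes f :: "real^'n::finite \<Rightarrow> real" and \<Omega> :: "(real^'n) set"
  assumes op: "open \<Omega>" and smooth: "smooth_on \<Omega> f" and convex: "strictly_convex_on \<Omega> f"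
    and parallel: "parallel3_on \<Omega> (calabi_metric f) (cubic_form f)"
begin

lemma hessian_pd: "x \<in> \<Omega> \<Longrightarrow> positive_definite (hessian f x)"
  using convex by (simp add: strictly_convex_on_def)

lemma third_partial_sym:
  assumes "x \<in> \<Omega>"
  shows "partial i (partial j (partial k f)) x = partial j (partial i (partial k f)) x"
    "partial i (partial j (partial k f)) x = partial i (partial k (partial j f)) x"
proof -
  show "partial i (partial j (partial k f)) x = partial j (partial i (partial k f)) x"
    by (rule smooth_partial_commute[OF smooth_on_partial[OF smooth] op assms])
  show "partial i (partial j (partial k f)) x = partial i (partial k (partial j f)) x"
  proof (rule partial_cong_open[OF op assms])
    show "partial j (partial k f) y = partial k (partial j f) y" if "y \<in> \<Omega>" for y
      by (rule smooth_partial_commute[OF smooth op that])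
    show "partial k (partial j f) differentiable (at x)"
      by (intro smooth_on_differentiable[OF _ assms] smooth_on_partial smooth)
  qed
qed

lemma third_sym:
  assumes "x \<in> \<Omega>"
  shows "third f x u v z = third f x v u z" "third f x u v z = third f x u z v"
proof -
  show "third f x u v z = third f x v u z"
    unfolding third_def
    by (subst sum.swap) (simp add: third_partial_sym(1)[OF assms, symmetric] mult_ac)
  have *: "u $ i * v $ j * z $ k * partial i (partial j (partial k f)) x
      = u $ i * z $ k * v $ j * partial i (partial k (partial j f)) x" for i j k
    by (subst third_partial_sym(2)[OF assms]) (simp add: mult_ac)
  show "third f x u v z = third f x u z v"
    unfolding third_def * by (intro sum.cong refl sum.swap)
qed

lemma bilinear_metric: "bilinear (hessian_form f x)"
  unfolding hessian_form_def bilinear_def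
  by (auto intro!: linearI simp: inner_simps matrix_vector_right_distrib matrix_vector_mult_scaleR)

lemma metric_sym:
  assumes "x \<in> \<Omega>" shows "hessian_form f x u v = hessian_form f x v u"
proof -
  have "transpose (hessian f x) = hessian f x"
    using hessian_pd[OF assms] by (simp add: positive_definite_def)
  then show ?thesis unfolding hessian_form_def by (metis dot_lmul_matrix inner_commute transpose_matrix_vector)
qed

lemma metric_pos: "x \<in> \<Omega> \<Longrightarrow> v \<noteq> 0 \<Longrightarrow> hessian_form f x v v > 0"
  using hessian_pd by (simp add: positive_definite_def hessian_form_def)

lemma metric_eqI:
  assumes "x \<in> \<Omega>" "\<And>z. hessian_form f x u z = hessian_form f x v z"
  shows "u = v"
proof (rule ccontr)
  assume "u \<noteq> v"
  then have "hessian_form f x (u - v) (u - v) > 0" using metric_pos[OF assms(1)] by simp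
  then show False using assms(2) by (simp add: bilinear_lsub[OF bilinear_metric])
qed

lemma hessian_inverse:
  assumes "x \<in> \<Omega>"
  shows "hessian f x ** matrix_inv (hessian f x) = mat 1" "matrix_inv (hessian f x) ** hessian f x = mat 1"
  using positive_definite_invertible(1)[OF hessian_pd[OF assms]]
  unfolding matrix_inv_def invertible_def by (metis (mono_tags, lifting) someI_ex)+

lemma metric_product:
  assumes "x \<in> \<Omega>"
  shows "hessian_form f x (calabi_product f x u v) z = third f x u v z"
proof -
  have "hessian f x *v calabi_product f x u v = (\<chi> k. third f x u v (axis k 1))"
    unfolding calabi_product_def matrix_vector_mul_assoc hessian_inverse[OF assms] by simp
  then have "hessian_form f x z (calabi_product f x u v) = (\<Sum>k\<in>UNIV. z $ k * third f x u v (axis k 1))"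
    by (simp add: hessian_form_def inner_vec_def)
  then show ?thesis
    using linear_axis_expand[OF linear_third(3), of f x u v z] metric_sym[OF assms] by simp
qed

lemma bilinear_product: "bilinear (calabi_product f x)"
proof -
  have lin: "linear (\<lambda>w. matrix_inv (hessian f x) *v (\<chi> k. g w k))" if "\<And>k. linear (\<lambda>w. g w k)"
    for g :: "real^'n \<Rightarrow> 'n \<Rightarrow> real"
  proof -
    have "linear (\<lambda>w. (\<chi> k. g w k))"
      using that by (auto intro!: linearI simp: vec_eq_iff linear_add[OF that] linear_cmul[OF that])
    from linear_compose[OF this matrix_vector_mul_linear] show ?thesis by (simp add: o_def)
  qed
  show ?thesis
    unfolding bilinear_def calabi_product_def by (intro conjI allI lin linear_third)
qed

lemma product_sym: "x \<in> \<Omega> \<Longrightarrow> calabi_product f x u v = calabi_product f x v u"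
  by (simp add: calabi_product_def third_sym(1))

text \<open>The first derivatives of a Hessian metric are totally symmetric, so two of the three
  terms in the Christoffel symbol cancel.\<close>

lemma christoffel_product:
  assumes "x \<in> \<Omega>"
  shows "christoffel (calabi_metric f) k i j x = (1/2) * calabi_product f x (axis i 1) (axis j 1) $ k"
proof -
  have "partial i (partial j (partial l f)) x + partial j (partial i (partial l f)) x - partial l (partial i (partial j f)) x
      = partial i (partial j (partial l f)) x" for l
    using third_partial_sym[OF assms] by (metis add_diff_cancel_right')
  then show ?thesis
    by (simp add: christoffel_def calabi_metric_def hessian_def calabi_product_def matrix_vector_mult_def third_axis)
qed

text \<open>\<open>parallel\<close> solved for the ordinary derivative. The factor 1/2 comes from
  the Christoffel symbols; the -1/2 in \<open>cubic_form\<close> cancels.\<close>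

lemma fourth_partial:
  assumes "x \<in> \<Omega>"
  defines "P \<equiv> \<lambda>i j. calabi_product f x (axis i 1) (axis j 1)"
  shows "partial l (partial i (partial j (partial k f))) x =
    (1/2) * (third f x (P l i) (axis j 1) (axis k 1) + third f x (axis i 1) (P l j) (axis k 1)
      + third f x (axis i 1) (axis j 1) (P l k))"
proof -
  have d: "partial i (partial j (partial k f)) differentiable (at x)" for i j k
    by (intro smooth_on_differentiable[OF _ assms(1)] smooth_on_partial smooth)
  have pc: "partial l (cubic_form f i j k) x = - (1/2) * partial l (partial i (partial j (partial k f))) x"
    by (subst partial_eqI[where D = "\<lambda>w. - (1/2) * (\<Sum>l\<in>UNIV. w $ l * partial l (partial i (partial j (partial k f))) x)"])
      (unfold cubic_form_def, intro has_derivative_mult_right differentiable_has_partials d, simp add: sum_axis_mult)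
  have e1: "(\<Sum>m\<in>UNIV. v $ m * third f x (axis m 1) a b) = third f x v a b"
    and e2: "(\<Sum>m\<in>UNIV. v $ m * third f x a (axis m 1) b) = third f x a v b"
    and e3: "(\<Sum>m\<in>UNIV. v $ m * third f x a b (axis m 1)) = third f x a b v" for v a b
    using linear_axis_expand[OF linear_third(1), of f x v a b] linear_axis_expand[OF linear_third(2), of f x a v b]
      linear_axis_expand[OF linear_third(3), of f x a b v] by simp_all
  have "covariant_derivative3 (calabi_metric f) (cubic_form f) l i j k x = 0"
    using parallel assms(1) by (simp add: parallel3_on_def)
  then have "partial l (partial i (partial j (partial k f))) x =
      (1/2) * ((\<Sum>m\<in>UNIV. P l i $ m * third f x (axis m 1) (axis j 1) (axis k 1))
        + (\<Sum>m\<in>UNIV. P l j $ m * third f x (axis i 1) (axis m 1) (axis k 1))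
        + (\<Sum>m\<in>UNIV. P l k $ m * third f x (axis i 1) (axis j 1) (axis m 1)))"
    unfolding covariant_derivative3_def pc
    by (simp add: christoffel_product[OF assms(1)] cubic_form_def third_axis P_def algebra_simps sum_negf
      flip: sum_divide_distrib)
  then show ?thesis unfolding e1 e2 e3 .
qed

lemma metric_has_derivative:
  assumes "x \<in> \<Omega>"
  shows "((\<lambda>y. hessian_form f y u v) has_derivative (\<lambda>w. hessian_form f x (calabi_product f x u v) w)) (at x)"
proof -
  have m: "hessian_form f y u v = (\<Sum>i\<in>UNIV. \<Sum>j\<in>UNIV. (u $ i * v $ j) * partial i (partial j f) y)" for y
    by (simp add: hessian_form_def hessian_def inner_vec_def matrix_vector_mult_def sum_distrib_left mult_ac)
  have "((\<lambda>y. hessian_form f y u v) has_derivative (\<lambda>w. \<Sum>i\<in>UNIV. \<Sum>j\<in>UNIV. (u $ i * v $ j) *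
      (\<Sum>l\<in>UNIV. w $ l * partial l (partial i (partial j f)) x))) (at x)"
    unfolding m
    by (intro has_derivative_sum has_derivative_mult_right differentiable_has_partials
        smooth_on_differentiable[OF _ assms] smooth_on_partial smooth)
  moreover have "(\<Sum>i\<in>UNIV. \<Sum>j\<in>UNIV. (u $ i * v $ j) * (\<Sum>l\<in>UNIV. w $ l * partial l (partial i (partial j f)) x))
      = third f x w u v" for w
    unfolding third_def sum_distrib_left
    by (subst sum.swap[where B = "UNIV"], subst (2) sum.swap) (simp add: mult_ac)
  ultimately show ?thesis
    using metric_product[OF assms] third_sym[OF assms] by simp
qed

lemma third_has_derivative:
  fixes x u v z :: "real^'n"
  assumes "x \<in> \<Omega>"
  defines "P \<equiv> calabi_product f x"
  shows "((\<lambda>y. third f y u v z) has_derivative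
    (\<lambda>w. (1/2) * (third f x (P w u) v z + third f x u (P w v) z + third f x u v (P w z)))) (at x)"
proof -
  define R where "R w u v z = (1/2) * (third f x (P w u) v z + third f x u (P w v) z + third f x u v (P w z))"
    for w u v z
  have bil: "bilinear P" by (simp add: P_def bilinear_product)
  note l3 = linear_add[OF linear_third(1)] linear_add[OF linear_third(2)] linear_add[OF linear_third(3)]
    linear_cmul[OF linear_third(1)] linear_cmul[OF linear_third(2)] linear_cmul[OF linear_third(3)]
    bilinear_ladd[OF bil] bilinear_radd[OF bil] bilinear_lmul[OF bil] bilinear_rmul[OF bil]
  have R: "linear (\<lambda>w. R w u v z)" "linear (\<lambda>u. R w u v z)" "linear (\<lambda>v. R w u v z)" "linear (\<lambda>z. R w u v z)"
    for w u v z
    by (auto intro!: linearI simp: R_def l3 field_simps)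
  have "((\<lambda>y. third f y u v z) has_derivative (\<lambda>w. \<Sum>i\<in>UNIV. \<Sum>j\<in>UNIV. \<Sum>k\<in>UNIV. (u $ i * v $ j * z $ k) *
      (\<Sum>l\<in>UNIV. w $ l * partial l (partial i (partial j (partial k f))) x))) (at x)"
    unfolding third_def
    by (intro has_derivative_sum has_derivative_mult_right differentiable_has_partials
        smooth_on_differentiable[OF _ assms(1)] smooth_on_partial smooth)
  moreover have "(\<Sum>i\<in>UNIV. \<Sum>j\<in>UNIV. \<Sum>k\<in>UNIV. (u $ i * v $ j * z $ k) *
      (\<Sum>l\<in>UNIV. w $ l * partial l (partial i (partial j (partial k f))) x)) = R w u v z" for w
  proof -
    have 1: "(\<Sum>l\<in>UNIV. w $ l * partial l (partial i (partial j (partial k f))) x)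
        = R w (axis i 1) (axis j 1) (axis k 1)" for i j k
      using linear_axis_expand[OF R(1), of w "axis i 1" "axis j 1" "axis k 1"]
      by (simp add: fourth_partial[OF assms(1)] R_def P_def)
    have 2: "(\<Sum>k\<in>UNIV. z $ k * R w a b (axis k 1)) = R w a b z" for a b
      using linear_axis_expand[OF R(4), of w a b z] by simp
    have 3: "(\<Sum>j\<in>UNIV. v $ j * R w a (axis j 1) z) = R w a v z" for a
      using linear_axis_expand[OF R(3), of w a v z] by simp
    have 4: "(\<Sum>i\<in>UNIV. u $ i * R w (axis i 1) v z) = R w u v z"
      using linear_axis_expand[OF R(2), of w u v z] by simp
    show ?thesis
      unfolding 1 by (simp add: mult.assoc sum_distrib_left[symmetric] 2 3 4)
  qed
  ultimately show ?thesis by (simp add: R_def)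
qed

text \<open>The product contains the inverse Hessian. Cramer's rule writes its components as
  quotients of determinants, which are polynomial in differentiable entries.\<close>

lemma product_differentiable:
  assumes "x \<in> \<Omega>"
  shows "(\<lambda>y. calabi_product f y u v) differentiable (at x)"
proof -
  have hess: "(\<lambda>y. hessian f y $ i $ j) differentiable (at x)" for i j
    unfolding hessian_def vec_lambda_beta
    by (intro smooth_on_differentiable[OF _ assms] smooth_on_partial smooth)
  have third: "(\<lambda>y. third f y u v z) differentiable (at x)" for z
    using third_has_derivative[OF assms] differentiable_def by blast
  \<comment> \<open>\<open>N k y\<close> is the Cramer numerator: the Hessian with column
    \<open>k\<close> replaced by the right side of the system for
    \<open>calabi_product f y u v\<close>.\<close>
  define N where "N k y = (\<chi> i j. if j = k then (\<chi> l. third f y u v (axis l 1)) $ i else hessian f y $ i $ j)" for k y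
  have "(\<lambda>y. N k y $ i $ j) differentiable (at x)" for i j k
    using hess third by (cases "j = k") (simp_all add: N_def)
  then have N: "(\<lambda>y. det (N k y)) differentiable (at x)" for k by (rule det_differentiable)
  have "det (hessian f x) \<noteq> 0" using positive_definite_invertible hessian_pd assms by blast
  then have "(\<lambda>y. det (N k y) / det (hessian f y)) differentiable (at x)" for k
    by (intro differentiable_divide N det_differentiable hess)
  then have "\<exists>D. \<forall>k. ((\<lambda>y. det (N k y) / det (hessian f y)) has_derivative D k) (at x)"
    unfolding differentiable_def by metis
  then obtain D where D: "\<And>k. ((\<lambda>y. det (N k y) / det (hessian f y)) has_derivative D k) (at x)" by blast
  have "((\<lambda>y. \<Sum>k\<in>UNIV. (det (N k y) / det (hessian f y)) *\<^sub>R axis k 1) has_derivative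
      (\<lambda>w. \<Sum>k\<in>UNIV. D k w *\<^sub>R axis k 1)) (at x)"
    by (intro has_derivative_sum has_derivative_scaleR_left D)
  moreover have "(\<Sum>k\<in>UNIV. (det (N k y) / det (hessian f y)) *\<^sub>R axis k 1) = calabi_product f y u v"
    if "y \<in> \<Omega>" for y
  proof -
    have "det (hessian f y) \<noteq> 0" using positive_definite_invertible hessian_pd that by blast
    moreover have "hessian f y *v calabi_product f y u v = (\<chi> k. third f y u v (axis k 1))"
      unfolding calabi_product_def matrix_vector_mul_assoc hessian_inverse[OF that] by simp
    ultimately have "calabi_product f y u v = (\<chi> k. det (N k y) / det (hessian f y))"
      unfolding N_def by (subst (asm) cramer) simp_all
    then show ?thesis
      using basis_expansion[of "calabi_product f y u v"] by (simp flip: scalar_mult_eq_scaleR)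
  qed
  ultimately have "((\<lambda>y. calabi_product f y u v) has_derivative (\<lambda>w. \<Sum>k\<in>UNIV. D k w *\<^sub>R axis k 1)) (at x)"
    by (rule has_derivative_transform_within_open[OF _ op assms])
  then show ?thesis unfolding differentiable_def by blast
qed

text \<open>Differentiate \<open>G(z, u v) = D^3 f(u, v, z)\<close> in both forms. On the left the
  derivative of \<open>G\<close> contributes \<open>w (u v)\<close> with coefficient 1, on the right
  the same term occurs with 1/2; the difference is the minus sign in
  \<open>product_ode\<close>.\<close>

lemma product_ode_calabi: "product_ode \<Omega> (calabi_product f)"
  unfolding product_ode_def
proof (intro ballI conjI allI)
  fix x assume x: "x \<in> \<Omega>"
  show "bilinear (calabi_product f x)" by (rule bilinear_product)
  fix u v show "calabi_product f x u v = calabi_product f x v u" by (rule product_sym[OF x])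
  let ?P = "calabi_product f x"
  obtain D where D: "((\<lambda>y. calabi_product f y u v) has_derivative D) (at x)"
    using product_differentiable[OF x] by (auto simp: differentiable_def)
  note m = metric_product[OF x] and s = third_sym[OF x]
  have "D w = (1/2) *\<^sub>R (?P u (?P v w) + ?P v (?P u w) - ?P w (?P u v))" for w
  proof (rule metric_eqI[OF x])
    fix z
    have d1: "((\<lambda>y. hessian_form f y z (calabi_product f y u v)) has_derivative
        (\<lambda>w. hessian_form f x (?P z (?P u v)) w + hessian_form f x z (D w))) (at x)"
      by (rule has_derivative_bilinear_family[OF op x _ _ D])
        (auto intro: bilinear_metric metric_has_derivative[OF x])
    have d2: "((\<lambda>y. hessian_form f y z (calabi_product f y u v)) has_derivative
        (\<lambda>w. (1/2) * (third f x (?P w u) v z + third f x u (?P w v) z + third f x u v (?P w z)))) (at x)"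
      by (rule has_derivative_transform_within_open[OF third_has_derivative[OF x] op x])
        (metis metric_product metric_sym)
    have "hessian_form f x (?P z (?P u v)) w + hessian_form f x z (D w) =
        (1/2) * (third f x (?P w u) v z + third f x u (?P w v) z + third f x u v (?P w z))"
      using fun_cong[OF has_derivative_unique[OF d1 d2], of w] .
    moreover have "third f x (?P w u) v z = hessian_form f x (?P v (?P u w)) z"
      by (simp add: m product_sym[OF x, of w u] s(1)[of v])
    moreover have "third f x u (?P w v) z = hessian_form f x (?P u (?P v w)) z"
      by (simp add: m product_sym[OF x, of w v])
    moreover have "third f x u v (?P w z) = hessian_form f x (?P w (?P u v)) z"
    proof -
      have "third f x u v (?P w z) = hessian_form f x (?P u v) (?P w z)" by (simp add: m)
      also have "\<dots> = third f x w z (?P u v)" by (metis m metric_sym[OF x])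
      also have "\<dots> = third f x w (?P u v) z" by (rule s(2))
      finally show ?thesis by (simp add: m)
    qed
    moreover have "hessian_form f x (?P z (?P u v)) w = hessian_form f x (?P w (?P u v)) z"
      by (metis m s)
    ultimately show "hessian_form f x (D w) z = hessian_form f x ((1/2) *\<^sub>R (?P u (?P v w) + ?P v (?P u w) - ?P w (?P u v))) z"
      by (simp add: bilinear_lmul[OF bilinear_metric] bilinear_ladd[OF bilinear_metric]
          bilinear_lsub[OF bilinear_metric] metric_sym[OF x, of z] field_simps)
  qed
  then have "D = (\<lambda>w. (1/2) *\<^sub>R (?P u (?P v w) + ?P v (?P u w) - ?P w (?P u v)))" by blast
  with D show "((\<lambda>y. calabi_product f y u v) has_derivative
      (\<lambda>w. (1/2) *\<^sub>R (?P u (?P v w) + ?P v (?P u w) - ?P w (?P u v)))) (at x)" by simp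
qed

text \<open>The equation of the product replaces the derivatives of the Christoffel symbols, so
  curvature becomes algebraic: the trace of a composition of two multiplications minus the trace of
  multiplication by the product.\<close>

lemma ricci_product:
  assumes x: "x \<in> \<Omega>"
  defines "P \<equiv> calabi_product f x"
  shows "ricci (calabi_metric f) j k x =
    (1/4) * (\<Sum>i\<in>UNIV. P (axis j 1) (P (axis k 1) (axis i 1)) $ i - P (axis i 1) (P (axis j 1) (axis k 1)) $ i)"
proof -
  define e :: "'n \<Rightarrow> real^'n" where "e i = axis i 1" for i
  have sym: "P u v = P v u" for u v by (simp add: P_def product_sym[OF x])
  have Gam: "christoffel (calabi_metric f) k i j x = (1/2) * P (e i) (e j) $ k" for k i j
    by (simp add: christoffel_product[OF x] P_def e_def)
  have dG: "partial l (christoffel (calabi_metric f) k i j) x =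
      (1/4) * (P (e i) (P (e j) (e l)) + P (e j) (P (e i) (e l)) - P (e l) (P (e i) (e j))) $ k" for l k i j
  proof -
    have "((\<lambda>y. calabi_product f y (e i) (e j)) has_derivative
        (\<lambda>w. (1/2) *\<^sub>R (P (e i) (P (e j) w) + P (e j) (P (e i) w) - P w (P (e i) (e j))))) (at x)"
      using product_ode_calabi x unfolding product_ode_def P_def by blast
    then have "((\<lambda>y. (1/2) * (calabi_product f y (e i) (e j) \<bullet> axis k 1)) has_derivative
        (\<lambda>w. (1/2) * (((1/2) *\<^sub>R (P (e i) (P (e j) w) + P (e j) (P (e i) w) - P w (P (e i) (e j)))) \<bullet> axis k 1))) (at x)"
      by (intro has_derivative_mult_right has_derivative_inner_left)
    then have "(christoffel (calabi_metric f) k i j has_derivative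
        (\<lambda>w. (1/2) * (((1/2) *\<^sub>R (P (e i) (P (e j) w) + P (e j) (P (e i) w) - P w (P (e i) (e j)))) \<bullet> axis k 1))) (at x)"
      by (rule has_derivative_transform_within_open[OF _ op x]) (simp add: christoffel_product e_def inner_axis)
    from partial_eqI[OF this, of l] show ?thesis by (simp add: inner_axis e_def)
  qed
  have comp: "(\<Sum>m\<in>UNIV. P u (e m) $ i * v $ m) = P u v $ i" for i u v
  proof -
    have "linear (P u)" using bilinear_product by (simp add: P_def bilinear_def)
    from linear_axis_expand[OF this, of v] have "P u v $ i = (\<Sum>m\<in>UNIV. v $ m *\<^sub>R P u (e m)) $ i"
      by (simp add: e_def)
    then show ?thesis by (simp add: mult.commute)
  qed
  have "ricci (calabi_metric f) j k x =
      (\<Sum>i\<in>UNIV. (1/4) * (P (e j) (P (e k) (e i)) + P (e k) (P (e j) (e i)) - P (e i) (P (e j) (e k))) $ i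
        - (1/4) * (P (e i) (P (e k) (e j)) + P (e k) (P (e i) (e j)) - P (e j) (P (e i) (e k))) $ i
        + ((1/4) * (\<Sum>m\<in>UNIV. P (e i) (e m) $ i * P (e j) (e k) $ m)
          - (1/4) * (\<Sum>m\<in>UNIV. P (e j) (e m) $ i * P (e i) (e k) $ m)))"
    unfolding ricci_def dG Gam by (simp add: sum_subtractf sum_distrib_left mult_ac)
  also have "\<dots> = (\<Sum>i\<in>UNIV. (1/4) * (P (e j) (P (e k) (e i)) $ i - P (e i) (P (e j) (e k)) $ i))"
    unfolding comp
  proof (rule sum.cong[OF refl], goal_cases)
    case (1 i)
    show ?case
      unfolding sym[of "e i" "e j"] sym[of "e i" "e k"] sym[of "e k" "e j"] by (simp add: algebra_simps)
  qed
  finally show ?thesis by (simp add: e_def sum_distrib_left)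
qed

end

section \<open>Normal forms relative to an inner product\<close>

text \<open>\<open>h a v = 0\<close> says that \<open>v\<close> is orthogonal, for the dot product,
  to the vector representing \<open>h a\<close>. The Euclidean existence lemma applies, and
  rescaling gives \<open>h\<close>-length 1.\<close>

lemma form_orthonormal3_exists:
  fixes h :: "real^3 \<Rightarrow> real^3 \<Rightarrow> real"
  assumes bil: "bilinear h" and pos: "\<And>v. v \<noteq> 0 \<Longrightarrow> h v v > 0"
  shows "\<exists>a b c. orthonormal3 h a b c"
proof -
  have unit: "\<exists>v. h v v = 1 \<and> h a v = 0 \<and> h b v = 0" for a b
  proof -
    have lin: "linear (h u)" for u using bil by (simp add: bilinear_def)
    have h_eq: "h u v = (\<chi> i. h u (axis i 1)) \<bullet> v" for u v
      using linear_axis_expand[OF lin, of u v] by (simp add: inner_vec_def mult.commute)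
    obtain v where v: "v \<bullet> v = 1" "h a v = 0" "h b v = 0"
      using unit_orthogonal_exists[of "\<chi> i. h a (axis i 1)" "\<chi> i. h b (axis i 1)"] h_eq by metis
    then have "h v v > 0" by (intro pos) auto
    then show ?thesis using v(2,3)
      by (intro exI[of _ "(1 / sqrt (h v v)) *\<^sub>R v"])
        (simp add: bilinear_lmul[OF bil] bilinear_rmul[OF bil])
  qed
  obtain a where "h a a = 1" using unit by blast
  moreover obtain b where "h b b = 1" "h a b = 0" using unit by blast
  moreover obtain c where "h c c = 1" "h a c = 0" "h b c = 0" using unit by blast
  ultimately show ?thesis unfolding orthonormal3_def by blast
qed

text \<open>Coordinates \<open>B\<close> in an \<open>h\<close>-orthonormal basis carry the dot
  product to \<open>h\<close>; \<open>p\<close> is the product \<open>m\<close> read in these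
  coordinates.\<close>

lemma form_split_or_spin:
  fixes h :: "real^3 \<Rightarrow> real^3 \<Rightarrow> real" and m :: "real^3 \<Rightarrow> real^3 \<Rightarrow> real^3"
  assumes h: "bilinear h" "\<And>u v. h u v = h v u" "\<And>v. v \<noteq> 0 \<Longrightarrow> h v v > 0"
    and m: "bilinear m" "\<And>u v. m u v = m v u" "\<And>u v w. h (m u v) w = h (m u w) v"
    and der: "\<And>u v w z. m z (m w (m u v)) - m w (m z (m u v)) =
      m u (m z (m w v) - m w (m z v)) + m v (m z (m w u) - m w (m z u))"
  shows "(\<exists>a b c l1 l2 l3. split_basis h m a b c l1 l2 l3) \<or> (\<exists>a b c n. spin_basis h m a b c n)"
proof -
  obtain w1 w2 w3 where w: "orthonormal3 h w1 w2 w3" using form_orthonormal3_exists h by blast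
  define B where "B y = (y $ 1) *\<^sub>R w1 + (y $ 2) *\<^sub>R w2 + (y $ 3) *\<^sub>R w3" for y :: "real^3"
  have lB: "linear B" by (auto intro!: linearI simp: B_def algebra_simps)
  have hB: "h (B y) (B z) = y \<bullet> z" for y z
    using w h(2) unfolding orthonormal3_def
    by (simp add: B_def bilinear_ladd[OF h(1)] bilinear_radd[OF h(1)] bilinear_lmul[OF h(1)]
        bilinear_rmul[OF h(1)] inner_vec_def sum_3 h(2)[of w2 w1] h(2)[of w3 w1] h(2)[of w3 w2])
  have "inj B"
  proof (rule injI)
    fix y z assume "B y = B z"
    then have "h (B (y - z)) (B (y - z)) = 0" by (simp add: linear_diff[OF lB] bilinear_lzero[OF h(1)])
    then show "y = z" by (simp add: hB)
  qed
  then have "surj B" using lB linear_injective_imp_surjective by blast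
  define C where "C = inv B"
  have BC: "B (C v) = v" for v using \<open>surj B\<close> by (simp add: C_def surj_f_inv_f)
  have CB: "C (B y) = y" for y using \<open>inj B\<close> by (simp add: C_def)
  have C_add: "C (u + v) = C u + C v" for u v
    by (metis BC CB linear_add[OF lB])
  have C_scale: "C (r *\<^sub>R v) = r *\<^sub>R C v" for r v
    by (metis BC CB linear_cmul[OF lB])
  have lC: "linear C" by (rule linearI) (auto simp: C_add C_scale)
  define p where "p y z = C (m (B y) (B z))" for y z
  have Bp: "B (p y z) = m (B y) (B z)" for y z by (simp add: p_def BC)
  have dist: "B (u + v) = B u + B v" "B (u - v) = B u - B v" "B (r *\<^sub>R v) = r *\<^sub>R B v" for u v r
    by (auto simp: linear_add[OF lB] linear_diff[OF lB] linear_cmul[OF lB])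
  interpret derivation_product p
  proof
    show "bilinear p"
      unfolding bilinear_def p_def
      by (auto intro!: linearI simp: dist C_add C_scale bilinear_ladd[OF m(1)] bilinear_radd[OF m(1)]
          bilinear_lmul[OF m(1)] bilinear_rmul[OF m(1)])
    fix u v w z
    show "p u v = p v u" by (simp add: p_def m(2))
    show "p u v \<bullet> w = p u w \<bullet> v" by (simp add: hB[symmetric] Bp m(3))
    have "B (p z (p w (p u v)) - p w (p z (p u v))) =
      B (p u (p z (p w v) - p w (p z v)) + p v (p z (p w u) - p w (p z u)))"
      unfolding dist Bp by (rule der)
    then show "p z (p w (p u v)) - p w (p z (p u v)) =
      p u (p z (p w v) - p w (p z v)) + p v (p z (p w u) - p w (p z u))"
      using \<open>inj B\<close> by (simp add: inj_eq)
  qed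
  have mB: "m (B y) (B z) = B (p y z)" for y z by (simp add: Bp)
  have B0: "B 0 = 0" using lB by (rule linear_0)
  from split_or_spin show ?thesis
  proof (elim disjE exE)
    fix a b c l1 l2 l3 assume "split_basis (\<bullet>) p a b c l1 l2 l3"
    then have "split_basis h m (B a) (B b) (B c) l1 l2 l3"
      unfolding split_basis_def orthonormal3_def by (simp add: hB mB dist B0)
    then show ?thesis by blast
  next
    fix a b c n assume "spin_basis (\<bullet>) p a b c n"
    then have "spin_basis h m (B a) (B b) (B c) n"
      unfolding spin_basis_def orthonormal3_def by (simp add: hB mB dist B0)
    then show ?thesis by blast
  qed
qed

lemma form_orthonormal3_expand:
  fixes h :: "real^3 \<Rightarrow> real^3 \<Rightarrow> real"
  assumes h: "bilinear h" "\<And>u v. h u v = h v u" and o: "orthonormal3 h a b c"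
  shows "v = (h v a) *\<^sub>R a + (h v b) *\<^sub>R b + (h v c) *\<^sub>R c"
proof -
  define B where "B y = (y $ 1) *\<^sub>R a + (y $ 2) *\<^sub>R b + (y $ 3) *\<^sub>R c" for y :: "real^3"
  have lB: "linear B" by (auto intro!: linearI simp: B_def algebra_simps)
  have hB: "h (B y) a = y $ 1" "h (B y) b = y $ 2" "h (B y) c = y $ 3" for y
    using o h(2) unfolding orthonormal3_def
    by (simp_all add: B_def bilinear_ladd[OF h(1)] bilinear_lmul[OF h(1)] bilinear_radd[OF h(1)]
        bilinear_rmul[OF h(1)] h(2)[of b a] h(2)[of c a] h(2)[of c b])
  have "inj B"
  proof (rule injI)
    fix y z assume "B y = B z"
    then have "h (B y) a = h (B z) a" "h (B y) b = h (B z) b" "h (B y) c = h (B z) c"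
      by (simp_all only:)
    then show "y = z" by (simp add: hB vec_eq_iff forall_3)
  qed
  then have "surj B" using lB linear_injective_imp_surjective by blast
  then obtain y where "v = B y" by blast
  then show ?thesis by (simp only: hB) (simp add: B_def)
qed

section \<open>Uniqueness of the metric and of the potential\<close>

definition metric_ode ::
    "'a::euclidean_space set \<Rightarrow> ('a \<Rightarrow> 'a \<Rightarrow> 'a \<Rightarrow> 'a) \<Rightarrow> ('a \<Rightarrow> 'a \<Rightarrow> 'a \<Rightarrow> real) \<Rightarrow> bool" where
  "metric_ode S P h \<longleftrightarrow> (\<forall>x\<in>S. bilinear (h x) \<and>
     (\<forall>u v. ((\<lambda>y. h y u v) has_derivative (\<lambda>w. h x (P x u v) w)) (at x)))"

text \<open>For a given \<open>P\<close> the equation is linear in \<open>h\<close>, so a local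
  bound for \<open>P\<close> alone controls the difference of two solutions.\<close>

lemma metric_ode_unique:
  fixes P :: "'a::euclidean_space \<Rightarrow> 'a \<Rightarrow> 'a \<Rightarrow> 'a"
  assumes S: "open S" "connected S" and P: "product_ode S P"
    and h: "metric_ode S P h" and k: "metric_ode S P k"
    and x0: "x0 \<in> S" "h x0 = k x0" and x: "x \<in> S"
  shows "h x = k x"
proof (rule connected_clopen_induct[where Q = "\<lambda>x. h x = k x", OF S(2) x0 _ _ x])
  fix x assume x: "x \<in> S" and eq: "h x = k x"
  obtain r where r: "r > 0" "cball x r \<subseteq> S" using S x open_contains_cball by blast
  have dP: "\<And>y u v. y \<in> S \<Longrightarrow> ((\<lambda>y. P y u v) has_derivative
        (\<lambda>w. (1/2) *\<^sub>R (P y u (P y v w) + P y v (P y u w) - P y w (P y u v)))) (at y)"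
    and bP: "\<And>y. y \<in> S \<Longrightarrow> bilinear (P y)"
    using P by (auto simp: product_ode_def)
  have bh: "bilinear (h y)" "bilinear (k y)" if "y \<in> S" for y
    using h k that by (auto simp: metric_ode_def)
  obtain B where B: "B > 0" "\<And>y. y \<in> cball x r \<Longrightarrow> bilinear_norm (P y) \<le> B"
    using locally_bounded_bilinear_norm[of S P, OF has_derivative_continuous[OF dP] r(2)] by blast
  define d where "d = (\<lambda>(u, v) y. h y u v - k y u v)"
  define d' where "d' = (\<lambda>(u, v) y w. h y (P y u v) w - k y (P y u v) w)"
  have "\<exists>r'>0. \<forall>y\<in>ball x r'. \<forall>i\<in>Basis \<times> Basis. d i y = 0"
  proof (rule local_vanishing[where d' = d' and K = B])
    show "(d i has_derivative d' i y) (at y)" if "y \<in> ball x r" for i y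
    proof (cases i)
      case (Pair u v)
      have "y \<in> S" using r that by auto
      then have "((\<lambda>y. h y u v) has_derivative (\<lambda>w. h y (P y u v) w)) (at y)"
        "((\<lambda>y. k y u v) has_derivative (\<lambda>w. k y (P y u v) w)) (at y)"
        using h k unfolding metric_ode_def by blast+
      then show ?thesis unfolding Pair d_def d'_def by (simp add: has_derivative_diff)
    qed
    fix i :: "'a \<times> 'a" and y w assume i: "i \<in> Basis \<times> Basis" and "y \<in> ball x r"
    then have y: "y \<in> cball x r" "y \<in> S" using r by auto
    obtain u v where uv: "i = (u, v)" "norm u = 1" "norm v = 1" using i by auto
    define N where "N = (\<Sum>j\<in>Basis \<times> Basis. norm (d j y))"
    have N0: "N \<ge> 0" by (auto simp: N_def intro: sum_nonneg)
    have "bilinear (\<lambda>u v. h y u v - k y u v)"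
      using bh[OF y(2)] by (auto simp: bilinear_def intro: linear_compose_sub)
    from norm_bilinear_le[OF this, of "P y u v" w]
    have "norm (d' i y w) \<le> N * norm (P y u v) * norm w"
      by (simp add: uv(1) d'_def N_def bilinear_norm_def d_def split_def)
    also have "norm (P y u v) \<le> B"
      using norm_bilinear_le[OF bP[OF y(2)], of u v] B(2)[OF y(1)] uv by simp
    finally show "norm (d' i y w) \<le> B * (\<Sum>j\<in>Basis \<times> Basis. norm (d j y)) * norm w"
      using N0 by (simp add: N_def mult_ac mult_left_mono mult_right_mono)
  qed (use r eq in \<open>auto simp: d_def\<close>)
  then obtain r' where r': "r' > 0" "\<And>y i. y \<in> ball x r' \<Longrightarrow> i \<in> Basis \<times> Basis \<Longrightarrow> d i y = 0"
    by blast
  have "h y = k y" if "y \<in> ball x r'" "y \<in> S" for y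
    using r'(2)[of y "(_, _)"] that by (intro bilinear_eqI bh) (auto simp: d_def)
  then show "\<exists>r>0. \<forall>y\<in>ball x r. y \<in> S \<longrightarrow> h y = k y" using r' by blast
next
  fix x assume x: "x \<in> S" "x \<in> closure {y \<in> S. h y = k y}"
  have "h x u v - k x u v = 0" for u v
  proof (rule zero_on_closure[OF _ x(2), where g = "\<lambda>x. h x u v - k x u v"])
    show "continuous (at x) (\<lambda>x. h x u v - k x u v)"
      using h k x unfolding metric_ode_def
      by (intro continuous_diff has_derivative_continuous) blast+
  qed auto
  then show "h x = k x" by (intro ext) simp
qed

lemma same_hessian_affine:
  fixes f g :: "'a::euclidean_space \<Rightarrow> real"
  assumes S: "open S" "connected S"
    and f: "\<And>x. x \<in> S \<Longrightarrow> (f has_derivative F x) (at x)"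
      "\<And>x u. x \<in> S \<Longrightarrow> ((\<lambda>y. F y u) has_derivative h x u) (at x)"
    and g: "\<And>x. x \<in> S \<Longrightarrow> (g has_derivative G x) (at x)"
      "\<And>x u. x \<in> S \<Longrightarrow> ((\<lambda>y. G y u) has_derivative h x u) (at x)"
  shows "\<exists>q b. \<forall>x\<in>S. f x = g x + q \<bullet> x + b"
proof (cases "S = {}")
  case False
  then obtain x0 where x0: "x0 \<in> S" by blast
  define q where "q = (\<Sum>i\<in>Basis. (F x0 i - G x0 i) *\<^sub>R i)"
  have FG: "F x u - G x u = q \<bullet> u" if x: "x \<in> S" for x u
  proof -
    have "(\<lambda>y. F y u - G y u) constant_on S"
    proof (rule has_derivative_zero_connected_constant_on[OF S(2,1) finite.emptyI])
      have "((\<lambda>y. F y u - G y u) has_derivative (\<lambda>w. 0)) (at x)" if "x \<in> S" for x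
        using has_derivative_diff[OF f(2)[OF that] g(2)[OF that], of u u] by simp
      then show "\<forall>x\<in>S - {}. ((\<lambda>y. F y u - G y u) has_derivative (\<lambda>w. 0)) (at x within S)"
        using has_derivative_at_withinI by blast
      then show "continuous_on S (\<lambda>y. F y u - G y u)"
        using has_derivative_continuous by (fastforce simp: continuous_on_eq_continuous_within)
    qed
    then have "F x u - G x u = F x0 u - G x0 u" using x x0 by (auto simp: constant_on_def)
    also have "\<dots> = q \<bullet> u"
    proof -
      have lin: "linear (\<lambda>u. F x0 u - G x0 u)"
        using f(1)[OF x0] g(1)[OF x0] by (intro linear_compose_sub has_derivative_linear)
      have "F x0 u - G x0 u = (\<Sum>i\<in>Basis. (u \<bullet> i) * (F x0 i - G x0 i))"
        using linear_sum[OF lin, of "\<lambda>i. (u \<bullet> i) *\<^sub>R i" Basis]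
        by (simp add: euclidean_representation linear_cmul[OF lin])
      then show ?thesis by (simp add: q_def inner_sum_left inner_commute[of u] mult.commute)
    qed
    finally show ?thesis .
  qed
  have "(\<lambda>x. f x - g x - q \<bullet> x) constant_on S"
  proof (rule has_derivative_zero_connected_constant_on[OF S(2,1) finite.emptyI])
    have "((\<lambda>x. f x - g x - q \<bullet> x) has_derivative (\<lambda>w. 0)) (at x)" if "x \<in> S" for x
    proof -
      have "((\<lambda>x. f x - g x - q \<bullet> x) has_derivative (\<lambda>w. F x w - G x w - q \<bullet> w)) (at x)"
        by (intro has_derivative_diff f(1) g(1) that has_derivative_inner_right has_derivative_ident)
      then show ?thesis by (simp add: FG[OF that])
    qed
    then show "\<forall>x\<in>S - {}. ((\<lambda>x. f x - g x - q \<bullet> x) has_derivative (\<lambda>w. 0)) (at x within S)"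
      using has_derivative_at_withinI by blast
    then show "continuous_on S (\<lambda>x. f x - g x - q \<bullet> x)"
      using has_derivative_continuous by (fastforce simp: continuous_on_eq_continuous_within)
  qed
  then obtain b where "\<forall>x\<in>S. f x - g x - q \<bullet> x = b" by (auto simp: constant_on_def)
  then show ?thesis by (intro exI[of _ q] exI[of _ b]) (auto simp: algebra_simps)
qed simp

context parallel_calabi
begin

lemma metric_ode_calabi: "metric_ode \<Omega> (calabi_product f) (hessian_form f)"
  unfolding metric_ode_def using bilinear_metric metric_has_derivative by blast

definition gradient :: "real^'n \<Rightarrow> real^'n \<Rightarrow> real" where
  "gradient x w = (\<Sum>l\<in>UNIV. w $ l * partial l f x)"

lemma gradient_has_derivative: "x \<in> \<Omega> \<Longrightarrow> (f has_derivative gradient x) (at x)"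
  unfolding gradient_def[abs_def]
  by (intro differentiable_has_partials smooth_on_differentiable[OF smooth])

lemma metric_gradient_has_derivative:
  assumes "x \<in> \<Omega>" shows "((\<lambda>y. gradient y u) has_derivative hessian_form f x u) (at x)"
proof -
  have "((\<lambda>y. gradient y u) has_derivative (\<lambda>w. \<Sum>l\<in>UNIV. u $ l * (\<Sum>i\<in>UNIV. w $ i * partial i (partial l f) x))) (at x)"
    unfolding gradient_def
    by (intro has_derivative_sum has_derivative_mult_right differentiable_has_partials
        smooth_on_differentiable[OF _ assms] smooth_on_partial smooth)
  moreover have "(\<Sum>l\<in>UNIV. u $ l * (\<Sum>i\<in>UNIV. w $ i * partial i (partial l f) x)) = hessian_form f x u w" for w
    unfolding metric_sym[OF assms, of u w]
    by (simp add: hessian_form_def hessian_def inner_vec_def matrix_vector_mult_def sum_distrib_left mult_ac)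
      (rule sum.swap)
  ultimately show ?thesis by simp
qed

end

section \<open>The split model\<close>

text \<open>\<open>s i\<close> has two roles: value of the coordinate at \<open>x0\<close> and
  square root of the logarithmic coefficient. With this choice the \<open>b i\<close> are
  orthonormal for \<open>form x0\<close>.\<close>

locale split_model =
  fixes b :: "'n::finite \<Rightarrow> 'a::euclidean_space" and l :: "'n \<Rightarrow> 'a \<Rightarrow> real"
    and s :: "'n \<Rightarrow> real" and x0 :: 'a
  assumes lin: "linear (l i)" and dual: "l i (b j) = (if i = j then 1 else 0)"
begin

text \<open>Coordinates with \<open>s i = 0\<close> carry the quadratic summand \<open>y\<^sup>2/2\<close>, the others \<open>-s\<^sup>2 ln y\<close>.\<close>

definition y :: "'n \<Rightarrow> 'a \<Rightarrow> real" where "y i x = s i + l i (x - x0)"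

definition dom :: "'a set" where "dom = {x. \<forall>i. s i \<noteq> 0 \<longrightarrow> y i x > 0}"

definition eigen :: "'n \<Rightarrow> 'a \<Rightarrow> real" where "eigen i x = (if s i = 0 then 0 else - 2 / y i x)"

definition weight :: "'n \<Rightarrow> 'a \<Rightarrow> real" where "weight i x = (if s i = 0 then 1 else (s i)\<^sup>2 / (y i x)\<^sup>2)"

definition prod :: "'a \<Rightarrow> 'a \<Rightarrow> 'a \<Rightarrow> 'a" where
  "prod x u v = (\<Sum>i\<in>UNIV. (eigen i x * (l i u * l i v)) *\<^sub>R b i)"

definition form :: "'a \<Rightarrow> 'a \<Rightarrow> 'a \<Rightarrow> real" where
  "form x u v = (\<Sum>i\<in>UNIV. weight i x * (l i u * l i v))"

definition slope :: "'a \<Rightarrow> 'a \<Rightarrow> real" where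
  "slope x u = (\<Sum>i\<in>UNIV. (if s i = 0 then y i x else - (s i)\<^sup>2 / y i x) * l i u)"

definition potential :: "'a \<Rightarrow> real" where
  "potential x = (\<Sum>i\<in>UNIV. if s i = 0 then (y i x)\<^sup>2 / 2 else - (s i)\<^sup>2 * ln (y i x))"

lemma y_has_derivative: "(y i has_derivative l i) (at x)"
proof -
  have "bounded_linear (l i)" using lin linear_conv_bounded_linear by blast
  then have "((\<lambda>x. s i + l i (x - x0)) has_derivative (\<lambda>w. 0 + l i (w - 0))) (at x)"
    by (intro has_derivative_add has_derivative_const bounded_linear.has_derivative[of "l i"]
        has_derivative_diff has_derivative_ident)
  then show ?thesis by (simp add: y_def[abs_def])
qed

lemma continuous_y: "continuous_on S (y i)"
  by (intro continuous_at_imp_continuous_on ballI has_derivative_continuous[OF y_has_derivative])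

lemma open_dom: "open dom"
proof -
  have "dom = (\<Inter>i\<in>UNIV. {x. s i \<noteq> 0 \<longrightarrow> 0 < y i x})" by (auto simp: dom_def)
  moreover have "open {x. s i \<noteq> 0 \<longrightarrow> 0 < y i x}" for i
    by (cases "s i = 0") (auto intro!: open_Collect_less continuous_y continuous_on_const)
  ultimately show ?thesis by auto
qed

lemma l_sum: "l i (\<Sum>j\<in>UNIV. c j *\<^sub>R b j) = c i"
  by (simp add: linear_sum[OF lin] linear_cmul[OF lin] dual if_distrib cong: if_cong)

text \<open>The product is diagonal in the basis \<open>b\<close>, so \<open>product_ode\<close>
  reduces to this scalar Riccati equation for each eigenvalue.\<close>

lemma eigen_has_derivative:
  assumes "x \<in> dom"
  shows "(eigen i has_derivative (\<lambda>w. (1/2) * (eigen i x)\<^sup>2 * l i w)) (at x)"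
proof (cases "s i = 0")
  case False
  then have y: "y i x > 0" using assms by (simp add: dom_def)
  have "((\<lambda>x. - 2 / y i x) has_derivative (\<lambda>w. (1/2) * (- 2 / y i x)\<^sup>2 * l i w)) (at x)"
    using y by (auto intro!: derivative_eq_intros y_has_derivative simp: fun_eq_iff field_simps power2_eq_square)
  then show ?thesis using False by (simp add: eigen_def[abs_def])
qed (simp add: eigen_def[abs_def])

lemma weight_has_derivative:
  assumes "x \<in> dom"
  shows "(weight i has_derivative (\<lambda>w. eigen i x * weight i x * l i w)) (at x)"
proof (cases "s i = 0")
  case False
  then have y: "y i x > 0" using assms by (simp add: dom_def)
  have "((\<lambda>x. (s i)\<^sup>2 / (y i x)\<^sup>2) has_derivative (\<lambda>w. (- 2 / y i x) * ((s i)\<^sup>2 / (y i x)\<^sup>2) * l i w)) (at x)"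
    using y by (auto intro!: derivative_eq_intros y_has_derivative simp: fun_eq_iff field_simps power2_eq_square)
  then show ?thesis using False by (simp add: eigen_def[abs_def] weight_def[abs_def])
qed (simp add: eigen_def[abs_def] weight_def[abs_def])

lemma bilinear_prod: "bilinear (prod x)"
  unfolding bilinear_def prod_def
  by (auto intro!: linearI simp: linear_add[OF lin] linear_cmul[OF lin] algebra_simps sum.distrib scaleR_sum_right)

lemma bilinear_form: "bilinear (form x)"
  unfolding bilinear_def form_def
  by (auto intro!: linearI simp: linear_add[OF lin] linear_cmul[OF lin] algebra_simps sum.distrib sum_distrib_left)

lemma product_ode_prod: "product_ode dom prod"
  unfolding product_ode_def
proof (intro ballI conjI allI bilinear_prod)
  fix x u v assume x: "x \<in> dom"
  show "prod x u v = prod x v u" by (simp add: prod_def mult.commute)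
  have "((\<lambda>y. prod y u v) has_derivative
      (\<lambda>w. \<Sum>i\<in>UNIV. (((1/2) * (eigen i x)\<^sup>2 * l i w) * (l i u * l i v)) *\<^sub>R b i)) (at x)"
    unfolding prod_def
    by (intro has_derivative_sum has_derivative_scaleR_left has_derivative_mult_left eigen_has_derivative x)
  moreover have "(\<Sum>i\<in>UNIV. (((1/2) * (eigen i x)\<^sup>2 * l i w) * (l i u * l i v)) *\<^sub>R b i) =
      (1/2) *\<^sub>R (prod x u (prod x v w) + prod x v (prod x u w) - prod x w (prod x u v))" for w
  proof -
    have "prod x a (prod x c e) = (\<Sum>i\<in>UNIV. ((eigen i x)\<^sup>2 * (l i a * l i c * l i e)) *\<^sub>R b i)" for a c e
      unfolding prod_def l_sum by (simp add: power2_eq_square mult_ac)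
    then show ?thesis by (simp add: scaleR_sum_right mult_ac)
  qed
  ultimately show "((\<lambda>y. prod y u v) has_derivative
      (\<lambda>w. (1/2) *\<^sub>R (prod x u (prod x v w) + prod x v (prod x u w) - prod x w (prod x u v)))) (at x)"
    by simp
qed

lemma metric_ode_form: "metric_ode dom prod form"
  unfolding metric_ode_def
proof (intro ballI conjI allI bilinear_form)
  fix x u v assume x: "x \<in> dom"
  have "((\<lambda>y. form y u v) has_derivative
      (\<lambda>w. \<Sum>i\<in>UNIV. (eigen i x * weight i x * l i w) * (l i u * l i v))) (at x)"
    unfolding form_def by (intro has_derivative_sum has_derivative_mult_left weight_has_derivative x)
  moreover have "(\<Sum>i\<in>UNIV. (eigen i x * weight i x * l i w) * (l i u * l i v)) = form x (prod x u v) w" for w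
    unfolding form_def prod_def l_sum by (simp add: mult_ac)
  ultimately show "((\<lambda>y. form y u v) has_derivative (\<lambda>w. form x (prod x u v) w)) (at x)" by simp
qed

lemma potential_has_derivative:
  assumes "x \<in> dom" shows "(potential has_derivative slope x) (at x)"
proof -
  have "((\<lambda>x. if s i = 0 then (y i x)\<^sup>2 / 2 else - (s i)\<^sup>2 * ln (y i x)) has_derivative
      (\<lambda>w. (if s i = 0 then y i x else - (s i)\<^sup>2 / y i x) * l i w)) (at x)" for i
  proof (cases "s i = 0")
    case True
    have "((\<lambda>x. (y i x)\<^sup>2 / 2) has_derivative (\<lambda>w. y i x * l i w)) (at x)"
      by (auto intro!: derivative_eq_intros y_has_derivative simp: fun_eq_iff)
    with True show ?thesis by simp
  next
    case False
    then have y: "y i x > 0" using assms by (simp add: dom_def)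
    have "((\<lambda>x. - (s i)\<^sup>2 * ln (y i x)) has_derivative (\<lambda>w. - (s i)\<^sup>2 / y i x * l i w)) (at x)"
      using y by (auto intro!: derivative_eq_intros y_has_derivative simp: fun_eq_iff field_simps)
    with False show ?thesis by simp
  qed
  then show ?thesis
    unfolding potential_def[abs_def] slope_def[abs_def] by (intro has_derivative_sum)
qed

lemma slope_has_derivative:
  assumes "x \<in> dom" shows "((\<lambda>x. slope x u) has_derivative form x u) (at x)"
proof -
  have "((\<lambda>x. if s i = 0 then y i x else - (s i)\<^sup>2 / y i x) has_derivative (\<lambda>w. weight i x * l i w)) (at x)" for i
  proof (cases "s i = 0")
    case True
    then show ?thesis using y_has_derivative by (simp add: weight_def)
  next
    case False
    then have y: "y i x > 0" using assms by (simp add: dom_def)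
    have "((\<lambda>x. - (s i)\<^sup>2 / y i x) has_derivative (\<lambda>w. (s i)\<^sup>2 / (y i x)\<^sup>2 * l i w)) (at x)"
      using y by (auto intro!: derivative_eq_intros y_has_derivative simp: fun_eq_iff field_simps power2_eq_square)
    with False show ?thesis by (simp add: weight_def)
  qed
  then have "((\<lambda>x. slope x u) has_derivative (\<lambda>w. \<Sum>i\<in>UNIV. (weight i x * l i w) * l i u)) (at x)"
    unfolding slope_def by (intro has_derivative_sum has_derivative_mult_left)
  then show ?thesis by (simp add: form_def[abs_def] mult_ac)
qed

end

section \<open>The spin model\<close>

text \<open>In the application \<open>B\<close> is a Lorentz form, \<open>p\<close> the apex of its
  cone and \<open>k\<close> the coefficient of the logarithm.\<close>

locale spin_model =
  fixes B :: "'a::euclidean_space \<Rightarrow> 'a \<Rightarrow> real" and p :: 'a and k :: real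
  assumes bil: "bilinear B" and sym: "B u v = B v u"
begin

definition q :: "'a \<Rightarrow> real" where "q x = B (x - p) (x - p)"

definition dom :: "'a set" where "dom = {x. q x > 0}"

text \<open>The part of the product polynomial in \<open>x\<close>, which stays meaningful where
  \<open>q x = 0\<close>. It satisfies \<open>core x u (x - p) = q x *\<^sub>R u\<close>, so
  \<open>x - p\<close> divided by -2 is the unit of \<open>prod x\<close> wherever
  \<open>q x\<close> is nonzero.\<close>

definition core :: "'a \<Rightarrow> 'a \<Rightarrow> 'a \<Rightarrow> 'a" where
  "core x u v = B (x - p) u *\<^sub>R v + B (x - p) v *\<^sub>R u - B u v *\<^sub>R (x - p)"

definition prod :: "'a \<Rightarrow> 'a \<Rightarrow> 'a \<Rightarrow> 'a" where
  "prod x u v = (- 2 / q x) *\<^sub>R core x u v"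

definition form :: "'a \<Rightarrow> 'a \<Rightarrow> 'a \<Rightarrow> real" where
  "form x u v = - 2 * k * (B u v / q x - 2 * B (x - p) u * B (x - p) v / (q x)\<^sup>2)"

definition slope :: "'a \<Rightarrow> 'a \<Rightarrow> real" where
  "slope x u = - 2 * k * (B (x - p) u / q x)"

definition potential :: "'a \<Rightarrow> real" where "potential x = - k * ln (q x)"

lemmas lin = bilinear_ladd[OF bil] bilinear_radd[OF bil] bilinear_lsub[OF bil] bilinear_rsub[OF bil]
  bilinear_lmul[OF bil] bilinear_rmul[OF bil] bilinear_lneg[OF bil] bilinear_rneg[OF bil]

lemma B_has_derivative: "((\<lambda>x. B (x - p) u) has_derivative (\<lambda>w. B w u)) (at x)"
proof -
  have "linear (\<lambda>x. B x u)" using bil by (simp add: bilinear_def)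
  then have "bounded_linear (\<lambda>x. B x u)" using linear_conv_bounded_linear by blast
  then have "((\<lambda>x. B (x - p) u) has_derivative (\<lambda>w. B (w - 0) u)) (at x)"
    by (intro bounded_linear.has_derivative[of "\<lambda>x. B x u"] has_derivative_diff has_derivative_ident has_derivative_const)
  then show ?thesis by simp
qed

lemma q_has_derivative: "(q has_derivative (\<lambda>w. 2 * B (x - p) w)) (at x)"
proof -
  have "bounded_bilinear B" using bil bilinear_conv_bounded_bilinear by blast
  then have "((\<lambda>x. B (x - p) (x - p)) has_derivative (\<lambda>w. B (x - p) (w - 0) + B (w - 0) (x - p))) (at x)"
    by (intro bounded_bilinear.FDERIV has_derivative_diff has_derivative_ident has_derivative_const)
  then show ?thesis by (simp add: q_def[abs_def] sym)
qed

lemma continuous_q: "continuous_on S q"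
  by (intro continuous_at_imp_continuous_on ballI has_derivative_continuous[OF q_has_derivative])

lemma open_dom: "open dom"
  unfolding dom_def by (intro open_Collect_less continuous_q continuous_on_const)

lemma bilinear_prod: "bilinear (prod x)"
  unfolding bilinear_def prod_def core_def by (auto intro!: linearI simp: lin algebra_simps add_divide_distrib)

lemma bilinear_form: "bilinear (form x)"
  unfolding bilinear_def form_def
  by (auto intro!: linearI simp: lin add_divide_distrib diff_divide_distrib algebra_simps)

lemma core_core:
  fixes x :: 'a
  defines "z \<equiv> x - p"
  shows "core x a (core x c e) = (B z a * B z c) *\<^sub>R e + (B z a * B z e) *\<^sub>R c - (B z a * B c e) *\<^sub>R z
    + (2 * B z c * B z e - B c e * q x) *\<^sub>R a - (B z c * B a e + B z e * B a c - B c e * B z a) *\<^sub>R z"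
  unfolding core_def q_def z_def[symmetric]
  by (simp add: lin sym[of a z] sym[of c z] sym[of e z] algebra_simps scaleR_2[symmetric])

text \<open>Up to the common factor \<open>2 / Q\<^sup>2\<close>, the three double products on the
  right collapse to \<open>2 * B z w\<close> times \<open>core x u v\<close> minus \<open>Q\<close>
  times the derivative of \<open>core\<close>. These are the two terms of the product rule for
  \<open>- 2 / q x\<close> times \<open>core\<close>.\<close>

lemma product_ode_prod: "product_ode dom prod"
  unfolding product_ode_def
proof (intro ballI conjI allI bilinear_prod)
  fix x u v assume x: "x \<in> dom"
  show "prod x u v = prod x v u" by (simp add: prod_def core_def sym[of u v])
  have q: "q x > 0" using x by (simp add: dom_def)
  define z where "z = x - p"
  have dN: "((\<lambda>x. core x u v) has_derivative (\<lambda>w. B w u *\<^sub>R v + B w v *\<^sub>R u - B u v *\<^sub>R (w - 0))) (at x)"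
    unfolding core_def
    by (intro has_derivative_add has_derivative_diff has_derivative_scaleR_left has_derivative_scaleR_right
        has_derivative_ident has_derivative_const B_has_derivative)
  have dq: "((\<lambda>x. - 2 / q x) has_derivative (\<lambda>w. (4 / (q x)\<^sup>2) * B z w)) (at x)"
    using q by (auto intro!: derivative_eq_intros q_has_derivative simp: fun_eq_iff field_simps power2_eq_square z_def)
  have eq: "(- 2 / q x) *\<^sub>R (B w u *\<^sub>R v + B w v *\<^sub>R u - B u v *\<^sub>R (w - 0)) + ((4 / (q x)\<^sup>2) * B z w) *\<^sub>R core x u v
      = (1/2) *\<^sub>R (prod x u (prod x v w) + prod x v (prod x u w) - prod x w (prod x u v))" for w
  proof -
    define Q where "Q = q x"
    have Q: "B z z = Q" "Q > 0" using q by (auto simp: Q_def q_def z_def)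
    have nz: "core x u v = B z u *\<^sub>R v + B z v *\<^sub>R u - B u v *\<^sub>R z" for u v by (simp add: core_def z_def)
    define r where "r = - 2 / Q"
    have r: "r * r / 2 = 2 / Q\<^sup>2" by (simp add: r_def power2_eq_square)
    have prodN: "prod x u v = r *\<^sub>R core x u v" for u v by (simp add: prod_def Q_def r_def)
    note NN = core_core[of x, folded z_def Q_def]
    have Nscale: "core x a (r *\<^sub>R c) = r *\<^sub>R core x a c" for a r c
      by (simp add: nz lin algebra_simps)
    have double: "(a * (c * 2)) *\<^sub>R t = (a * c) *\<^sub>R t + (a * c) *\<^sub>R t" for a c and t :: 'a
      by (simp flip: scaleR_left_distrib)
    have "(1/2) *\<^sub>R (prod x u (prod x v w) + prod x v (prod x u w) - prod x w (prod x u v))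
        = (2 / Q\<^sup>2) *\<^sub>R (core x u (core x v w) + core x v (core x u w) - core x w (core x u v))"
      unfolding r[symmetric] by (simp add: prodN Nscale algebra_simps)
    also have "core x u (core x v w) + core x v (core x u w) - core x w (core x u v)
        = (2 * B z w) *\<^sub>R core x u v - Q *\<^sub>R (B w u *\<^sub>R v + B w v *\<^sub>R u - B u v *\<^sub>R w)"
      unfolding NN unfolding nz
      by (simp add: sym[of w] sym[of v u] algebra_simps double)
    also have "(2 / Q\<^sup>2) *\<^sub>R ((2 * B z w) *\<^sub>R core x u v - Q *\<^sub>R (B w u *\<^sub>R v + B w v *\<^sub>R u - B u v *\<^sub>R w))
        = (- 2 / Q) *\<^sub>R (B w u *\<^sub>R v + B w v *\<^sub>R u - B u v *\<^sub>R (w - 0)) + ((4 / Q\<^sup>2) * B z w) *\<^sub>R core x u v"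
      using Q(2) unfolding scaleR_diff_right scaleR_scaleR by (simp add: power2_eq_square)
    finally show ?thesis by (simp add: Q_def)
  qed
  have "((\<lambda>y. prod y u v) has_derivative (\<lambda>w. (- 2 / q x) *\<^sub>R (B w u *\<^sub>R v + B w v *\<^sub>R u - B u v *\<^sub>R (w - 0))
      + ((4 / (q x)\<^sup>2) * B z w) *\<^sub>R core x u v)) (at x)"
    using has_derivative_scaleR[OF dq dN] by (simp only: prod_def)
  then show "((\<lambda>y. prod y u v) has_derivative
      (\<lambda>w. (1/2) *\<^sub>R (prod x u (prod x v w) + prod x v (prod x u w) - prod x w (prod x u v)))) (at x)"
    unfolding eq .
qed

lemma metric_ode_form: "metric_ode dom prod form"
  unfolding metric_ode_def
proof (intro ballI conjI allI bilinear_form)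
  fix x u v assume x: "x \<in> dom"
  define z where "z = x - p"
  have q: "q x > 0" and Bz: "B z z = q x" using x by (auto simp: dom_def z_def q_def)
  have "((\<lambda>y. form y u v) has_derivative (\<lambda>w. - 2 * k * (- 2 * B u v * B z w / (q x)\<^sup>2
      - 2 * B w u * B z v / (q x)\<^sup>2 - 2 * B z u * B w v / (q x)\<^sup>2 + 8 * B z u * B z v * B z w / (q x)^3))) (at x)"
    unfolding form_def z_def using q
    by (auto intro!: derivative_eq_intros q_has_derivative B_has_derivative
        simp: fun_eq_iff field_simps power2_eq_square power3_eq_cube)
  moreover have "- 2 * k * (- 2 * B u v * B z w / (q x)\<^sup>2
      - 2 * B w u * B z v / (q x)\<^sup>2 - 2 * B z u * B w v / (q x)\<^sup>2 + 8 * B z u * B z v * B z w / (q x)^3)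
      = form x (prod x u v) w" for w
    unfolding form_def prod_def core_def z_def[symmetric] using q
    by (simp add: lin Bz sym[of w] sym[of u z] sym[of v z] field_simps power2_eq_square power3_eq_cube)
  ultimately show "((\<lambda>y. form y u v) has_derivative (\<lambda>w. form x (prod x u v) w)) (at x)" by simp
qed

lemma potential_has_derivative:
  assumes "x \<in> dom" shows "(potential has_derivative slope x) (at x)"
  unfolding potential_def[abs_def] slope_def[abs_def] using assms
  by (auto intro!: derivative_eq_intros q_has_derivative simp: dom_def fun_eq_iff field_simps)

lemma slope_has_derivative:
  assumes "x \<in> dom" shows "((\<lambda>x. slope x u) has_derivative form x u) (at x)"
  unfolding form_def[abs_def] slope_def using assms
  by (auto intro!: derivative_eq_intros q_has_derivative B_has_derivative
      simp: dom_def fun_eq_iff field_simps power2_eq_square sym[of u])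

end

section \<open>Identification with the models\<close>

lemma equivalent_to_open_part_graphI:
  fixes A :: "real^'n::finite^'n"
  assumes op: "open \<Omega>" and A: "invertible A"
    and D: "\<And>x. x \<in> \<Omega> \<Longrightarrow> A *v x + d \<in> D"
    and f: "\<And>x. x \<in> \<Omega> \<Longrightarrow> f x = g (A *v x + d) + q \<bullet> x + b"
  shows "equivalent_to_open_part (graph_over \<Omega> f) (graph_over D g)"
proof -
  obtain C where AC: "A ** C = mat 1" and CA: "C ** A = mat 1"
    using A by (auto simp: invertible_def)
  \<comment> \<open>The affine difference between \<open>f\<close> and the model is removed by the
    shear with \<open>- q\<close> and the vertical shift by \<open>- b\<close>.\<close>
  define \<phi> where "\<phi> = (\<lambda>(x, t). (A *v x, (- q) \<bullet> x + t) + (d, - b))"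
  define N where "N = \<phi> ` graph_over \<Omega> f"
  have \<phi>: "\<phi> (x, f x) = (A *v x + d, g (A *v x + d))" if "x \<in> \<Omega>" for x
    using f[OF that] by (simp add: \<phi>_def)
  have CAx: "C *v (A *v x + d - d) = x" for x
    by (simp add: matrix_vector_mul_assoc CA)
  have ACy: "A *v (C *v (y - d)) + d = y" for y
    by (simp add: matrix_vector_mul_assoc AC)
  \<comment> \<open>The image is cut out of the model graph by an open condition on the base point
    alone, which gives relative openness.\<close>
  have N: "N = graph_over D g \<inter> (\<lambda>z. C *v (fst z - d)) -` \<Omega>"
  proof
    show "N \<subseteq> graph_over D g \<inter> (\<lambda>z. C *v (fst z - d)) -` \<Omega>"
      using D \<phi> CAx by (auto simp: N_def graph_over_def)
    show "graph_over D g \<inter> (\<lambda>z. C *v (fst z - d)) -` \<Omega> \<subseteq> N"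
    proof
      fix z assume "z \<in> graph_over D g \<inter> (\<lambda>z. C *v (fst z - d)) -` \<Omega>"
      then obtain y where y: "z = (y, g y)" "C *v (y - d) \<in> \<Omega>" by (auto simp: graph_over_def)
      then have "z = \<phi> (C *v (y - d), f (C *v (y - d)))" by (simp only: \<phi>[OF y(2)] ACy)
      with y(2) show "z \<in> N" by (auto simp: N_def graph_over_def)
    qed
  qed
  have "open ((\<lambda>z :: (real^'n) \<times> real. C *v (fst z - d)) -` \<Omega>)"
    by (intro open_vimage op linear_continuous_on_compose[OF _ matrix_vector_mul_linear] continuous_intros)
  then have "openin (top_of_set (graph_over D g)) N"
    unfolding N by (rule openin_open_Int)
  moreover have "calabi_affine \<phi>" unfolding calabi_affine_def \<phi>_def using A by blast
  ultimately show ?thesis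
    unfolding equivalent_to_open_part_def calabi_equivalent_def N_def by blast
qed

context parallel_calabi
begin

text \<open>Both cases end here: a model has to agree with \<open>f\<close> in product and metric at
  one point, and only \<open>bdry\<close> needs an argument specific to the model.\<close>

lemma match_model:
  assumes con: "connected \<Omega>"
    and M: "product_ode D M" "open D" "metric_ode D M h"
    and g: "\<And>x. x \<in> D \<Longrightarrow> (g has_derivative G x) (at x)"
      "\<And>x u. x \<in> D \<Longrightarrow> ((\<lambda>y. G y u) has_derivative h x u) (at x)"
    and x0: "x0 \<in> \<Omega>" "x0 \<in> D" "calabi_product f x0 = M x0" "hessian_form f x0 = h x0"
    and bdry: "\<And>x. x \<in> \<Omega> \<Longrightarrow> x \<in> closure {y\<in>\<Omega>. y \<in> D \<and> calabi_product f y = M y} \<Longrightarrow> x \<in> D"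
  shows "\<Omega> \<subseteq> D" "\<And>x. x \<in> \<Omega> \<Longrightarrow> calabi_product f x = M x" "\<And>x. x \<in> \<Omega> \<Longrightarrow> hessian_form f x = h x"
    "\<exists>q b. \<forall>x\<in>\<Omega>. f x = g x + q \<bullet> x + b"
proof -
  have *: "x \<in> D \<and> calabi_product f x = M x" if "x \<in> \<Omega>" for x
    by (rule product_ode_unique_continuation[OF product_ode_calabi op con M(1,2) x0(1-3) bdry that])
  then show sub: "\<Omega> \<subseteq> D" and P: "\<And>x. x \<in> \<Omega> \<Longrightarrow> calabi_product f x = M x" by auto
  have "metric_ode \<Omega> (calabi_product f) h"
    using M(3) sub P unfolding metric_ode_def by (metis subsetD)
  then show H: "hessian_form f x = h x" if "x \<in> \<Omega>" for x
    using metric_ode_unique[OF op con product_ode_calabi metric_ode_calabi, of h x0 x] x0(1,4) that by blast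
  show "\<exists>q b. \<forall>x\<in>\<Omega>. f x = g x + q \<bullet> x + b"
  proof (rule same_hessian_affine[OF op con])
    fix x u assume x: "x \<in> \<Omega>"
    show "(f has_derivative gradient x) (at x)" by (rule gradient_has_derivative[OF x])
    show "((\<lambda>y. gradient y u) has_derivative h x u) (at x)"
      using metric_gradient_has_derivative[OF x, of u] H[OF x] by simp
    show "(g has_derivative G x) (at x)" "((\<lambda>y. G y u) has_derivative h x u) (at x)"
      using g sub x by auto
  qed
qed

text \<open>Contracting with the inverse metric sends the metric to the dimension and the square of
  the covector of \<open>z\<close> to the squared length of \<open>z\<close>.\<close>

lemma scalar_curvature_of_ricci:
  assumes x: "x \<in> \<Omega>"
    and ric: "\<And>j k. ricci (calabi_metric f) j k x =
      \<alpha> * (hessian_form f x (axis j 1) (axis k 1) - \<beta> * hessian_form f x (axis j 1) z * hessian_form f x (axis k 1) z)"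
  shows "scalar_curvature (calabi_metric f) x = \<alpha> * (real CARD('n) - \<beta> * hessian_form f x z z)"
proof -
  define H where "H = hessian f x"
  define I where "I = matrix_inv H"
  have HI: "H ** I = mat 1" and IH: "I ** H = mat 1" using hessian_inverse[OF x] by (auto simp: H_def I_def)
  have "transpose H = H" using hessian_pd[OF x] by (simp add: positive_definite_def H_def)
  from arg_cong[OF this, of "\<lambda>M. M $ _ $ _"] have Hsym: "H $ j $ k = H $ k $ j" for j k
    by (simp add: transpose_def)
  have m1: "hessian_form f x (axis j 1) v = (H *v v) $ j" for j v
    by (simp add: hessian_form_def H_def inner_axis')
  have m2: "(H *v axis k 1) $ j = H $ j $ k" for j k
    by (simp add: matrix_vector_mult_basis column_def)
  have tr: "(\<Sum>j\<in>UNIV. \<Sum>k\<in>UNIV. I $ j $ k * H $ j $ k) = real CARD('n)"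
  proof -
    have "(\<Sum>k\<in>UNIV. I $ j $ k * H $ j $ k) = (I ** H) $ j $ j" for j
      by (simp add: matrix_matrix_mult_def Hsym[of j])
    then show ?thesis by (simp add: IH mat_def)
  qed
  have zz: "(\<Sum>j\<in>UNIV. \<Sum>k\<in>UNIV. I $ j $ k * ((H *v z) $ j * (H *v z) $ k)) = hessian_form f x z z"
  proof -
    have "(\<Sum>j\<in>UNIV. \<Sum>k\<in>UNIV. I $ j $ k * ((H *v z) $ j * (H *v z) $ k)) = (H *v z) \<bullet> (I *v (H *v z))"
      by (simp add: inner_vec_def matrix_vector_mult_def[of I] sum_distrib_left mult_ac)
    also have "\<dots> = hessian_form f x z z"
      by (simp only: matrix_vector_mul_assoc IH matrix_vector_mul_lid hessian_form_def H_def[symmetric] inner_commute)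
    finally show ?thesis .
  qed
  have "scalar_curvature (calabi_metric f) x =
      (\<Sum>j\<in>UNIV. \<Sum>k\<in>UNIV. \<alpha> * (I $ j $ k * H $ j $ k) - \<alpha> * \<beta> * (I $ j $ k * ((H *v z) $ j * (H *v z) $ k)))"
    unfolding scalar_curvature_def ric m1 m2
    by (simp add: calabi_metric_def I_def H_def algebra_simps)
  also have "\<dots> = \<alpha> * real CARD('n) - \<alpha> * \<beta> * hessian_form f x z z"
    by (simp only: sum_subtractf sum_distrib_left[symmetric] tr zz)
  finally show ?thesis by (simp add: algebra_simps)
qed

end


text \<open>The two traces required by \<open>ricci_product\<close>. Each summand of
  \<open>core\<close> and \<open>core_core\<close>, read as an operator on the basis vector, is a
  multiple of the identity or has rank one.\<close>

lemma spin_model_trace: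
  fixes B :: "real^'n::finite \<Rightarrow> real^'n \<Rightarrow> real" and p x a c :: "real^'n"
  assumes "spin_model B"
  defines "N \<equiv> spin_model.core B p" and "z \<equiv> x - p"
  shows "(\<Sum>i\<in>UNIV. N x a (N x c (axis i 1)) $ i) = (real CARD('n) + 2) * (B z a * B z c) - 2 * spin_model.q B p x * B a c"
    and "(\<Sum>i\<in>UNIV. N x (axis i 1) a $ i) = real CARD('n) * B z a"
proof -
  interpret spin_model B p by fact
  have L: "linear (\<lambda>e. B e v)" "linear (\<lambda>e. B v e)" for v
    using bil by (auto simp: bilinear_def)
  have S: "(\<Sum>i\<in>UNIV. B v (axis i 1) * u $ i) = B v u" for u v
    using linear_axis_expand[OF L(2), of v u] by (simp add: mult.commute)
  have zz: "B z z = q x" by (simp add: q_def z_def)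
  have T: "(\<Sum>i\<in>(UNIV :: 'n set). axis i (1::real) $ i) = real CARD('n)" by simp
  have "(\<Sum>i\<in>UNIV. N x a (N x c (axis i 1)) $ i) =
      (\<Sum>i\<in>UNIV. (B z a * B z c) * axis i (1::real) $ i + B z a * (B z (axis i 1) * c $ i) - B z a * (B c (axis i 1) * z $ i)
      + 2 * B z c * (B z (axis i 1) * a $ i) - q x * (B c (axis i 1) * a $ i)
      - (B z c * (B a (axis i 1) * z $ i) + B a c * (B z (axis i 1) * z $ i) - B z a * (B c (axis i 1) * z $ i)))"
    unfolding N_def core_core z_def[symmetric] by (intro sum.cong refl) (simp add: algebra_simps)
  also have "\<dots> = (real CARD('n) + 2) * (B z a * B z c) - 2 * q x * B a c"
    by (simp only: sum.distrib sum_subtractf sum_distrib_left[symmetric] S T)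
      (simp add: sym[of c z] sym[of a z] sym[of c a] zz algebra_simps)
  finally show "(\<Sum>i\<in>UNIV. N x a (N x c (axis i 1)) $ i) = (real CARD('n) + 2) * (B z a * B z c) - 2 * q x * B a c" .
  have "(\<Sum>i\<in>UNIV. N x (axis i 1) a $ i) =
      (\<Sum>i\<in>UNIV. B z (axis i 1) * a $ i + B z a * axis i (1::real) $ i - B a (axis i 1) * z $ i)"
    unfolding N_def core_def z_def[symmetric] by (intro sum.cong refl) (simp add: sym[of a])
  also have "\<dots> = real CARD('n) * B z a"
    by (simp only: sum.distrib sum_subtractf sum_distrib_left[symmetric] S T) (simp add: sym[of a])
  finally show "(\<Sum>i\<in>UNIV. N x (axis i 1) a $ i) = real CARD('n) * B z a" .
qed

lemma invertible_rows:
  fixes l :: "'n::finite \<Rightarrow> real^'n \<Rightarrow> real"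
  assumes lin: "\<And>i. linear (l i)" and inj: "\<And>w. (\<And>i. l i w = 0) \<Longrightarrow> w = 0"
  defines "A \<equiv> \<chi> i j. l i (axis j 1)"
  shows "A *v w = (\<chi> i. l i w)" "invertible A"
proof -
  show eq: "A *v w = (\<chi> i. l i w)" for w
    using linear_axis_expand[OF lin, of _ w]
    by (simp add: A_def matrix_vector_mult_def vec_eq_iff mult.commute)
  have "A *v w = 0 \<longrightarrow> w = 0" for w
    using inj[of w] by (auto simp: eq vec_eq_iff)
  then show "invertible A"
    by (simp add: invertible_left_inverse matrix_left_invertible_ker)
qed

section \<open>Dimension three: the split and the spin case\<close>

locale parallel_calabi3 = parallel_calabi f \<Omega> for f :: "real^3 \<Rightarrow> real" and \<Omega> +
  assumes con: "connected \<Omega>"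
begin

lemma split_or_spin_at:
  assumes x: "x \<in> \<Omega>"
  shows "(\<exists>a b c l1 l2 l3. split_basis (hessian_form f x) (calabi_product f x) a b c l1 l2 l3)
    \<or> (\<exists>a b c n. spin_basis (hessian_form f x) (calabi_product f x) a b c n)"
proof (rule form_split_or_spin)
  show "hessian_form f x (calabi_product f x u v) w = hessian_form f x (calabi_product f x u w) v" for u v w
    by (metis metric_product[OF x] third_sym[OF x])
qed (rule bilinear_metric metric_sym[OF x] metric_pos[OF x] bilinear_product product_sym[OF x]
    product_ode_derivation[OF product_ode_calabi op x] | assumption)+

lemma split_equivalent:
  assumes x0: "x0 \<in> \<Omega>"
    and basis: "split_basis (hessian_form f x0) (calabi_product f x0) a b c l1 l2 l3"
  shows "equivalent_to_open_part (graph_over \<Omega> f) elliptic_paraboloid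
    \<or> (\<exists>r c. 1 \<le> r \<and> r \<le> 3 \<and> (\<forall>i\<in>{1..r}. c i > 0)
          \<and> equivalent_to_open_part (graph_over \<Omega> f) (Q_hypersurface r c))"
proof -
  define h where "h = hessian_form f x0"
  define P where "P = calabi_product f x0"
  have bh: "bilinear h" and sh: "h u v = h v u" and bP: "bilinear P" and sP: "P u v = P v u" for u v
    by (auto simp: h_def P_def bilinear_metric metric_sym[OF x0] bilinear_product product_sym[OF x0])
  note B = basis[folded h_def P_def, unfolded split_basis_def orthonormal3_def]
  have o: "orthonormal3 h a b c" using B by (simp add: orthonormal3_def)
  define bb :: "3 \<Rightarrow> real^3" where "bb i = (if i = 1 then a else if i = 2 then b else c)" for i
  define L :: "3 \<Rightarrow> real" where "L i = (if i = 1 then l1 else if i = 2 then l2 else l3)" for i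
  define l where "l i u = h u (bb i)" for i u
  \<comment> \<open>The model eigenvalue at \<open>x0\<close> is \<open>- 2 / s i\<close> and has to
    equal \<open>L i\<close>. As \<open>L i \<le> 0\<close>, the point \<open>x0\<close> lies on the
    positive side required by the model domain.\<close>
  define s where "s i = (if L i = 0 then 0 else - 2 / L i)" for i
  have bb: "bb 1 = a" "bb 2 = b" "bb 3 = c" and LL: "L 1 = l1" "L 2 = l2" "L 3 = l3"
    by (simp_all add: bb_def L_def)
  have L_le: "\<forall>i. L i \<le> 0" using B by (simp add: forall_3 LL)
  have s_ge: "s i \<ge> 0" "s i = 0 \<longleftrightarrow> L i = 0" for i
    using spec[OF L_le, of i] by (auto simp: s_def divide_simps)
  have linl: "linear (l i)" for i
    using bh by (simp add: l_def[abs_def] bilinear_def)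
  have dual: "\<forall>i j. l i (bb j) = (if i = j then 1 else 0)"
    using B by (simp add: forall_3 l_def bb sh[of b a] sh[of c a] sh[of c b])
  have expand: "u = (l 1 u) *\<^sub>R a + (l 2 u) *\<^sub>R b + (l 3 u) *\<^sub>R c" for u
    using form_orthonormal3_expand[OF bh sh o, of u] by (simp add: l_def bb)
  interpret S: split_model bb l s x0
    by (rule split_model.intro) (simp_all only: linl dual)
  have y0: "S.y i x0 = s i" for i by (simp add: S.y_def linear_0[OF linl])
  have x0D: "x0 \<in> S.dom" using s_ge by (simp add: S.dom_def y0 less_le)
  have eig0: "S.eigen i x0 = L i" for i by (simp add: S.eigen_def y0 s_ge) (simp add: s_def)
  have wei0: "S.weight i x0 = 1" for i by (simp add: S.weight_def y0)
  have P0: "P = S.prod x0"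
  proof (intro ext)
    fix u v
    have "P u v = P ((l 1 u) *\<^sub>R a + (l 2 u) *\<^sub>R b + (l 3 u) *\<^sub>R c) ((l 1 v) *\<^sub>R a + (l 2 v) *\<^sub>R b + (l 3 v) *\<^sub>R c)"
      using expand[of u] expand[of v] by simp
    then show "P u v = S.prod x0 u v"
      using B by (simp add: S.prod_def sum_3 eig0 bb LL bilinear_ladd[OF bP] bilinear_radd[OF bP]
          bilinear_lmul[OF bP] bilinear_rmul[OF bP] sP[of b a] sP[of c a] sP[of c b] mult_ac)
  qed
  have h0: "h = S.form x0"
  proof (intro ext)
    fix u v
    have "h u v = h u ((l 1 v) *\<^sub>R a + (l 2 v) *\<^sub>R b + (l 3 v) *\<^sub>R c)"
      using expand[of v] by simp
    then show "h u v = S.form x0 u v"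
      by (simp add: S.form_def sum_3 wei0 bilinear_radd[OF bh] bilinear_rmul[OF bh] l_def bb mult_ac)
  qed
  have bdry: "x \<in> S.dom" if x: "x \<in> \<Omega>" "x \<in> closure {y\<in>\<Omega>. y \<in> S.dom \<and> calabi_product f y = S.prod y}" for x
    unfolding S.dom_def
  proof (intro CollectI allI impI)
    fix i assume si: "s i \<noteq> 0"
    let ?Z = "{y\<in>\<Omega>. y \<in> S.dom \<and> calabi_product f y = S.prod y}"
    have "closure ?Z \<subseteq> {x. 0 \<le> S.y i x}"
    proof (rule closure_minimal)
      show "?Z \<subseteq> {x. 0 \<le> S.y i x}" using si by (auto simp: S.dom_def less_imp_le)
      show "closed {x. 0 \<le> S.y i x}" by (intro closed_Collect_le continuous_on_const S.continuous_y)
    qed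
    then have ge: "0 \<le> S.y i x" using x(2) by blast
    \<comment> \<open>On the agreement set this is the formula for the eigenvalue multiplied by the
      coordinate. \<open>calabi_product f\<close> is continuous at \<open>x\<close> because
      \<open>x\<close> lies in \<open>\<Omega>\<close>, so the identity persists there, and a zero
      of the coordinate would give \<open>bb i = 0\<close>.\<close>
    have "S.y i x *\<^sub>R calabi_product f x (bb i) (bb i) + 2 *\<^sub>R bb i = 0"
    proof (rule zero_on_closure[OF _ x(2), where g = "\<lambda>y. S.y i y *\<^sub>R calabi_product f y (bb i) (bb i) + 2 *\<^sub>R bb i"])
      obtain D where "((\<lambda>y. calabi_product f y (bb i) (bb i)) has_derivative D) (at x)"
        using product_differentiable[OF x(1)] unfolding differentiable_def by blast
      then show "continuous (at x) (\<lambda>y. S.y i y *\<^sub>R calabi_product f y (bb i) (bb i) + 2 *\<^sub>R bb i)"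
        by (intro continuous_intros has_derivative_continuous[OF S.y_has_derivative])
          (rule has_derivative_continuous)
      fix z assume z: "z \<in> ?Z"
      have "S.prod z (bb i) (bb i) = (\<Sum>j\<in>UNIV. if j = i then S.eigen i z *\<^sub>R bb i else 0)"
        unfolding S.prod_def using dual by (intro sum.cong) auto
      then have "S.prod z (bb i) (bb i) = S.eigen i z *\<^sub>R bb i" by simp
      moreover have "S.y i z > 0" using z si by (auto simp: S.dom_def)
      ultimately show "S.y i z *\<^sub>R calabi_product f z (bb i) (bb i) + 2 *\<^sub>R bb i = 0"
        using z si by (simp add: S.eigen_def)
    qed
    moreover have "bb i \<noteq> 0"
      using dual linear_0[OF linl] by (metis zero_neq_one)
    ultimately have "S.y i x \<noteq> 0" by auto
    with ge show "S.y i x > 0" by simp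
  qed
  note match = match_model[OF con S.product_ode_prod S.open_dom S.metric_ode_form
      S.potential_has_derivative S.slope_has_derivative x0 x0D P0[unfolded P_def] h0[unfolded h_def] bdry]
  obtain q0 b0 where f_eq: "\<And>x. x \<in> \<Omega> \<Longrightarrow> f x = S.potential x + q0 \<bullet> x + b0"
    using match(4) by blast
  have sub: "\<Omega> \<subseteq> S.dom" by (rule match(1))
  define A :: "real^3^3" where "A = (\<chi> i j. l i (axis j 1))"
  define d :: "real^3" where "d = (\<chi> i. s i - l i x0)"
  have inj: "w = 0" if "\<And>i. l i w = 0" for w
    using expand[of w] that by simp
  have A: "A *v w = (\<chi> i. l i w)" "invertible A" for w
    unfolding A_def using invertible_rows[of l, OF linl inj] by blast+
  have Ad: "A *v x + d = (\<chi> i. S.y i x)" for x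
    by (simp add: A(1) d_def S.y_def linear_diff[OF linl] vec_eq_iff)
  have reduce: "equivalent_to_open_part (graph_over \<Omega> f) (graph_over D g)"
    if "\<And>x. x \<in> S.dom \<Longrightarrow> A *v x + d \<in> D" "\<And>x. g (A *v x + d) = S.potential x" for D g
    by (rule equivalent_to_open_part_graphI[OF op A(2)]) (use that sub f_eq in auto)
  define C where "C k = (s (of_nat k))\<^sup>2" for k
  have Cpos: "C k > 0" if "L (of_nat k) \<noteq> 0" for k
    using that s_ge by (simp add: C_def)
  have sets: "{1..1::nat} = {1}" "{1..2::nat} = {1,2}" "{1..3::nat} = {1,2,3}" "{2..3::nat} = {2,3}" "{3..3::nat} = {3}" "{1+1..3::nat} = {2,3}"
    "{2+1..3::nat} = {3}" "{3+1..3::nat} = {}"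
    by auto
  have Qcase: "?thesis" if r: "1 \<le> r" "r \<le> 3" and Lr: "\<And>i. i \<in> {1..r} \<Longrightarrow> L (of_nat i) \<noteq> 0"
    "\<And>i. i \<in> {r+1..3} \<Longrightarrow> L (of_nat i) = 0" for r
  proof -
    have "equivalent_to_open_part (graph_over \<Omega> f) (Q_hypersurface r C)"
      unfolding Q_hypersurface_def
    proof (rule reduce)
      show "A *v x + d \<in> {x. \<forall>i\<in>{1..r}. x $ of_nat i > 0}" if "x \<in> S.dom" for x
        using that Lr(1) by (auto simp: Ad S.dom_def s_ge)
      fix x
      \<comment> \<open>\<open>of_nat\<close> maps the numbers 1, 2, 3 bijectively onto the index
        type, so a sum over the type can be split after \<open>r\<close>.\<close>
      have "(\<Sum>i\<in>UNIV. F i) = (\<Sum>i=1..r. F (of_nat i)) + (\<Sum>i=r+1..3. F (of_nat i))" for F :: "3 \<Rightarrow> real"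
      proof -
        have "(\<Sum>i=1..r. F (of_nat i)) + (\<Sum>i=r+1..3. F (of_nat i)) = (\<Sum>i=1..3. F (of_nat i))"
          using r sum.ub_add_nat[of 1 r "\<lambda>i. F (of_nat i)" "3 - r"] by simp
        also have "\<dots> = (\<Sum>i\<in>UNIV. F i)" unfolding sets sum_3 by simp
        finally show ?thesis by simp
      qed
      note split_sum = this
      have "S.potential x = (\<Sum>i=1..r. - C i * ln (S.y (of_nat i) x)) + (\<Sum>i=r+1..3. (S.y (of_nat i) x)\<^sup>2 / 2)"
        unfolding S.potential_def split_sum
        by (intro arg_cong2[where f = "(+)"] sum.cong refl) (simp_all only: s_ge C_def Lr if_True if_False simp_thms)
      then show "- (\<Sum>i = 1..r. C i * ln ((A *v x + d) $ of_nat i)) + (\<Sum>j = r + 1..3. 1 / 2 * ((A *v x + d) $ of_nat j)\<^sup>2) = S.potential x"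
        by (simp add: Ad sum_negf)
    qed
    moreover have "\<forall>i\<in>{1..r}. C i > 0" using Lr(1) Cpos by blast
    ultimately show ?thesis using r by blast
  qed
  \<comment> \<open>The nonzero eigenvalues come first in a \<open>split_basis\<close>;
    \<open>r\<close> is their number, and the coordinates already have the order of
    \<open>Q_hypersurface\<close>.\<close>
  consider "l1 = 0" | "l1 \<noteq> 0" "l2 = 0" | "l1 \<noteq> 0" "l2 \<noteq> 0" "l3 = 0" | "l1 \<noteq> 0" "l2 \<noteq> 0" "l3 \<noteq> 0" by blast
  then show ?thesis
  proof cases
    case 1
    then have "l2 = 0" "l3 = 0" using B by auto
    then have L0: "\<forall>i. L i = 0" using 1 by (simp add: forall_3 LL)
    have "equivalent_to_open_part (graph_over \<Omega> f) elliptic_paraboloid"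
      unfolding elliptic_paraboloid_def
      by (rule reduce) (simp_all only: UNIV_I Ad vec_lambda_beta, simp add: S.potential_def s_ge L0 sum_divide_distrib)
    then show ?thesis ..
  next
    case 2
    then have "l3 = 0" using B by auto
    then show ?thesis using 2 by - (rule Qcase[of 1], simp, simp, (unfold sets, auto simp: LL)+)
  next
    case 3
    then show ?thesis by - (rule Qcase[of 2], simp, simp, (unfold sets, auto simp: LL)+)
  next
    case 4
    then show ?thesis by - (rule Qcase[of 3], simp, simp, (unfold sets, auto simp: LL)+)
  qed
qed

lemma spin_equivalent:
  assumes x0: "x0 \<in> \<Omega>"
    and basis: "spin_basis (hessian_form f x0) (calabi_product f x0) a b c n"
  shows "\<exists>c>0. (\<forall>x\<in>\<Omega>. scalar_curvature (calabi_metric f) x = - 2 * c\<^sup>2)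
    \<and> equivalent_to_open_part (graph_over \<Omega> f) (cone_hypersurface c)"
proof -
  define h where "h = hessian_form f x0"
  define P where "P = calabi_product f x0"
  have bh: "bilinear h" and sh: "h u v = h v u" and bP: "bilinear P" and sP: "P u v = P v u" for u v
    by (auto simp: h_def P_def bilinear_metric metric_sym[OF x0] bilinear_product product_sym[OF x0])
  note B = basis[folded h_def P_def, unfolded spin_basis_def orthonormal3_def]
  have o: "orthonormal3 h a b c" using B by (simp add: orthonormal3_def)
  define s where "s = - 2 / n"
  have n: "n < 0" using B by blast
  have s: "s > 0" "n = - 2 / s" using n by (auto simp: s_def divide_simps)
  define l where "l = (\<lambda>(i::3) u. h u (if i = 1 then a else if i = 2 then b else c))"
  have l: "l 1 u = h u a" "l 2 u = h u b" "l 3 u = h u c" for u by (simp_all add: l_def)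
  have linl: "linear (l i)" for i
    using bh by (simp add: l_def bilinear_def)
  note ladd = linear_add[OF linl] linear_cmul[OF linl] linear_diff[OF linl] linear_0[OF linl]
  have dual: "l 1 a = 1" "l 2 a = 0" "l 3 a = 0"
    using B by (simp_all add: l)
  have expand: "u = (l 1 u) *\<^sub>R a + (l 2 u) *\<^sub>R b + (l 3 u) *\<^sub>R c" for u
    using form_orthonormal3_expand[OF bh sh o, of u] by (simp add: l)
  \<comment> \<open>The Lorentz form for which \<open>a\<close> is timelike and \<open>b\<close>,
    \<open>c\<close> are spacelike.\<close>
  define Q where "Q u v = l 1 u * l 1 v - l 2 u * l 2 v - l 3 u * l 3 v" for u v
  \<comment> \<open>The apex is placed so that the unit of the model product at \<open>x0\<close>,
    which is \<open>x0 - p\<close> divided by -2, equals \<open>a\<close> divided by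
    \<open>n\<close>.\<close>
  define p where "p = x0 - s *\<^sub>R a"
  \<comment> \<open>Determined by the metric: at \<open>x0\<close> the model form of
    \<open>b\<close> with itself is \<open>2 * k / s\<^sup>2\<close>, which must be 1.\<close>
  define k where "k = s\<^sup>2 / 2"
  interpret S: spin_model Q p k
  proof (rule spin_model.intro)
    show "bilinear Q"
      unfolding bilinear_def Q_def by (auto intro!: linearI simp: ladd algebra_simps)
  qed (simp add: Q_def mult.commute)
  have q: "S.q x = (l 1 (x - p))\<^sup>2 - ((l 2 (x - p))\<^sup>2 + (l 3 (x - p))\<^sup>2)" for x
    by (simp add: S.q_def Q_def power2_eq_square)
  \<comment> \<open>\<open>S.dom\<close> contains both nappes of the cone; the model graph lies over
    one of them.\<close>
  define D where "D = {x. l 1 (x - p) > sqrt ((l 2 (x - p))\<^sup>2 + (l 3 (x - p))\<^sup>2)}"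
  have D_dom: "D \<subseteq> S.dom"
  proof
    fix x assume "x \<in> D"
    then have "(sqrt ((l 2 (x - p))\<^sup>2 + (l 3 (x - p))\<^sup>2))\<^sup>2 < (l 1 (x - p))\<^sup>2"
      unfolding D_def by (intro power_strict_mono) auto
    then show "x \<in> S.dom" by (simp add: S.dom_def q)
  qed
  have cont_l: "continuous_on T (\<lambda>x. l i (x - p))" for T i
    by (intro linear_continuous_on_compose[OF _ linl] continuous_intros)
  have openD: "open D"
    unfolding D_def by (intro open_Collect_less continuous_intros cont_l)
  have x0p: "x0 - p = s *\<^sub>R a" by (simp add: p_def)
  have lx0: "l 1 (x0 - p) = s" "l 2 (x0 - p) = 0" "l 3 (x0 - p) = 0"
    by (simp_all add: x0p ladd dual)
  have x0D: "x0 \<in> D" using s by (simp add: D_def lx0)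
  have q0: "S.q x0 = s\<^sup>2" by (simp add: q lx0)
  have P0: "P = S.prod x0"
  proof (intro ext)
    fix u v
    have "P u v = P ((l 1 u) *\<^sub>R a + (l 2 u) *\<^sub>R b + (l 3 u) *\<^sub>R c) ((l 1 v) *\<^sub>R a + (l 2 v) *\<^sub>R b + (l 3 v) *\<^sub>R c)"
      using expand[of u] expand[of v] by simp
    also have "\<dots> = n *\<^sub>R ((l 1 u * l 1 v + l 2 u * l 2 v + l 3 u * l 3 v) *\<^sub>R a
        + (l 1 u * l 2 v + l 2 u * l 1 v) *\<^sub>R b + (l 1 u * l 3 v + l 3 u * l 1 v) *\<^sub>R c)"
      using B by (simp add: bilinear_ladd[OF bP] bilinear_radd[OF bP]
          bilinear_lmul[OF bP] bilinear_rmul[OF bP] sP[of b a] sP[of c a] sP[of c b] algebra_simps)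
    also have "\<dots> = n *\<^sub>R (l 1 u *\<^sub>R ((l 1 v) *\<^sub>R a + (l 2 v) *\<^sub>R b + (l 3 v) *\<^sub>R c)
        + l 1 v *\<^sub>R ((l 1 u) *\<^sub>R a + (l 2 u) *\<^sub>R b + (l 3 u) *\<^sub>R c) - Q u v *\<^sub>R a)"
      by (simp add: Q_def algebra_simps)
    also have "\<dots> = n *\<^sub>R (l 1 u *\<^sub>R v + l 1 v *\<^sub>R u - Q u v *\<^sub>R a)"
      by (simp only: expand[symmetric])
    also have "\<dots> = S.prod x0 u v"
      using s by (simp add: S.prod_def S.core_def q0 x0p Q_def ladd dual algebra_simps power2_eq_square)
    finally show "P u v = S.prod x0 u v" .
  qed
  have h0: "h = S.form x0"
  proof (intro ext)
    fix u v
    have "h u v = h u ((l 1 v) *\<^sub>R a + (l 2 v) *\<^sub>R b + (l 3 v) *\<^sub>R c)"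
      using expand[of v] by simp
    then have "h u v = l 1 u * l 1 v + l 2 u * l 2 v + l 3 u * l 3 v"
      by (simp add: bilinear_radd[OF bh] bilinear_rmul[OF bh] l mult_ac)
    then show "h u v = S.form x0 u v"
      using s unfolding S.form_def q0 x0p unfolding Q_def k_def
      by (simp add: ladd dual field_simps power2_eq_square)
  qed
  have bdry: "x \<in> D" if x: "x \<in> \<Omega>" "x \<in> closure {y\<in>\<Omega>. y \<in> D \<and> calabi_product f y = S.prod y}" for x
  proof -
    let ?Z = "{y\<in>\<Omega>. y \<in> D \<and> calabi_product f y = S.prod y}"
    have Zq: "S.q z > 0" if "z \<in> ?Z" for z using that D_dom by (auto simp: S.dom_def)
    have "closure ?Z \<subseteq> {x. sqrt ((l 2 (x - p))\<^sup>2 + (l 3 (x - p))\<^sup>2) \<le> l 1 (x - p)}"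
      by (rule closure_minimal) (auto simp: D_def intro!: closed_Collect_le continuous_intros cont_l)
    then have ge: "sqrt ((l 2 (x - p))\<^sup>2 + (l 3 (x - p))\<^sup>2) \<le> l 1 (x - p)" using x(2) by blast
    obtain E where E: "\<And>u v. ((\<lambda>y. calabi_product f y u v) has_derivative E u v) (at x)"
      using product_differentiable[OF x(1)] unfolding differentiable_def by metis
    have lin_id: "((\<lambda>y. y - p) has_derivative (\<lambda>w. w)) (at x)"
      by (auto intro!: derivative_eq_intros)
    \<comment> \<open>Multiplication by \<open>x - p\<close> is -2 times the identity on the
      agreement set. In the limit this excludes the apex, where \<open>x - p\<close>
      vanishes.\<close>
    have unit: "calabi_product f x a (x - p) + 2 *\<^sub>R a = 0"
    proof (rule zero_on_closure[OF _ x(2), where g = "\<lambda>y. calabi_product f y a (y - p) + 2 *\<^sub>R a"])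
      show "continuous (at x) (\<lambda>y. calabi_product f y a (y - p) + 2 *\<^sub>R a)"
        by (intro continuous_add continuous_const
            has_derivative_continuous[OF has_derivative_bilinear_family[OF op x(1) bilinear_product E lin_id]])
      fix z assume z: "z \<in> ?Z"
      have "S.core z a (z - p) = S.q z *\<^sub>R a"
        by (simp add: S.core_def S.q_def S.sym[of a "z - p"])
      then show "calabi_product f z a (z - p) + 2 *\<^sub>R a = 0"
        using z Zq[OF z] by (simp add: S.prod_def)
    qed
    \<comment> \<open>The formula for the product of \<open>a\<close> with itself, multiplied by
      \<open>q\<close>. It excludes the boundary points other than the apex: there it would force
      \<open>core x a a = 0\<close>, hence \<open>x = p\<close>.\<close>
    have cone: "S.q x *\<^sub>R calabi_product f x a a + 2 *\<^sub>R S.core x a a = 0"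
    proof (rule zero_on_closure[OF _ x(2), where g = "\<lambda>y. S.q y *\<^sub>R calabi_product f y a a + 2 *\<^sub>R S.core y a a"])
      show "continuous (at x) (\<lambda>y. S.q y *\<^sub>R calabi_product f y a a + 2 *\<^sub>R S.core y a a)"
        unfolding S.core_def
        by (intro continuous_intros has_derivative_continuous[OF S.q_has_derivative]
            has_derivative_continuous[OF E] has_derivative_continuous[OF S.B_has_derivative])
      fix z assume z: "z \<in> ?Z"
      then show "S.q z *\<^sub>R calabi_product f z a a + 2 *\<^sub>R S.core z a a = 0"
        using Zq[OF z] by (simp add: S.prod_def)
    qed
    have "S.q x \<noteq> 0"
    proof
      assume "S.q x = 0"
      then have "S.core x a a = 0" using cone by simp
      moreover have "Q (x - p) a = l 1 (x - p)" "Q a a = 1" by (simp_all add: Q_def dual)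
      ultimately have core: "(l 1 (x - p) + l 1 (x - p)) *\<^sub>R a - (x - p) = 0"
        by (simp only: S.core_def scaleR_left_distrib scaleR_one)
      have "x - p = 0"
      proof -
        have "l i ((l 1 (x - p) + l 1 (x - p)) *\<^sub>R a - (x - p)) = 0" for i
          using core ladd by simp
        then have "(l 1 (x - p) + l 1 (x - p)) * l i a = l i (x - p)" for i
          by (simp only: ladd) simp
        from this[of 1] this[of 2] this[of 3] have "l 1 (x - p) = 0" "l 2 (x - p) = 0" "l 3 (x - p) = 0"
          by (simp_all add: dual)
        then show ?thesis using expand[of "x - p"] by simp
      qed
      then have "a = 0" using unit by (simp add: bilinear_rzero[OF bilinear_product])
      then show False using dual(1) ladd by simp
    qed
    then have "(l 1 (x - p))\<^sup>2 \<noteq> (sqrt ((l 2 (x - p))\<^sup>2 + (l 3 (x - p))\<^sup>2))\<^sup>2" by (simp add: q)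
    then have "sqrt ((l 2 (x - p))\<^sup>2 + (l 3 (x - p))\<^sup>2) \<noteq> l 1 (x - p)" by metis
    with ge show ?thesis by (simp add: D_def)
  qed
  have ode: "product_ode D S.prod" "metric_ode D S.prod S.form"
    using S.product_ode_prod S.metric_ode_form D_dom unfolding product_ode_def metric_ode_def by blast+
  note match = match_model[OF con ode(1) openD ode(2)
      S.potential_has_derivative[OF subsetD[OF D_dom]] S.slope_has_derivative[OF subsetD[OF D_dom]]
      x0 x0D P0[unfolded P_def] h0[unfolded h_def] bdry]
  obtain q0 b0 where f_eq: "\<And>x. x \<in> \<Omega> \<Longrightarrow> f x = S.potential x + q0 \<bullet> x + b0"
    using match(4) by blast
  have sub: "\<Omega> \<subseteq> D" by (rule match(1))
  define A :: "real^3^3" where "A = (\<chi> i j. l i (axis j 1))"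
  have inj: "w = 0" if "\<And>i. l i w = 0" for w
    using expand[of w] that by simp
  have A: "A *v w = (\<chi> i. l i w)" "invertible A" for w
    unfolding A_def using invertible_rows[of l, OF linl inj] by blast+
  have Ad: "A *v x + (\<chi> i. - l i p) = (\<chi> i. l i (x - p))" for x
    by (simp add: A(1) ladd vec_eq_iff)
  \<comment> \<open>Chosen so that the coefficient in \<open>cone_hypersurface\<close> is
    \<open>k\<close>; the curvature computation below must produce the same constant.\<close>
  define r where "r = 1 / s"
  have r: "r > 0" "1 / (2 * r\<^sup>2) = k" using s by (auto simp: r_def k_def field_simps)
  have "equivalent_to_open_part (graph_over \<Omega> f) (cone_hypersurface r)"
    unfolding cone_hypersurface_def
  proof (rule equivalent_to_open_part_graphI[OF op A(2)])
    show "A *v x + (\<chi> i. - l i p) \<in> {x. sqrt ((x $ 2)\<^sup>2 + (x $ 3)\<^sup>2) < x $ 1}" if "x \<in> \<Omega>" for x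
      using sub that by (auto simp only: Ad D_def vec_lambda_beta)
    show "f x = - (1 / (2 * r\<^sup>2)) * ln (((A *v x + (\<chi> i. - l i p)) $ 1)\<^sup>2
        - (((A *v x + (\<chi> i. - l i p)) $ 2)\<^sup>2 + ((A *v x + (\<chi> i. - l i p)) $ 3)\<^sup>2)) + q0 \<bullet> x + b0"
      if "x \<in> \<Omega>" for x
      unfolding f_eq[OF that] Ad r(2) S.potential_def q vec_lambda_beta ..
  qed
  moreover have "scalar_curvature (calabi_metric f) x = - 2 * r\<^sup>2" if x: "x \<in> \<Omega>" for x
  proof -
    define z where "z = x - p"
    define e :: "3 \<Rightarrow> real^3" where "e i = axis i 1" for i
    have qx: "S.q x > 0" and Qzz: "Q z z = S.q x" using x sub D_dom by (auto simp: S.dom_def S.q_def z_def)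
    have kp: "k > 0" using s by (simp add: k_def)
    have H: "hessian_form f x = S.form x" by (rule match(3)) (use x in auto)
    have Pm: "calabi_product f x = S.prod x" by (rule match(2)) (use x in auto)
    have core_scale: "S.core x u (t *\<^sub>R v) = t *\<^sub>R S.core x u v" for u v t
      by (simp add: S.core_def S.lin algebra_simps)
    \<comment> \<open>The radial vector \<open>z\<close> has squared length \<open>2 * k\<close>.
      The Ricci tensor vanishes along it and is -1/(2k) times the metric on its complement, so the
      trace has two nonzero contributions and equals -1/k.\<close>
    have "scalar_curvature (calabi_metric f) x =
        (- 1 / (2 * k)) * (real CARD(3) - (1 / (2 * k)) * hessian_form f x z z)"
    proof (rule scalar_curvature_of_ricci[OF x])
      fix i j :: 3
      have "ricci (calabi_metric f) i j x = (1/4) * (\<Sum>m\<in>UNIV. (- 2 / S.q x)\<^sup>2 * S.core x (e i) (S.core x (e j) (axis m 1)) $ m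
          - (- 2 / S.q x)\<^sup>2 * S.core x (axis m 1) (S.core x (e i) (e j)) $ m)"
        unfolding ricci_product[OF x] Pm S.prod_def core_scale by (simp add: e_def power2_eq_square)
      also have "\<dots> = (1/4) * ((- 2 / S.q x)\<^sup>2 * ((real CARD(3) + 2) * (Q z (e i) * Q z (e j)) - 2 * S.q x * Q (e i) (e j))
          - (- 2 / S.q x)\<^sup>2 * (real CARD(3) * Q z (S.core x (e i) (e j))))"
        unfolding sum_subtractf sum_distrib_left[symmetric]
          spin_model_trace[OF S.spin_model_axioms, where p = p and x = x, folded z_def] ..
      also have "Q z (S.core x (e i) (e j)) = 2 * Q z (e i) * Q z (e j) - Q (e i) (e j) * S.q x"
        unfolding S.core_def z_def[symmetric] by (simp add: S.lin Qzz)
      finally have ric: "ricci (calabi_metric f) i j x = (Q (e i) (e j) * S.q x - Q z (e i) * Q z (e j)) / (S.q x)\<^sup>2"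
        by (simp add: power_divide algebra_simps add_divide_distrib diff_divide_distrib)
      have fz: "S.form x v z = 2 * k * (Q z v / S.q x)" for v
        using qx unfolding S.form_def z_def[symmetric] Qzz S.sym[of v z]
        by (simp add: field_simps power2_eq_square)
      show "ricci (calabi_metric f) i j x = - 1 / (2 * k) *
          (hessian_form f x (axis i 1) (axis j 1) - 1 / (2 * k) * hessian_form f x (axis i 1) z * hessian_form f x (axis j 1) z)"
        unfolding ric H fz e_def[symmetric] using kp qx
        unfolding S.form_def z_def[symmetric] by (simp add: field_simps power2_eq_square)
    qed
    also have "hessian_form f x z z = 2 * k"
      using qx unfolding H S.form_def z_def[symmetric] Qzz by (simp add: field_simps power2_eq_square)
    also have "(- 1 / (2 * k)) * (real CARD(3) - (1 / (2 * k)) * (2 * k)) = - 2 * r\<^sup>2"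
      using s by (simp add: k_def r_def field_simps power2_eq_square)
    finally show ?thesis .
  qed
  ultimately show ?thesis using r(1) by blast
qed

end

theorem theorem1p5:
  fixes f :: "real^3 \<Rightarrow> real" and \<Omega> :: "(real^3) set"
  assumes "is_domain \<Omega>"
    and "smooth_on \<Omega> f"
    and "strictly_convex_on \<Omega> f"
    and "parallel3_on \<Omega> (calabi_metric f) (cubic_form f)"
  shows "equivalent_to_open_part (graph_over \<Omega> f) elliptic_paraboloid
    \<or> (\<exists>r c. 1 \<le> r \<and> r \<le> 3 \<and> (\<forall>i\<in>{1..r}. c i > 0)
          \<and> equivalent_to_open_part (graph_over \<Omega> f) (Q_hypersurface r c))
    \<or> (\<exists>c>0. (\<forall>x\<in>\<Omega>. scalar_curvature (calabi_metric f) x = - 2 * c\<^sup>2)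
          \<and> equivalent_to_open_part (graph_over \<Omega> f) (cone_hypersurface c))"
proof -
  interpret parallel_calabi3 f \<Omega>
    using assms by unfold_locales (simp_all add: is_domain_def)
  obtain x0 where x0: "x0 \<in> \<Omega>" using assms(1) by (auto simp: is_domain_def)
  from split_or_spin_at[OF x0] show ?thesis
  proof (elim disjE exE)
    fix a b c l1 l2 l3
    assume "split_basis (hessian_form f x0) (calabi_product f x0) a b c l1 l2 l3"
    then show ?thesis using split_equivalent[OF x0] by blast
  next
    fix a b c n
    assume "spin_basis (hessian_form f x0) (calabi_product f x0) a b c n"
    then show ?thesis using spin_equivalent[OF x0] by blast
  qed
qed

end
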